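(* Let $R$ be a ring with unity, let $\mathcal{X}$ be a semibrick of left $R$-modules and let $Y$ be a left $R$-module. For any $f\in\mathrm{Hom}(X,Y_{\mathcal{X}}(\infty))$ with $X\in\mathcal{X}$, the image of $f$ is contained in $Y$.
   Context: A brick is a finitely presented left $R$-module whose endomorphism ring is a division ring. A semibrick is a class $\mathcal{X}$ of pairwise non-isomorphic bricks with $\mathrm{Hom}(X,X')=0$ for distinct $X,X'\in\mathcal{X}$. $\mathcal{X}$-universal sequences: let $Y$ be a module. For each $X\in\mathcal{X}$, $\mathrm{Ext}^1(X,Y)$ is a left $\mathrm{End}(X)$-module (endomorphisms act by pull-back; compositions written from left to right). Choose a basis $(0\to Y\to M_{X,i}\to X\to 0)_{i\in I_X}$ over the division ring $\mathrm{End}(X)$. The $\mathcal{X}$-universal short exact sequence $0\to Y\to M\to\bigoplus_{X\in\mathcal{X}}X^{(I_X)}\to 0$ starting from $Y$ is the push-out of $0\to\bigoplus_{X}Y^{(I_X)}\to\bigoplus_{X,i}M_{X,i}\to\bigoplus_{X}X^{(I_X)}\to 0$ along the summation map $\bigoplus_X Y^{(I_X)}\to Y$. Define $Y_{\mathcal{X}}(1)=Y$ and, recursively, let $Y_{\mathcal{X}}(i)\to Y_{\mathcal{X}}(i+1)$ be the monomorphism of an $\mathcal{X}$-universal short exact sequence starting from $Y_{\mathcal{X}}(i)$. $Y_{\mathcal{X}}(\infty)$ is the direct limit of this system (well defined up to isomorphism), and $Y$ is viewed as a submodule of $Y_{\mathcal{X}}(\infty)$ via the canonical embedding. *)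

theory Defs
  imports "HOL-Algebra.Module" "HOL-Algebra.AbelCoset"
begin

section \<open>Left modules over a not necessarily commutative ring\<close>

text \<open>
  The locale \<open>module\<close> of the library assumes a commutative ring of scalars, so only its record type
  is reused. The fields \<open>mult\<close> and \<open>one\<close> of that record carry no meaning for a module and are left
  \<open>undefined\<close> in the constructions below.
\<close>

locale left_module = R?: ring R + M?: abelian_group M for R (structure) and M (structure) +
  assumes smult_closed [simp, intro]:
      "\<lbrakk>a \<in> carrier R; x \<in> carrier M\<rbrakk> \<Longrightarrow> a \<odot>\<^bsub>M\<^esub> x \<in> carrier M"
    and smult_l_distr:
      "\<lbrakk>a \<in> carrier R; b \<in> carrier R; x \<in> carrier M\<rbrakk> \<Longrightarrow>
        (a \<oplus>\<^bsub>R\<^esub> b) \<odot>\<^bsub>M\<^esub> x = a \<odot>\<^bsub>M\<^esub> x \<oplus>\<^bsub>M\<^esub> b \<odot>\<^bsub>M\<^esub> x"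
    and smult_r_distr:
      "\<lbrakk>a \<in> carrier R; x \<in> carrier M; y \<in> carrier M\<rbrakk> \<Longrightarrow>
        a \<odot>\<^bsub>M\<^esub> (x \<oplus>\<^bsub>M\<^esub> y) = a \<odot>\<^bsub>M\<^esub> x \<oplus>\<^bsub>M\<^esub> a \<odot>\<^bsub>M\<^esub> y"
    and smult_assoc:
      "\<lbrakk>a \<in> carrier R; b \<in> carrier R; x \<in> carrier M\<rbrakk> \<Longrightarrow>
        (a \<otimes>\<^bsub>R\<^esub> b) \<odot>\<^bsub>M\<^esub> x = a \<odot>\<^bsub>M\<^esub> (b \<odot>\<^bsub>M\<^esub> x)"
    and smult_one [simp]:
      "x \<in> carrier M \<Longrightarrow> \<one>\<^bsub>R\<^esub> \<odot>\<^bsub>M\<^esub> x = x"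

text \<open>Homomorphisms are extensional functions, so that equal homomorphisms are equal terms.\<close>

definition lmod_hom ::
    "('r, 'k) ring_scheme \<Rightarrow> ('r, 'm) module \<Rightarrow> ('r, 'n) module \<Rightarrow> ('m \<Rightarrow> 'n) set" where
  "lmod_hom R M N = {f \<in> carrier M \<rightarrow>\<^sub>E carrier N.
     (\<forall>x\<in>carrier M. \<forall>y\<in>carrier M. f (x \<oplus>\<^bsub>M\<^esub> y) = f x \<oplus>\<^bsub>N\<^esub> f y) \<and>
     (\<forall>r\<in>carrier R. \<forall>x\<in>carrier M. f (r \<odot>\<^bsub>M\<^esub> x) = r \<odot>\<^bsub>N\<^esub> f x)}"

definition lmod_iso ::
    "('r, 'k) ring_scheme \<Rightarrow> ('r, 'm) module \<Rightarrow> ('r, 'n) module \<Rightarrow> ('m \<Rightarrow> 'n) set" where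
  "lmod_iso R M N = {f \<in> lmod_hom R M N. bij_betw f (carrier M) (carrier N)}"

definition zero_hom :: "('r, 'm) module \<Rightarrow> ('r, 'n) module \<Rightarrow> 'm \<Rightarrow> 'n" where
  "zero_hom M N = (\<lambda>x\<in>carrier M. \<zero>\<^bsub>N\<^esub>)"

text \<open>Compositions are written from left to right: the product of \<open>f\<close> and \<open>g\<close> applies \<open>f\<close> first.\<close>

definition End_ring :: "('r, 'k) ring_scheme \<Rightarrow> ('r, 'm) module \<Rightarrow> ('m \<Rightarrow> 'm) ring" where
  "End_ring R M =
    \<lparr>carrier = lmod_hom R M M,
     mult = (\<lambda>f g. compose (carrier M) g f),
     one = (\<lambda>x\<in>carrier M. x),
     zero = zero_hom M M,
     add = (\<lambda>f g. \<lambda>x\<in>carrier M. f x \<oplus>\<^bsub>M\<^esub> g x)\<rparr>"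

definition division_ring :: "('a, 'k) ring_scheme \<Rightarrow> bool" where
  "division_ring D \<longleftrightarrow> ring D \<and> \<one>\<^bsub>D\<^esub> \<noteq> \<zero>\<^bsub>D\<^esub> \<and> Units D = carrier D - {\<zero>\<^bsub>D\<^esub>}"

definition lmod_prod :: "('r, 'm) module \<Rightarrow> ('r, 'n) module \<Rightarrow> ('r, 'm \<times> 'n) module" where
  "lmod_prod M N =
    \<lparr>carrier = carrier M \<times> carrier N,
     mult = undefined, one = undefined,
     zero = (\<zero>\<^bsub>M\<^esub>, \<zero>\<^bsub>N\<^esub>),
     add = (\<lambda>(x, y) (x', y'). (x \<oplus>\<^bsub>M\<^esub> x', y \<oplus>\<^bsub>N\<^esub> y')),
     smult = (\<lambda>r (x, y). (r \<odot>\<^bsub>M\<^esub> x, r \<odot>\<^bsub>N\<^esub> y))\<rparr>"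

definition lmod_sum :: "'i set \<Rightarrow> ('i \<Rightarrow> ('r, 'm) module) \<Rightarrow> ('r, 'i \<Rightarrow> 'm) module" where
  "lmod_sum I M =
    \<lparr>carrier = {f \<in> \<Pi>\<^sub>E i\<in>I. carrier (M i). finite {i \<in> I. f i \<noteq> \<zero>\<^bsub>M i\<^esub>}},
     mult = undefined, one = undefined,
     zero = (\<lambda>i\<in>I. \<zero>\<^bsub>M i\<^esub>),
     add = (\<lambda>f g. \<lambda>i\<in>I. f i \<oplus>\<^bsub>M i\<^esub> g i),
     smult = (\<lambda>r f. \<lambda>i\<in>I. r \<odot>\<^bsub>M i\<^esub> f i)\<rparr>"

definition lmod_quot :: "('r, 'm) module \<Rightarrow> 'm set \<Rightarrow> ('r, 'm set) module" where
  "lmod_quot M N =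
    \<lparr>carrier = a_rcosets\<^bsub>M\<^esub> N,
     mult = undefined, one = undefined,
     zero = N,
     add = (\<lambda>A B. A <+>\<^bsub>M\<^esub> B),
     smult = (\<lambda>r A. \<Union>x\<in>A. N +>\<^bsub>M\<^esub> (r \<odot>\<^bsub>M\<^esub> x))\<rparr>"

definition regular_module :: "('r, 'k) ring_scheme \<Rightarrow> ('r, 'r) module" where
  "regular_module R =
    \<lparr>carrier = carrier R, mult = undefined, one = undefined,
     zero = \<zero>\<^bsub>R\<^esub>, add = add R, smult = mult R\<rparr>"

definition finitely_generated :: "('r, 'k) ring_scheme \<Rightarrow> ('r, 'm) module \<Rightarrow> bool" where
  "finitely_generated R M \<longleftrightarrow>
    (\<exists>S. finite S \<and> S \<subseteq> carrier M \<and>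
      carrier M = {\<Oplus>\<^bsub>M\<^esub>s\<in>S. c s \<odot>\<^bsub>M\<^esub> s | c. c \<in> S \<rightarrow> carrier R})"

definition finitely_presented :: "('r, 'k) ring_scheme \<Rightarrow> ('r, 'm) module \<Rightarrow> bool" where
  "finitely_presented R M \<longleftrightarrow>
    (\<exists>(n::nat) p. let F = lmod_sum {..<n} (\<lambda>_. regular_module R) in
      p \<in> lmod_hom R F M \<and> p ` carrier F = carrier M \<and>
      finitely_generated R (F\<lparr>carrier := {v \<in> carrier F. p v = \<zero>\<^bsub>M\<^esub>}\<rparr>))"

definition lmod_basis ::
    "('d, 'k) ring_scheme \<Rightarrow> ('d, 'v) module \<Rightarrow> 'i set \<Rightarrow> ('i \<Rightarrow> 'v) \<Rightarrow> bool" where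
  "lmod_basis D V I e \<longleftrightarrow>
    e \<in> I \<rightarrow> carrier V \<and>
    (\<forall>A c. finite A \<and> A \<subseteq> I \<and> c \<in> A \<rightarrow> carrier D \<and> (\<Oplus>\<^bsub>V\<^esub>i\<in>A. c i \<odot>\<^bsub>V\<^esub> e i) = \<zero>\<^bsub>V\<^esub>
       \<longrightarrow> (\<forall>i\<in>A. c i = \<zero>\<^bsub>D\<^esub>)) \<and>
    (\<forall>v\<in>carrier V. \<exists>A c. finite A \<and> A \<subseteq> I \<and> c \<in> A \<rightarrow> carrier D \<and>
       v = (\<Oplus>\<^bsub>V\<^esub>i\<in>A. c i \<odot>\<^bsub>V\<^esub> e i))"


section \<open>Semibricks\<close>

definition brick :: "('r, 'k) ring_scheme \<Rightarrow> ('r, 'x) module \<Rightarrow> bool" where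
  "brick R X \<longleftrightarrow> left_module R X \<and> finitely_presented R X \<and> division_ring (End_ring R X)"

definition semibrick :: "('r, 'k) ring_scheme \<Rightarrow> ('r, 'x) module set \<Rightarrow> bool" where
  "semibrick R \<X> \<longleftrightarrow>
    (\<forall>X\<in>\<X>. brick R X) \<and>
    (\<forall>X\<in>\<X>. \<forall>X'\<in>\<X>. X \<noteq> X' \<longrightarrow> lmod_iso R X X' = {} \<and> lmod_hom R X X' = {zero_hom X X'})"


section \<open>Extensions of modules\<close>

record ('r, 'y, 'm, 'x) extension =
  middle :: "('r, 'm) module"
  incl :: "'y \<Rightarrow> 'm"
  proj :: "'m \<Rightarrow> 'x"

text \<open>\<open>is_extension R X Y E\<close> says that \<open>E\<close> is a short exact sequence \<open>0 \<rightarrow> Y \<rightarrow> M \<rightarrow> X \<rightarrow> 0\<close>.\<close>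

definition is_extension ::
    "('r, 'k) ring_scheme \<Rightarrow> ('r, 'x) module \<Rightarrow> ('r, 'y) module \<Rightarrow>
     ('r, 'y, 'm, 'x) extension \<Rightarrow> bool" where
  "is_extension R X Y E \<longleftrightarrow>
    left_module R (middle E) \<and>
    incl E \<in> lmod_hom R Y (middle E) \<and> proj E \<in> lmod_hom R (middle E) X \<and>
    inj_on (incl E) (carrier Y) \<and>
    incl E ` carrier Y = {m \<in> carrier (middle E). proj E m = \<zero>\<^bsub>X\<^esub>} \<and>
    proj E ` carrier (middle E) = carrier X"

definition ext_equiv ::
    "('r, 'k) ring_scheme \<Rightarrow> ('r, 'y) module \<Rightarrow>
     ('r, 'y, 'm, 'x) extension \<Rightarrow> ('r, 'y, 'n, 'x) extension \<Rightarrow> bool" where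
  "ext_equiv R Y E E' \<longleftrightarrow>
    (\<exists>h\<in>lmod_iso R (middle E) (middle E').
      (\<forall>y\<in>carrier Y. h (incl E y) = incl E' y) \<and>
      (\<forall>m\<in>carrier (middle E). proj E' (h m) = proj E m))"

text \<open>Pull-back along \<open>g : X' \<rightarrow> X\<close> of an extension of \<open>X\<close> by \<open>Y\<close>.\<close>

definition pullback_ext ::
    "('r, 'y) module \<Rightarrow> ('r, 'z) module \<Rightarrow> ('z \<Rightarrow> 'x) \<Rightarrow>
     ('r, 'y, 'm, 'x) extension \<Rightarrow> ('r, 'y, 'm \<times> 'z, 'z) extension" where
  "pullback_ext Y X' g E =
    (let P = {(m, x) \<in> carrier (middle E) \<times> carrier X'. proj E m = g x} in
     \<lparr>middle = (lmod_prod (middle E) X')\<lparr>carrier := P\<rparr>,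
      incl = (\<lambda>y\<in>carrier Y. (incl E y, \<zero>\<^bsub>X'\<^esub>)),
      proj = (\<lambda>p\<in>P. snd p)\<rparr>)"

text \<open>Push-out along \<open>h : Y \<rightarrow> Y'\<close> of an extension of \<open>X\<close> by \<open>Y\<close>.\<close>

definition pushout_ext ::
    "('r, 'y) module \<Rightarrow> ('r, 'z) module \<Rightarrow> ('y \<Rightarrow> 'z) \<Rightarrow>
     ('r, 'y, 'm, 'x) extension \<Rightarrow> ('r, 'z, ('z \<times> 'm) set, 'x) extension" where
  "pushout_ext Y Y' h E =
    (let P = lmod_prod Y' (middle E);
         N = (\<lambda>y. (h y, \<ominus>\<^bsub>middle E\<^esub> incl E y)) ` carrier Y
     in \<lparr>middle = lmod_quot P N,
         incl = (\<lambda>y\<in>carrier Y'. N +>\<^bsub>P\<^esub> (y, \<zero>\<^bsub>middle E\<^esub>)),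
         proj = (\<lambda>C\<in>carrier (lmod_quot P N). the_elem ((\<lambda>(y, m). proj E m) ` C))\<rparr>)"

definition prod_ext ::
    "('r, 'y) module \<Rightarrow> ('r, 'y, 'm, 'x) extension \<Rightarrow> ('r, 'y, 'm, 'x) extension \<Rightarrow>
     ('r, 'y \<times> 'y, 'm \<times> 'm, 'x \<times> 'x) extension" where
  "prod_ext Y E E' =
    \<lparr>middle = lmod_prod (middle E) (middle E'),
     incl = (\<lambda>(y, y')\<in>carrier Y \<times> carrier Y. (incl E y, incl E' y')),
     proj = (\<lambda>(m, m')\<in>carrier (middle E) \<times> carrier (middle E'). (proj E m, proj E' m'))\<rparr>"

definition sum_ext ::
    "'j set \<Rightarrow> ('r, 'y) module \<Rightarrow> ('j \<Rightarrow> ('r, 'y, 'm, 'x) extension) \<Rightarrow>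
     ('r, 'j \<Rightarrow> 'y, 'j \<Rightarrow> 'm, 'j \<Rightarrow> 'x) extension" where
  "sum_ext J Y E =
    \<lparr>middle = lmod_sum J (\<lambda>j. middle (E j)),
     incl = (\<lambda>f\<in>carrier (lmod_sum J (\<lambda>_. Y)). \<lambda>j\<in>J. incl (E j) (f j)),
     proj = (\<lambda>f\<in>carrier (lmod_sum J (\<lambda>j. middle (E j))). \<lambda>j\<in>J. proj (E j) (f j))\<rparr>"

definition split_ext ::
    "('r, 'x) module \<Rightarrow> ('r, 'y) module \<Rightarrow> ('r, 'y, 'y \<times> 'x, 'x) extension" where
  "split_ext X Y =
    \<lparr>middle = lmod_prod Y X,
     incl = (\<lambda>y\<in>carrier Y. (y, \<zero>\<^bsub>X\<^esub>)),
     proj = (\<lambda>p\<in>carrier Y \<times> carrier X. snd p)\<rparr>"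

definition baer_sum ::
    "('r, 'x) module \<Rightarrow> ('r, 'y) module \<Rightarrow>
     ('r, 'y, 'm, 'x) extension \<Rightarrow> ('r, 'y, 'm, 'x) extension \<Rightarrow>
     ('r, 'y, ('y \<times> (('m \<times> 'm) \<times> 'x)) set, 'x) extension" where
  "baer_sum X Y E E' =
    pushout_ext (lmod_prod Y Y) Y (\<lambda>(y, y')\<in>carrier Y \<times> carrier Y. y \<oplus>\<^bsub>Y\<^esub> y')
      (pullback_ext (lmod_prod Y Y) X (\<lambda>x\<in>carrier X. (x, x)) (prod_ext Y E E'))"

text \<open>
  Equivalence classes are formed among the extensions whose middle term lives on the type
  \<open>'y \<times> 'x\<close>. This loses nothing: a set-theoretic section of \<open>M \<rightarrow> X\<close> identifies the underlying set
  of \<open>M\<close> with \<open>Y \<times> X\<close>, so every extension of \<open>X\<close> by \<open>Y\<close>, on whatever type, is equivalent to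
  one of these. The argument \<open>E\<close> of \<open>ext_class\<close> may live on an arbitrary type.
\<close>

definition ext_class ::
    "('r, 'k) ring_scheme \<Rightarrow> ('r, 'x) module \<Rightarrow> ('r, 'y) module \<Rightarrow>
     ('r, 'y, 'm, 'x) extension \<Rightarrow> ('r, 'y, 'y \<times> 'x, 'x) extension set" where
  "ext_class R X Y E = {E'. is_extension R X Y E' \<and> ext_equiv R Y E E'}"

text \<open>
  \<open>Ext\<^sup>1(X, Y)\<close> with Baer sums, as a left module over \<open>End_ring R X\<close>, where endomorphisms of \<open>X\<close> act
  by pull-back.
\<close>

definition Ext1 ::
    "('r, 'k) ring_scheme \<Rightarrow> ('r, 'x) module \<Rightarrow> ('r, 'y) module \<Rightarrow>
     ('x \<Rightarrow> 'x, ('r, 'y, 'y \<times> 'x, 'x) extension set) module" where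
  "Ext1 R X Y =
    \<lparr>carrier = ext_class R X Y ` {E :: ('r, 'y, 'y \<times> 'x, 'x) extension. is_extension R X Y E},
     mult = undefined, one = undefined,
     zero = ext_class R X Y (split_ext X Y),
     add = (\<lambda>C D. \<Union>E\<in>C. \<Union>E'\<in>D. ext_class R X Y (baer_sum X Y E E')),
     smult = (\<lambda>d C. \<Union>E\<in>C. ext_class R X Y (pullback_ext Y X d E))\<rparr>"


section \<open>Universal short exact sequences and their direct limit\<close>

definition summation_map :: "'j set \<Rightarrow> ('r, 'y) module \<Rightarrow> ('j \<Rightarrow> 'y) \<Rightarrow> 'y" where
  "summation_map J Y =
    (\<lambda>f\<in>carrier (lmod_sum J (\<lambda>_. Y)). \<Oplus>\<^bsub>Y\<^esub>j\<in>{j \<in> J. f j \<noteq> \<zero>\<^bsub>Y\<^esub>}. f j)"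

text \<open>
  \<open>U\<close> is an \<open>\<X>\<close>-universal short exact sequence starting from \<open>Y\<close>, for the chosen bases
  \<open>(E X i)\<close>, \<open>i \<in> I X\<close>, of \<open>Ext\<^sup>1(X, Y)\<close>. The push-out is only required up to an equivalence of
  extensions, so that the middle term of \<open>U\<close> may live on any type.
\<close>

definition universal_ses ::
    "('r, 'k) ring_scheme \<Rightarrow> ('r, 'x) module set \<Rightarrow> ('r, 'y) module \<Rightarrow>
     (('r, 'x) module \<Rightarrow> 'i set) \<Rightarrow> (('r, 'x) module \<Rightarrow> 'i \<Rightarrow> ('r, 'y, 'e, 'x) extension) \<Rightarrow>
     ('r, 'y, 'm, ('r, 'x) module \<times> 'i \<Rightarrow> 'x) extension \<Rightarrow> bool" where
  "universal_ses R \<X> Y I E U \<longleftrightarrow>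
    (\<forall>X\<in>\<X>. (\<forall>i\<in>I X. is_extension R X Y (E X i)) \<and>
       lmod_basis (End_ring R X) (Ext1 R X Y) (I X) (\<lambda>i. ext_class R X Y (E X i))) \<and>
    (let J = Sigma \<X> I in
      is_extension R (lmod_sum J (\<lambda>(X, i). X)) Y U \<and>
      ext_equiv R Y
        (pushout_ext (lmod_sum J (\<lambda>_. Y)) Y (summation_map J Y) (sum_ext J Y (\<lambda>(X, i). E X i))) U)"

text \<open>
  A system \<open>N 1 \<rightarrow> N 2 \<rightarrow> \<dots>\<close> of modules \<open>N i = Y\<^sub>\<X>(i)\<close> and monomorphisms \<open>\<phi> i : N i \<rightarrow> N (i + 1)\<close>
  obtained from \<open>Y\<close> by iterated choice of bases; the values at index \<open>0\<close> are irrelevant.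
\<close>

definition universal_system ::
    "('r, 'k) ring_scheme \<Rightarrow> ('r, 'x) module set \<Rightarrow> ('r, 'y) module \<Rightarrow>
     (nat \<Rightarrow> ('r, 'x) module \<Rightarrow> 'i set) \<Rightarrow>
     (nat \<Rightarrow> ('r, 'x) module \<Rightarrow> 'i \<Rightarrow> ('r, 'y, 'e, 'x) extension) \<Rightarrow>
     (nat \<Rightarrow> ('r, 'y) module) \<Rightarrow> (nat \<Rightarrow> 'y \<Rightarrow> 'y) \<Rightarrow> bool" where
  "universal_system R \<X> Y I E N \<phi> \<longleftrightarrow>
    N 1 = Y \<and>
    (\<forall>i\<ge>1. \<exists>p. universal_ses R \<X> (N i) (I i) (E i) \<lparr>middle = N (i + 1), incl = \<phi> i, proj = p\<rparr>)"

text \<open>\<open>transition \<phi> i k\<close> is the composite \<open>N i \<rightarrow> N (i + k)\<close>.\<close>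

primrec transition :: "(nat \<Rightarrow> 'y \<Rightarrow> 'y) \<Rightarrow> nat \<Rightarrow> nat \<Rightarrow> 'y \<Rightarrow> 'y" where
  "transition \<phi> i 0 y = y"
| "transition \<phi> i (Suc k) y = \<phi> (i + k) (transition \<phi> i k y)"

definition dirlim_class ::
    "(nat \<Rightarrow> ('r, 'y) module) \<Rightarrow> (nat \<Rightarrow> 'y \<Rightarrow> 'y) \<Rightarrow> nat \<Rightarrow> 'y \<Rightarrow> (nat \<times> 'y) set" where
  "dirlim_class N \<phi> i y =
    {(j, z). 1 \<le> j \<and> z \<in> carrier (N j) \<and>
       (\<exists>k l. i + k = j + l \<and> transition \<phi> i k y = transition \<phi> j l z)}"

text \<open>
  The direct limit of \<open>N 1 \<rightarrow> N 2 \<rightarrow> \<dots>\<close>, as the disjoint union of the \<open>N i\<close> modulo eventual equality.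
  Representatives in \<open>N i\<close> and \<open>N j\<close> are added in \<open>N (i + j)\<close>.
\<close>

definition dirlim ::
    "(nat \<Rightarrow> ('r, 'y) module) \<Rightarrow> (nat \<Rightarrow> 'y \<Rightarrow> 'y) \<Rightarrow> ('r, (nat \<times> 'y) set) module" where
  "dirlim N \<phi> =
    \<lparr>carrier = {dirlim_class N \<phi> i y | i y. 1 \<le> i \<and> y \<in> carrier (N i)},
     mult = undefined, one = undefined,
     zero = dirlim_class N \<phi> 1 \<zero>\<^bsub>N 1\<^esub>,
     add = (\<lambda>C D. \<Union>(i, y)\<in>C. \<Union>(j, z)\<in>D.
       dirlim_class N \<phi> (i + j) (transition \<phi> i j y \<oplus>\<^bsub>N (i + j)\<^esub> transition \<phi> j i z)),
     smult = (\<lambda>r C. \<Union>(i, y)\<in>C. dirlim_class N \<phi> i (r \<odot>\<^bsub>N i\<^esub> y))\<rparr>"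

definition dirlim_embedding ::
    "(nat \<Rightarrow> ('r, 'y) module) \<Rightarrow> (nat \<Rightarrow> 'y \<Rightarrow> 'y) \<Rightarrow> 'y \<Rightarrow> (nat \<times> 'y) set" where
  "dirlim_embedding N \<phi> = (\<lambda>y\<in>carrier (N 1). dirlim_class N \<phi> 1 y)"

end

theory Submission
  imports Defs
begin

text \<open>
  Since \<open>X\<close> is finitely generated and the transition maps are injective, \<open>f\<close> is a homomorphism into
  some \<open>Y\<^sub>\<X>(n)\<close>, and it suffices to show that a homomorphism \<open>g : X \<rightarrow> M\<close> into the middle term of a
  universal sequence \<open>0 \<rightarrow> Y \<rightarrow> M \<rightarrow> \<Oplus> X'\<^sup>(\<^sup>I\<^sup>) \<rightarrow> 0\<close> has image in \<open>Y\<close>. By the semibrick property the only nonzero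
  components of \<open>X \<rightarrow> M \<rightarrow> \<Oplus> X'\<^sup>(\<^sup>I\<^sup>)\<close> are finitely many endomorphisms \<open>d\<^sub>i\<close> of \<open>X\<close>. Pulling the universal
  sequence back along this map gives the class \<open>\<Sum> d\<^sub>i [E\<^sub>i]\<close> in \<open>Ext\<^sup>1(X, Y)\<close>, which vanishes because the
  map lifts to \<open>M\<close>; as the \<open>[E\<^sub>i]\<close> are linearly independent, all \<open>d\<^sub>i\<close> are zero.

  The computation in \<open>Ext\<^sup>1\<close> uses factor sets: an extension is determined up to equivalence by the
  failure of a set-theoretic section to be linear, and Baer sums and pull-backs act on these
  factor sets pointwise and by substitution.
\<close>

section \<open>Modules and homomorphisms\<close>

text \<open>The basis extensions, the stages and the representatives of classes in
  \<open>Ext1\<close> live on different types, so they are not members of one set of extensions. A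
  factor set is a function into \<open>Y\<close>, whatever type carries the middle term, and so
  compares them all. No cocycle identities are ever imposed: the functions that occur arise from
  actual extensions, and \<open>fs_class R X Y a \<noteq> {}\<close> records this.

  The pull-back of the universal sequence is not built as an extension either. Its factor set
  \<open>b\<close> is read off from a set-theoretic lift to the direct sum of the basis extensions,
  and comparing this lift with the given homomorphism into \<open>M\<close> exhibits
  \<open>b\<close> as a coboundary.

  Finite generation of \<open>X\<close> is used twice: to reach a finite stage of the limit, and to
  make the map into the direct sum finitely supported, so that the sum of the
  \<open>d\<^sub>i [E\<^sub>i]\<close> is a linear combination. The argument for one sequence allows
  any module as its start, hence it applies at every stage and carries a homomorphism down to
  \<open>Y\<close>.\<close>

lemma lmod_hom_closed:
  "\<lbrakk>f \<in> lmod_hom R M N; x \<in> carrier M\<rbrakk> \<Longrightarrow> f x \<in> carrier N"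
  by (auto simp: lmod_hom_def)

lemma lmod_hom_add:
  "\<lbrakk>f \<in> lmod_hom R M N; x \<in> carrier M; y \<in> carrier M\<rbrakk> \<Longrightarrow> f (x \<oplus>\<^bsub>M\<^esub> y) = f x \<oplus>\<^bsub>N\<^esub> f y"
  by (auto simp: lmod_hom_def)

lemma lmod_hom_smult:
  "\<lbrakk>f \<in> lmod_hom R M N; r \<in> carrier R; x \<in> carrier M\<rbrakk> \<Longrightarrow> f (r \<odot>\<^bsub>M\<^esub> x) = r \<odot>\<^bsub>N\<^esub> f x"
  by (auto simp: lmod_hom_def)

lemma (in left_module) smult_zero_l: "x \<in> carrier M \<Longrightarrow> \<zero>\<^bsub>R\<^esub> \<odot>\<^bsub>M\<^esub> x = \<zero>\<^bsub>M\<^esub>"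
  using smult_l_distr[of "\<zero>\<^bsub>R\<^esub>" "\<zero>\<^bsub>R\<^esub>" x] M.add.r_cancel_one'[of "\<zero>\<^bsub>R\<^esub> \<odot>\<^bsub>M\<^esub> x" "\<zero>\<^bsub>R\<^esub> \<odot>\<^bsub>M\<^esub> x"]
  by simp

lemma (in left_module) smult_zero_r: "r \<in> carrier R \<Longrightarrow> r \<odot>\<^bsub>M\<^esub> \<zero>\<^bsub>M\<^esub> = \<zero>\<^bsub>M\<^esub>"
  using smult_r_distr[of r "\<zero>\<^bsub>M\<^esub>" "\<zero>\<^bsub>M\<^esub>"] M.add.r_cancel_one'[of "r \<odot>\<^bsub>M\<^esub> \<zero>\<^bsub>M\<^esub>" "r \<odot>\<^bsub>M\<^esub> \<zero>\<^bsub>M\<^esub>"]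
  by simp

lemma (in left_module) smult_minus:
  assumes "r \<in> carrier R" "x \<in> carrier M"
  shows "r \<odot>\<^bsub>M\<^esub> (\<ominus>\<^bsub>M\<^esub> x) = \<ominus>\<^bsub>M\<^esub> (r \<odot>\<^bsub>M\<^esub> x)"
proof -
  have "r \<odot>\<^bsub>M\<^esub> (\<ominus>\<^bsub>M\<^esub> x) \<oplus>\<^bsub>M\<^esub> r \<odot>\<^bsub>M\<^esub> x = \<zero>\<^bsub>M\<^esub>"
    using assms smult_r_distr[of r "\<ominus>\<^bsub>M\<^esub> x" x] by (simp add: M.l_neg smult_zero_r)
  then show ?thesis using assms by (simp add: M.minus_equality)
qed

lemma lmod_hom_zero:
  assumes "left_module R M" "left_module R N" "f \<in> lmod_hom R M N"
  shows "f \<zero>\<^bsub>M\<^esub> = \<zero>\<^bsub>N\<^esub>"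
proof -
  interpret M: left_module R M by fact
  interpret N: left_module R N by fact
  show ?thesis
    using lmod_hom_smult[OF assms(3), of "\<zero>\<^bsub>R\<^esub>" "\<zero>\<^bsub>M\<^esub>"] lmod_hom_closed[OF assms(3), of "\<zero>\<^bsub>M\<^esub>"]
    by (simp add: M.smult_zero_l N.smult_zero_l)
qed

lemma lmod_hom_minus:
  assumes "left_module R M" "left_module R N" "f \<in> lmod_hom R M N" "x \<in> carrier M"
  shows "f (\<ominus>\<^bsub>M\<^esub> x) = \<ominus>\<^bsub>N\<^esub> f x"
proof -
  interpret M: left_module R M by fact
  interpret N: left_module R N by fact
  show ?thesis
    using lmod_hom_add[OF assms(3), of "\<ominus>\<^bsub>M\<^esub> x" x] lmod_hom_closed[OF assms(3)] assms(4)
      lmod_hom_zero[OF assms(1-3)]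
    by (simp add: M.M.l_neg N.M.minus_equality)
qed

text \<open>A single identity on \<open>r x + y\<close> suffices: \<open>r = 1\<close> gives
  additivity, cancellation then gives \<open>f 0 = 0\<close>, and \<open>y = 0\<close> gives
  homogeneity. Factor sets measure the defect of the same combination, so both notions are compared
  without splitting into cases.\<close>

lemma lmod_homI:
  assumes "left_module R M" "left_module R N" "f \<in> carrier M \<rightarrow>\<^sub>E carrier N"
    and lin: "\<And>r x y. \<lbrakk>r \<in> carrier R; x \<in> carrier M; y \<in> carrier M\<rbrakk> \<Longrightarrow>
      f (r \<odot>\<^bsub>M\<^esub> x \<oplus>\<^bsub>M\<^esub> y) = r \<odot>\<^bsub>N\<^esub> f x \<oplus>\<^bsub>N\<^esub> f y"
  shows "f \<in> lmod_hom R M N"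
proof -
  interpret M: left_module R M by fact
  interpret N: left_module R N by fact
  have cl: "f x \<in> carrier N" if "x \<in> carrier M" for x using assms(3) that by auto
  have add: "f (x \<oplus>\<^bsub>M\<^esub> y) = f x \<oplus>\<^bsub>N\<^esub> f y" if "x \<in> carrier M" "y \<in> carrier M" for x y
    using lin[of "\<one>\<^bsub>R\<^esub>" x y] that cl by simp
  have "f \<zero>\<^bsub>M\<^esub> = \<zero>\<^bsub>N\<^esub>"
    using add[of "\<zero>\<^bsub>M\<^esub>" "\<zero>\<^bsub>M\<^esub>"] cl[of "\<zero>\<^bsub>M\<^esub>"] N.M.add.r_cancel_one'[of "f \<zero>\<^bsub>M\<^esub>" "f \<zero>\<^bsub>M\<^esub>"] by simp
  then have "f (r \<odot>\<^bsub>M\<^esub> x) = r \<odot>\<^bsub>N\<^esub> f x" if "r \<in> carrier R" "x \<in> carrier M" for r x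
    using lin[of r x "\<zero>\<^bsub>M\<^esub>"] that cl by simp
  with add show ?thesis using assms(3) by (simp add: lmod_hom_def)
qed

lemma lmod_hom_lin:
  assumes "left_module R M" "f \<in> lmod_hom R M N" "r \<in> carrier R" "x \<in> carrier M" "y \<in> carrier M"
  shows "f (r \<odot>\<^bsub>M\<^esub> x \<oplus>\<^bsub>M\<^esub> y) = r \<odot>\<^bsub>N\<^esub> f x \<oplus>\<^bsub>N\<^esub> f y"
proof -
  interpret M: left_module R M by fact
  show ?thesis using assms by (simp add: lmod_hom_add lmod_hom_smult)
qed

lemma lmod_hom_compose:
  assumes "left_module R L" "left_module R M" "left_module R N"
    "f \<in> lmod_hom R L M" "g \<in> lmod_hom R M N"
  shows "(\<lambda>x\<in>carrier L. g (f x)) \<in> lmod_hom R L N"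
proof -
  interpret L: left_module R L by fact
  show ?thesis
    by (rule lmod_homI[OF assms(1,3)])
      (use assms in \<open>auto simp: lmod_hom_closed lmod_hom_lin lmod_hom_add lmod_hom_smult\<close>)
qed

text \<open>Covers both quotients and transport of structure along a bijection.\<close>

lemma left_module_image:
  assumes "left_module R M" "k ` carrier M = carrier Q" "k \<zero>\<^bsub>M\<^esub> = \<zero>\<^bsub>Q\<^esub>"
    and add: "\<And>x y. \<lbrakk>x \<in> carrier M; y \<in> carrier M\<rbrakk> \<Longrightarrow> k x \<oplus>\<^bsub>Q\<^esub> k y = k (x \<oplus>\<^bsub>M\<^esub> y)"
    and smult: "\<And>r x. \<lbrakk>r \<in> carrier R; x \<in> carrier M\<rbrakk> \<Longrightarrow> r \<odot>\<^bsub>Q\<^esub> k x = k (r \<odot>\<^bsub>M\<^esub> x)"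
  shows "left_module R Q"
proof -
  interpret M: left_module R M by fact
  have zero: "\<zero>\<^bsub>Q\<^esub> = k \<zero>\<^bsub>M\<^esub>" using assms(3) by simp
  have carr: "carrier Q = k ` carrier M" using assms(2) by simp
  have "abelian_group Q"
  proof (rule abelian_groupI)
    fix x assume "x \<in> carrier Q"
    then obtain m where "m \<in> carrier M" "x = k m" using carr by auto
    then show "\<exists>y\<in>carrier Q. y \<oplus>\<^bsub>Q\<^esub> x = \<zero>\<^bsub>Q\<^esub>"
      by (intro bexI[of _ "k (\<ominus>\<^bsub>M\<^esub> m)"]) (auto simp: carr zero add M.M.l_neg)
  qed (auto simp: carr zero add M.M.a_assoc M.M.a_comm M.M.a_lcomm)
  then show ?thesis
    unfolding left_module_def left_module_axioms_def
    using M.R.ring_axioms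
    by (auto simp: carr add smult M.smult_l_distr M.smult_r_distr M.smult_assoc)
qed

section \<open>Products and direct sums of modules\<close>

lemma lmod_prod_simps [simp]:
  "carrier (lmod_prod M N) = carrier M \<times> carrier N"
  "\<zero>\<^bsub>lmod_prod M N\<^esub> = (\<zero>\<^bsub>M\<^esub>, \<zero>\<^bsub>N\<^esub>)"
  "(x, y) \<oplus>\<^bsub>lmod_prod M N\<^esub> (x', y') = (x \<oplus>\<^bsub>M\<^esub> x', y \<oplus>\<^bsub>N\<^esub> y')"
  "r \<odot>\<^bsub>lmod_prod M N\<^esub> (x, y) = (r \<odot>\<^bsub>M\<^esub> x, r \<odot>\<^bsub>N\<^esub> y)"
  by (auto simp: lmod_prod_def)

lemma left_module_prod:
  assumes "left_module R M" "left_module R N"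
  shows "left_module R (lmod_prod M N)"
proof -
  interpret M: left_module R M by fact
  interpret N: left_module R N by fact
  have "abelian_group (lmod_prod M N)"
  proof (rule abelian_groupI)
    fix p assume "p \<in> carrier (lmod_prod M N)"
    then obtain x y where "p = (x, y)" "x \<in> carrier M" "y \<in> carrier N" by auto
    then show "\<exists>q\<in>carrier (lmod_prod M N). q \<oplus>\<^bsub>lmod_prod M N\<^esub> p = \<zero>\<^bsub>lmod_prod M N\<^esub>"
      by (intro bexI[of _ "(\<ominus>\<^bsub>M\<^esub> x, \<ominus>\<^bsub>N\<^esub> y)"]) (auto simp: M.M.l_neg N.M.l_neg)
  qed (auto simp: M.M.a_assoc N.M.a_assoc M.M.a_comm N.M.a_comm M.M.a_lcomm N.M.a_lcomm)
  then show ?thesis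
    unfolding left_module_def left_module_axioms_def
    using M.R.ring_axioms
    by (auto simp: M.smult_l_distr M.smult_r_distr M.smult_assoc
        N.smult_l_distr N.smult_r_distr N.smult_assoc)
qed

lemma lmod_sum_simps:
  "carrier (lmod_sum J M) = {f \<in> \<Pi>\<^sub>E j\<in>J. carrier (M j). finite {j \<in> J. f j \<noteq> \<zero>\<^bsub>M j\<^esub>}}"
  "\<zero>\<^bsub>lmod_sum J M\<^esub> = (\<lambda>j\<in>J. \<zero>\<^bsub>M j\<^esub>)"
  "v \<oplus>\<^bsub>lmod_sum J M\<^esub> w = (\<lambda>j\<in>J. v j \<oplus>\<^bsub>M j\<^esub> w j)"
  "r \<odot>\<^bsub>lmod_sum J M\<^esub> v = (\<lambda>j\<in>J. r \<odot>\<^bsub>M j\<^esub> v j)"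
  by (auto simp: lmod_sum_def)

lemma lmod_sum_carrierI:
  assumes "v \<in> (\<Pi>\<^sub>E j\<in>J. carrier (M j))" "finite A" "\<And>j. \<lbrakk>j \<in> J; j \<notin> A\<rbrakk> \<Longrightarrow> v j = \<zero>\<^bsub>M j\<^esub>"
  shows "v \<in> carrier (lmod_sum J M)"
proof -
  have "{j \<in> J. v j \<noteq> \<zero>\<^bsub>M j\<^esub>} \<subseteq> A" using assms(3) by auto
  then show ?thesis using assms(1,2) by (auto simp: lmod_sum_simps intro: finite_subset)
qed

lemma lmod_sum_nth: "\<lbrakk>v \<in> carrier (lmod_sum J M); j \<in> J\<rbrakk> \<Longrightarrow> v j \<in> carrier (M j)"
  by (auto simp: lmod_sum_simps)

lemma left_module_sum:
  assumes "ring R" "\<And>j. j \<in> J \<Longrightarrow> left_module R (M j)"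
  shows "left_module R (lmod_sum J M)"
proof -
  interpret R: ring R by fact
  let ?S = "lmod_sum J M"
  note ab = assms(2)[unfolded left_module_def, THEN conjunct2, THEN conjunct1]
  \<comment> \<open>A pointwise operation that fixes zero has support in the union of the two
    supports. Addition, scalar multiplication and negation are all instances; the last two ignore
    the second argument.\<close>
  have cl: "(\<lambda>j\<in>J. u (v j) (w j) j) \<in> carrier ?S"
    if "v \<in> carrier ?S" "w \<in> carrier ?S"
      "\<And>j x y. \<lbrakk>j \<in> J; x \<in> carrier (M j); y \<in> carrier (M j)\<rbrakk> \<Longrightarrow> u x y j \<in> carrier (M j)"
      "\<And>j. j \<in> J \<Longrightarrow> u \<zero>\<^bsub>M j\<^esub> \<zero>\<^bsub>M j\<^esub> j = \<zero>\<^bsub>M j\<^esub>" for u v w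
    by (rule lmod_sum_carrierI[of _ _ _ "{j \<in> J. v j \<noteq> \<zero>\<^bsub>M j\<^esub>} \<union> {j \<in> J. w j \<noteq> \<zero>\<^bsub>M j\<^esub>}"])
      (use that in \<open>auto simp: lmod_sum_nth lmod_sum_simps(1)[THEN eqset_imp_iff]\<close>)
  have add: "v \<oplus>\<^bsub>?S\<^esub> w \<in> carrier ?S" if "v \<in> carrier ?S" "w \<in> carrier ?S" for v w
    using cl[OF that, of "\<lambda>x y j. x \<oplus>\<^bsub>M j\<^esub> y"] ab
    by (simp add: lmod_sum_simps(3) abelian_groupE abelian_monoid.a_closed abelian_group.axioms(1))
  have smult: "r \<odot>\<^bsub>?S\<^esub> v \<in> carrier ?S" if "r \<in> carrier R" "v \<in> carrier ?S" for r v
    using cl[OF that(2,2), of "\<lambda>x y j. r \<odot>\<^bsub>M j\<^esub> x"] assms(2) that(1)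
    by (simp add: lmod_sum_simps(4) left_module.smult_closed[OF assms(2)] left_module.smult_zero_r[OF assms(2)])
  have neg: "(\<lambda>j\<in>J. \<ominus>\<^bsub>M j\<^esub> v j) \<in> carrier ?S" if "v \<in> carrier ?S" for v
    using cl[OF that that, of "\<lambda>x y j. \<ominus>\<^bsub>M j\<^esub> x"] ab
    by (simp add: abelian_group.a_inv_closed abelian_group.minus_equality 
        abelian_group.axioms(1) abelian_monoid.zero_closed abelian_monoid.l_zero)
  have "abelian_group ?S"
  proof (rule abelian_groupI)
    show "\<zero>\<^bsub>?S\<^esub> \<in> carrier ?S"
      by (rule lmod_sum_carrierI[of _ _ _ "{}"])
        (use ab in \<open>auto simp: lmod_sum_simps abelian_group.axioms(1) abelian_monoid.zero_closed\<close>)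
    fix v assume v: "v \<in> carrier ?S"
    show "\<zero>\<^bsub>?S\<^esub> \<oplus>\<^bsub>?S\<^esub> v = v"
      using v ab by (auto simp: lmod_sum_simps fun_eq_iff PiE_def extensional_def
          abelian_group.axioms(1) abelian_monoid.l_zero Pi_def)
    show "\<exists>w\<in>carrier ?S. w \<oplus>\<^bsub>?S\<^esub> v = \<zero>\<^bsub>?S\<^esub>"
      by (rule bexI[OF _ neg[OF v]])
        (use ab in \<open>auto simp: lmod_sum_simps(2,3) abelian_group.l_neg lmod_sum_nth[OF v] intro!: restrict_ext\<close>)
    fix w assume w: "w \<in> carrier ?S"
    show "v \<oplus>\<^bsub>?S\<^esub> w = w \<oplus>\<^bsub>?S\<^esub> v"
      using ab by (auto simp: lmod_sum_simps(3) lmod_sum_nth[OF v] lmod_sum_nth[OF w]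
          abelian_group.axioms(1) abelian_monoid.a_comm intro!: restrict_ext)
    fix u assume u: "u \<in> carrier ?S"
    show "v \<oplus>\<^bsub>?S\<^esub> w \<oplus>\<^bsub>?S\<^esub> u = v \<oplus>\<^bsub>?S\<^esub> (w \<oplus>\<^bsub>?S\<^esub> u)"
      using ab by (auto simp: lmod_sum_simps(3) lmod_sum_nth[OF v] lmod_sum_nth[OF w] lmod_sum_nth[OF u]
          abelian_group.axioms(1) abelian_monoid.a_assoc intro!: restrict_ext)
  qed (rule add)
  then show ?thesis
    unfolding left_module_def left_module_axioms_def
    using assms(1) smult
    apply (intro conjI allI impI)
    apply (auto simp: lmod_sum_simps(3,4) lmod_sum_nth left_module.smult_l_distr[OF assms(2)]
        left_module.smult_r_distr[OF assms(2)] left_module.smult_assoc[OF assms(2)]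
        left_module.smult_closed[OF assms(2)] intro!: restrict_ext)
    apply (auto simp: lmod_sum_simps PiE_def extensional_def fun_eq_iff left_module.smult_one[OF assms(2)] Pi_def)
    done
qed

section \<open>Submodules and quotients\<close>

lemma (in abelian_group) a_inv_zero [simp]: "\<ominus> \<zero> = \<zero>"
  by (rule minus_equality) simp_all

locale lmod_submodule = left_module R M
  for R :: "('r, 'k) ring_scheme" (structure) and M :: "('r, 'm) module" (structure) +
  fixes H :: "'m set"
  assumes sub: "H \<subseteq> carrier M" and zero_mem: "\<zero>\<^bsub>M\<^esub> \<in> H"
    and lin_mem: "\<lbrakk>r \<in> carrier R; x \<in> H; y \<in> H\<rbrakk> \<Longrightarrow> r \<odot>\<^bsub>M\<^esub> x \<oplus>\<^bsub>M\<^esub> y \<in> H"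
begin

lemma mem_carrier: "x \<in> H \<Longrightarrow> x \<in> carrier M"
  using sub by auto

lemma add_mem: "\<lbrakk>x \<in> H; y \<in> H\<rbrakk> \<Longrightarrow> x \<oplus>\<^bsub>M\<^esub> y \<in> H"
  using lin_mem[of "\<one>\<^bsub>R\<^esub>" x y] mem_carrier by simp

lemma smult_mem: "\<lbrakk>r \<in> carrier R; x \<in> H\<rbrakk> \<Longrightarrow> r \<odot>\<^bsub>M\<^esub> x \<in> H"
  using lin_mem[of r x "\<zero>\<^bsub>M\<^esub>"] mem_carrier zero_mem by simp

lemma minus_mem: "x \<in> H \<Longrightarrow> \<ominus>\<^bsub>M\<^esub> x \<in> H"
proof -
  assume x: "x \<in> H"
  \<comment> \<open>Negation is the scalar -1, so closure under \<open>r x + y\<close> already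
    yields a subgroup.\<close>
  then have "(\<ominus>\<^bsub>R\<^esub> \<one>\<^bsub>R\<^esub>) \<odot>\<^bsub>M\<^esub> x \<oplus>\<^bsub>M\<^esub> x = \<zero>\<^bsub>M\<^esub>"
    using mem_carrier[OF x] smult_l_distr[of "\<ominus>\<^bsub>R\<^esub> \<one>\<^bsub>R\<^esub>" "\<one>\<^bsub>R\<^esub>" x] by (simp add: R.l_neg smult_zero_l)
  then have "\<ominus>\<^bsub>M\<^esub> x = (\<ominus>\<^bsub>R\<^esub> \<one>\<^bsub>R\<^esub>) \<odot>\<^bsub>M\<^esub> x"
    using mem_carrier[OF x] by (simp add: M.minus_equality)
  then show ?thesis using smult_mem[OF _ x] by simp
qed

lemma left_module_sub: "left_module R (M\<lparr>carrier := H\<rparr>)"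
proof -
  have "abelian_group (M\<lparr>carrier := H\<rparr>)"
    by (rule abelian_groupI)
      (auto simp: add_mem zero_mem mem_carrier M.a_assoc intro: M.a_comm M.l_neg intro!: bexI[OF _ minus_mem])
  then show ?thesis
    unfolding left_module_def left_module_axioms_def
    using R.ring_axioms
    by (auto simp: smult_mem mem_carrier smult_l_distr smult_r_distr smult_assoc)
qed

lemma is_abelian_subgroup: "abelian_subgroup H M"
proof -
  have "subgroup H (add_monoid M)"
    by (rule group.subgroupI[OF M.a_group])
      (use sub zero_mem add_mem minus_mem in \<open>auto simp: a_inv_def\<close>)
  then show ?thesis
    by (intro abelian_subgroupI3 additive_subgroupI M.abelian_group_axioms)
qed

text \<open>Equality of cosets amounts to membership of \<open>x\<close> in the coset of
  \<open>y\<close>. Spelled out with a witness, it later yields the element of \<open>Y\<close> by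
  which two representatives in a push-out differ.\<close>

lemma coset_eq_iff:
  assumes "x \<in> carrier M" "y \<in> carrier M"
  shows "H +>\<^bsub>M\<^esub> x = H +>\<^bsub>M\<^esub> y \<longleftrightarrow> (\<exists>n\<in>H. x = n \<oplus>\<^bsub>M\<^esub> y)"
proof -
  interpret H: abelian_subgroup H M by (rule is_abelian_subgroup)
  have "H +>\<^bsub>M\<^esub> x = H +>\<^bsub>M\<^esub> y \<longleftrightarrow> x \<in> H +>\<^bsub>M\<^esub> y"
    using H.a_rcos_self[OF assms(1)] M.a_repr_independence[of x H y] H.a_subgroup assms by auto
  then show ?thesis by (auto simp: a_r_coset_def')
qed

lemma quot_simps:
  "carrier (lmod_quot M H) = (\<lambda>x. H +>\<^bsub>M\<^esub> x) ` carrier M"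
  "\<zero>\<^bsub>lmod_quot M H\<^esub> = H +>\<^bsub>M\<^esub> \<zero>\<^bsub>M\<^esub>"
  "\<lbrakk>x \<in> carrier M; y \<in> carrier M\<rbrakk> \<Longrightarrow>
    (H +>\<^bsub>M\<^esub> x) \<oplus>\<^bsub>lmod_quot M H\<^esub> (H +>\<^bsub>M\<^esub> y) = H +>\<^bsub>M\<^esub> (x \<oplus>\<^bsub>M\<^esub> y)"
  "\<lbrakk>r \<in> carrier R; x \<in> carrier M\<rbrakk> \<Longrightarrow>
    r \<odot>\<^bsub>lmod_quot M H\<^esub> (H +>\<^bsub>M\<^esub> x) = H +>\<^bsub>M\<^esub> (r \<odot>\<^bsub>M\<^esub> x)"
proof -
  interpret H: abelian_subgroup H M by (rule is_abelian_subgroup)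
  show "carrier (lmod_quot M H) = (\<lambda>x. H +>\<^bsub>M\<^esub> x) ` carrier M"
    by (auto simp: lmod_quot_def A_RCOSETS_def')
  show "\<zero>\<^bsub>lmod_quot M H\<^esub> = H +>\<^bsub>M\<^esub> \<zero>\<^bsub>M\<^esub>"
    using M.a_coset_add_zero[OF sub] by (simp add: lmod_quot_def)
  show "(H +>\<^bsub>M\<^esub> x) \<oplus>\<^bsub>lmod_quot M H\<^esub> (H +>\<^bsub>M\<^esub> y) = H +>\<^bsub>M\<^esub> (x \<oplus>\<^bsub>M\<^esub> y)"
    if "x \<in> carrier M" "y \<in> carrier M"
    using H.a_rcos_sum[OF that] by (simp add: lmod_quot_def)
  show "r \<odot>\<^bsub>lmod_quot M H\<^esub> (H +>\<^bsub>M\<^esub> x) = H +>\<^bsub>M\<^esub> (r \<odot>\<^bsub>M\<^esub> x)"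
    if r: "r \<in> carrier R" and x: "x \<in> carrier M"
  proof -
    \<comment> \<open>Scalar multiplication on the quotient is a union over all representatives; it
      is a single coset because each representative gives the same one.\<close>
    have "H +>\<^bsub>M\<^esub> (r \<odot>\<^bsub>M\<^esub> z) = H +>\<^bsub>M\<^esub> (r \<odot>\<^bsub>M\<^esub> x)" if "z \<in> H +>\<^bsub>M\<^esub> x" for z
    proof -
      from that obtain n where "n \<in> H" "z = n \<oplus>\<^bsub>M\<^esub> x" by (auto simp: a_r_coset_def')
      then show ?thesis
        using r x by (subst coset_eq_iff) (auto simp: mem_carrier smult_r_distr smult_mem)
    qed
    moreover have "x \<in> H +>\<^bsub>M\<^esub> x" using H.a_rcos_self[OF x] .
    ultimately have "(\<Union>z\<in>H +>\<^bsub>M\<^esub> x. H +>\<^bsub>M\<^esub> (r \<odot>\<^bsub>M\<^esub> z)) = H +>\<^bsub>M\<^esub> (r \<odot>\<^bsub>M\<^esub> x)"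
      by blast
    then show ?thesis by (simp add: lmod_quot_def)
  qed
qed

lemma left_module_quot: "left_module R (lmod_quot M H)"
  by (rule left_module_image[OF left_module_axioms, where k = "\<lambda>x. H +>\<^bsub>M\<^esub> x"])
    (simp_all add: quot_simps)

end

section \<open>Constructions of extensions\<close>

text \<open>Only a complex from \<open>Y\<close> through \<open>M\<close> to \<open>X\<close> is
  asked for, so that the direct sum of extensions fits in through its componentwise maps. Exactness
  enters as an assumption of \<open>is_extension_pushout\<close>.\<close>

locale pushout_data =
  fixes R :: "('r, 'k) ring_scheme" and X :: "('r, 'x) module" and Y :: "('r, 'y) module"
    and Y' :: "('r, 'z) module" and h :: "'y \<Rightarrow> 'z" and E :: "('r, 'y, 'm, 'x) extension"
  assumes X: "left_module R X" and Y: "left_module R Y" and Y': "left_module R Y'"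
    and M: "left_module R (middle E)"
    and h: "h \<in> lmod_hom R Y Y'"
    and incl_hom: "incl E \<in> lmod_hom R Y (middle E)"
    and proj_hom: "proj E \<in> lmod_hom R (middle E) X"
    and proj_incl: "y \<in> carrier Y \<Longrightarrow> proj E (incl E y) = \<zero>\<^bsub>X\<^esub>"
begin

sublocale X: left_module R X by (rule X)
sublocale Y: left_module R Y by (rule Y)
sublocale Y': left_module R Y' by (rule Y')
sublocale M: left_module R "middle E" by (rule M)

abbreviation P where "P \<equiv> lmod_prod Y' (middle E)"

text \<open>The push-out is the cokernel of the map sending \<open>y\<close> to
  \<open>(h y, - incl y)\<close>. The sign makes the two maps from \<open>Y\<close> agree in the
  quotient, as \<open>\<kappa>_incl\<close> records.\<close>

definition "K = (\<lambda>y. (h y, \<ominus>\<^bsub>middle E\<^esub> incl E y)) ` carrier Y"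

definition "\<kappa> y m = K +>\<^bsub>P\<^esub> (y, m)"

sublocale K: lmod_submodule R P K
proof -
  interpret left_module R P by (rule left_module_prod[OF Y' M])
  show "lmod_submodule R P K"
  proof
    show "K \<subseteq> carrier P"
      by (auto simp: K_def lmod_hom_closed[OF h] lmod_hom_closed[OF incl_hom])
    have "(h \<zero>\<^bsub>Y\<^esub>, \<ominus>\<^bsub>middle E\<^esub> incl E \<zero>\<^bsub>Y\<^esub>) \<in> K" by (auto simp: K_def)
    then show "\<zero>\<^bsub>P\<^esub> \<in> K" by (simp add: lmod_hom_zero[OF Y Y' h] lmod_hom_zero[OF Y M incl_hom])
    fix r p q assume r: "r \<in> carrier R" and "p \<in> K" "q \<in> K"
    then obtain y y' where y: "y \<in> carrier Y" "p = (h y, \<ominus>\<^bsub>middle E\<^esub> incl E y)"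
      and y': "y' \<in> carrier Y" "q = (h y', \<ominus>\<^bsub>middle E\<^esub> incl E y')" by (auto simp: K_def)
    then show "r \<odot>\<^bsub>P\<^esub> p \<oplus>\<^bsub>P\<^esub> q \<in> K" unfolding K_def
      by (intro image_eqI[of _ _ "r \<odot>\<^bsub>Y\<^esub> y \<oplus>\<^bsub>Y\<^esub> y'"])
        (auto simp: r lmod_hom_lin[OF Y h] lmod_hom_lin[OF Y incl_hom] M.smult_minus M.M.minus_add
          lmod_hom_closed[OF incl_hom])
  qed
qed

lemma pushout_sel:
  "middle (pushout_ext Y Y' h E) = lmod_quot P K"
  "y \<in> carrier Y' \<Longrightarrow> incl (pushout_ext Y Y' h E) y = \<kappa> y \<zero>\<^bsub>middle E\<^esub>"
  by (simp_all add: pushout_ext_def Let_def K_def \<kappa>_def)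

lemma \<kappa>_closed:
  "\<lbrakk>y \<in> carrier Y'; m \<in> carrier (middle E)\<rbrakk> \<Longrightarrow> \<kappa> y m \<in> carrier (lmod_quot P K)"
  by (simp add: \<kappa>_def K.quot_simps)

lemma \<kappa>_surj:
  assumes "C \<in> carrier (lmod_quot P K)"
  obtains y m where "y \<in> carrier Y'" "m \<in> carrier (middle E)" "C = \<kappa> y m"
  using assms by (auto simp: K.quot_simps \<kappa>_def)

lemma \<kappa>_add:
  "\<lbrakk>y \<in> carrier Y'; m \<in> carrier (middle E); y' \<in> carrier Y'; m' \<in> carrier (middle E)\<rbrakk> \<Longrightarrow>
    \<kappa> y m \<oplus>\<^bsub>lmod_quot P K\<^esub> \<kappa> y' m' = \<kappa> (y \<oplus>\<^bsub>Y'\<^esub> y') (m \<oplus>\<^bsub>middle E\<^esub> m')"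
  by (simp add: \<kappa>_def K.quot_simps)

lemma \<kappa>_smult:
  "\<lbrakk>r \<in> carrier R; y \<in> carrier Y'; m \<in> carrier (middle E)\<rbrakk> \<Longrightarrow>
    r \<odot>\<^bsub>lmod_quot P K\<^esub> \<kappa> y m = \<kappa> (r \<odot>\<^bsub>Y'\<^esub> y) (r \<odot>\<^bsub>middle E\<^esub> m)"
  by (simp add: \<kappa>_def K.quot_simps)

lemma \<kappa>_eq_iff:
  assumes "y \<in> carrier Y'" "m \<in> carrier (middle E)" "y' \<in> carrier Y'" "m' \<in> carrier (middle E)"
  shows "\<kappa> y m = \<kappa> y' m' \<longleftrightarrow>
    (\<exists>z\<in>carrier Y. y = h z \<oplus>\<^bsub>Y'\<^esub> y' \<and> m = \<ominus>\<^bsub>middle E\<^esub> incl E z \<oplus>\<^bsub>middle E\<^esub> m')"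
  using assms by (simp add: \<kappa>_def K.coset_eq_iff) (auto simp: K_def)

lemma \<kappa>_incl:
  assumes "y \<in> carrier Y"
  shows "\<kappa> \<zero>\<^bsub>Y'\<^esub> (incl E y) = \<kappa> (h y) \<zero>\<^bsub>middle E\<^esub>"
proof -
  have "\<kappa> (h y) \<zero>\<^bsub>middle E\<^esub> = \<kappa> \<zero>\<^bsub>Y'\<^esub> (incl E y)"
    using assms by (subst \<kappa>_eq_iff)
      (auto simp: lmod_hom_closed[OF h] lmod_hom_closed[OF incl_hom] M.M.l_neg intro!: bexI[of _ y])
  then show ?thesis by simp
qed

text \<open>The projection is defined by \<open>the_elem\<close>, hence the image of the coset must
  be a singleton. It is one because elements of \<open>K\<close> have their second component in the
  image of \<open>incl E\<close>, which \<open>proj E\<close> kills.\<close>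

lemma proj_\<kappa>:
  assumes "y \<in> carrier Y'" "m \<in> carrier (middle E)"
  shows "proj (pushout_ext Y Y' h E) (\<kappa> y m) = proj E m"
proof -
  have "(\<lambda>(y, m). proj E m) ` \<kappa> y m = {proj E m}"
  proof (rule subset_antisym)
    show "(\<lambda>(y, m). proj E m) ` \<kappa> y m \<subseteq> {proj E m}"
      using assms by (auto simp: \<kappa>_def a_r_coset_def' K_def lmod_hom_add[OF proj_hom]
          lmod_hom_closed[OF incl_hom] lmod_hom_closed[OF proj_hom]
          lmod_hom_minus[OF M X proj_hom] proj_incl)
    have "(y, m) \<in> \<kappa> y m"
      unfolding \<kappa>_def using assms
      by (intro abelian_subgroup.a_rcos_self[OF K.is_abelian_subgroup]) auto
    then show "{proj E m} \<subseteq> (\<lambda>(y, m). proj E m) ` \<kappa> y m" by force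
  qed
  then show ?thesis
    using \<kappa>_closed[OF assms] by (simp add: pushout_ext_def Let_def flip: K_def)
qed

lemma is_extension_pushout:
  assumes ext: "is_extension R X Y E"
  shows "is_extension R X Y' (pushout_ext Y Y' h E)"
  unfolding is_extension_def pushout_sel
proof (intro conjI)
  let ?Q = "lmod_quot P K" and ?E = "pushout_ext Y Y' h E"
  show Q: "left_module R ?Q" by (rule K.left_module_quot)
  have inj: "inj_on (incl E) (carrier Y)"
    and ker: "incl E ` carrier Y = {m \<in> carrier (middle E). proj E m = \<zero>\<^bsub>X\<^esub>}"
    and surj: "proj E ` carrier (middle E) = carrier X"
    using ext by (auto simp: is_extension_def)
  note [simp] = pushout_sel \<kappa>_closed \<kappa>_add \<kappa>_smult proj_\<kappa> lmod_hom_closed[OF proj_hom]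
    lmod_hom_closed[OF incl_hom] lmod_hom_closed[OF h]
  have "incl ?E \<in> extensional (carrier Y')" "proj ?E \<in> extensional (carrier ?Q)"
    by (simp_all add: pushout_ext_def Let_def flip: K_def)
  note ex = this
  show "incl ?E \<in> lmod_hom R Y' ?Q"
    by (rule lmod_homI[OF Y' Q]) (use ex(1) in \<open>auto simp: PiE_iff M.smult_zero_r\<close>)
  show "proj ?E \<in> lmod_hom R ?Q X"
  proof (rule lmod_homI[OF Q X])
    show "proj ?E \<in> carrier ?Q \<rightarrow>\<^sub>E carrier X"
      using ex(2) by (auto simp: PiE_iff elim!: \<kappa>_surj)
    fix r C D assume r: "r \<in> carrier R" and C: "C \<in> carrier ?Q" and D: "D \<in> carrier ?Q"
    from C obtain y m where "y \<in> carrier Y'" "m \<in> carrier (middle E)" "C = \<kappa> y m" by (rule \<kappa>_surj)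
    moreover from D obtain y' m' where "y' \<in> carrier Y'" "m' \<in> carrier (middle E)" "D = \<kappa> y' m'"
      by (rule \<kappa>_surj)
    ultimately show "proj ?E (r \<odot>\<^bsub>?Q\<^esub> C \<oplus>\<^bsub>?Q\<^esub> D) = r \<odot>\<^bsub>X\<^esub> proj ?E C \<oplus>\<^bsub>X\<^esub> proj ?E D"
      using r by (simp add: lmod_hom_lin[OF M proj_hom])
  qed
  show "inj_on (incl ?E) (carrier Y')"
  proof (rule inj_onI)
    fix y y' assume y: "y \<in> carrier Y'" "y' \<in> carrier Y'" "incl ?E y = incl ?E y'"
    \<comment> \<open>Elements of \<open>Y'\<close> are identified only through some
      \<open>z\<close> whose image in \<open>M\<close> vanishes, and injectivity of
      \<open>incl E\<close> forces \<open>z\<close> to be zero.\<close>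
    then obtain z where z: "z \<in> carrier Y" "y = h z \<oplus>\<^bsub>Y'\<^esub> y'"
      "\<zero>\<^bsub>middle E\<^esub> = \<ominus>\<^bsub>middle E\<^esub> incl E z \<oplus>\<^bsub>middle E\<^esub> \<zero>\<^bsub>middle E\<^esub>"
      by (auto simp: \<kappa>_eq_iff)
    then have "\<ominus>\<^bsub>middle E\<^esub> incl E z = \<zero>\<^bsub>middle E\<^esub>" by simp
    then have "incl E z = \<zero>\<^bsub>middle E\<^esub>"
      using z(1) M.M.minus_minus[of "incl E z"] by simp
    then have "z = \<zero>\<^bsub>Y\<^esub>"
      using inj z(1) by (auto simp: inj_on_def lmod_hom_zero[OF Y M incl_hom])
    then show "y = y'" using z(2) y(2) by (simp add: lmod_hom_zero[OF Y Y' h])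
  qed
  show "incl ?E ` carrier Y' = {C \<in> carrier ?Q. proj ?E C = \<zero>\<^bsub>X\<^esub>}"
  proof (intro subset_antisym subsetI)
    fix C assume "C \<in> incl ?E ` carrier Y'"
    then show "C \<in> {C \<in> carrier ?Q. proj ?E C = \<zero>\<^bsub>X\<^esub>}"
      by (auto simp: lmod_hom_zero[OF M X proj_hom])
  next
    fix C assume "C \<in> {C \<in> carrier ?Q. proj ?E C = \<zero>\<^bsub>X\<^esub>}"
    then obtain y m where y: "y \<in> carrier Y'" "m \<in> carrier (middle E)" "C = \<kappa> y m"
      and "proj E m = \<zero>\<^bsub>X\<^esub>" by (auto elim!: \<kappa>_surj)
    \<comment> \<open>An element over zero has its \<open>M\<close>-component in the image of
      \<open>Y\<close>; the relation of the push-out turns that component into \<open>h z\<close>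
      and moves it into \<open>Y'\<close>.\<close>
    then have "m \<in> incl E ` carrier Y" using ker by auto
    then obtain z where z: "z \<in> carrier Y" "m = incl E z" by auto
    then have "\<kappa> y m = \<kappa> y \<zero>\<^bsub>middle E\<^esub> \<oplus>\<^bsub>?Q\<^esub> \<kappa> \<zero>\<^bsub>Y'\<^esub> (incl E z)" using y by simp
    also have "\<dots> = incl ?E (y \<oplus>\<^bsub>Y'\<^esub> h z)" using y z by (simp only: \<kappa>_incl) simp
    finally show "C \<in> incl ?E ` carrier Y'" using y z by auto
  qed
  show "proj ?E ` carrier ?Q = carrier X"
  proof (intro subset_antisym subsetI)
    fix x assume "x \<in> carrier X"
    then obtain m where "m \<in> carrier (middle E)" "x = proj E m" using surj by auto
    then have "x = proj ?E (\<kappa> \<zero>\<^bsub>Y'\<^esub> m)" "\<kappa> \<zero>\<^bsub>Y'\<^esub> m \<in> carrier ?Q" by simp_all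
    then show "x \<in> proj ?E ` carrier ?Q" by blast
  qed (auto elim!: \<kappa>_surj)
qed

end

section \<open>Short exact sequences: pull-backs, products and the split sequence\<close>

locale lmod_extension =
  fixes R :: "('r, 'k) ring_scheme" and X :: "('r, 'x) module" and Y :: "('r, 'y) module"
    and E :: "('r, 'y, 'm, 'x) extension"
  assumes X: "left_module R X" and Y: "left_module R Y" and ext: "is_extension R X Y E"
begin

sublocale X: left_module R X by (rule X)
sublocale Y: left_module R Y by (rule Y)
sublocale M: left_module R "middle E" using ext by (simp add: is_extension_def)

lemmas M = M.left_module_axioms

lemma incl_hom: "incl E \<in> lmod_hom R Y (middle E)"
  and proj_hom: "proj E \<in> lmod_hom R (middle E) X"
  using ext by (simp_all add: is_extension_def)

lemmas incl_simps [simp] = lmod_hom_closed[OF incl_hom] lmod_hom_zero[OF Y M incl_hom]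
  lmod_hom_add[OF incl_hom] lmod_hom_smult[OF incl_hom] lmod_hom_minus[OF Y M incl_hom]

lemmas proj_simps [simp] = lmod_hom_closed[OF proj_hom] lmod_hom_zero[OF M X proj_hom]
  lmod_hom_add[OF proj_hom] lmod_hom_smult[OF proj_hom] lmod_hom_minus[OF M X proj_hom]

lemma incl_eq_iff [simp]:
  "\<lbrakk>y \<in> carrier Y; y' \<in> carrier Y\<rbrakk> \<Longrightarrow> incl E y = incl E y' \<longleftrightarrow> y = y'"
  using ext by (auto simp: is_extension_def inj_on_def)

lemma proj_incl [simp]: "y \<in> carrier Y \<Longrightarrow> proj E (incl E y) = \<zero>\<^bsub>X\<^esub>"
  using ext by (auto simp: is_extension_def)

lemma proj_surj:
  assumes "x \<in> carrier X" obtains m where "m \<in> carrier (middle E)" "proj E m = x"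
proof -
  have "x \<in> proj E ` carrier (middle E)" using ext assms by (simp add: is_extension_def)
  then show ?thesis using that by auto
qed

lemma ker_proj:
  assumes "m \<in> carrier (middle E)" "proj E m = \<zero>\<^bsub>X\<^esub>"
  obtains y where "y \<in> carrier Y" "m = incl E y"
proof -
  have "m \<in> incl E ` carrier Y" using ext assms by (auto simp: is_extension_def)
  then show ?thesis using that by auto
qed

text \<open>The source of the \<open>Y\<close>-valued functions chosen below: factor sets, the
  coordinate \<open>\<eta>\<close> of a point of \<open>M\<close>, and the correction
  \<open>t\<close> in the argument for one universal sequence.\<close>

lemma fibre_proj:
  assumes "m \<in> carrier (middle E)" "m' \<in> carrier (middle E)" "proj E m = proj E m'"
  obtains y where "y \<in> carrier Y" "m = m' \<oplus>\<^bsub>middle E\<^esub> incl E y"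
proof -
  have "proj E (\<ominus>\<^bsub>middle E\<^esub> m' \<oplus>\<^bsub>middle E\<^esub> m) = \<zero>\<^bsub>X\<^esub>"
    using assms by (simp add: X.M.l_neg)
  then obtain y where "y \<in> carrier Y" "\<ominus>\<^bsub>middle E\<^esub> m' \<oplus>\<^bsub>middle E\<^esub> m = incl E y"
    using assms ker_proj[of "\<ominus>\<^bsub>middle E\<^esub> m' \<oplus>\<^bsub>middle E\<^esub> m"] by auto
  then show ?thesis
    using that[of y] assms M.M.r_neg2[of m' m] by simp
qed

end

lemma is_extension_pullback:
  fixes E :: "('r, 'y, 'm, 'x) extension"
  assumes "left_module R X" "left_module R Y" "left_module R X'" "is_extension R X Y E"
    and g: "g \<in> lmod_hom R X' X"
  shows "is_extension R X' Y (pullback_ext Y X' g E)"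
proof -
  interpret lmod_extension R X Y E by (rule lmod_extension.intro) fact+
  interpret X': left_module R X' by fact
  let ?P = "{(m, x) \<in> carrier (middle E) \<times> carrier X'. proj E m = g x}"
  let ?Q = "(lmod_prod (middle E) X')\<lparr>carrier := ?P\<rparr>"
  note [simp] = lmod_hom_closed[OF g] lmod_hom_zero[OF X'.left_module_axioms X g]
    lmod_hom_add[OF g] lmod_hom_smult[OF g]
  have "lmod_submodule R (lmod_prod (middle E) X') ?P"
    unfolding lmod_submodule_def lmod_submodule_axioms_def
    by (auto intro!: left_module_prod M X'.left_module_axioms)
  then have Q: "left_module R ?Q" by (rule lmod_submodule.left_module_sub)
  have sel: "middle (pullback_ext Y X' g E) = ?Q"
    "incl (pullback_ext Y X' g E) = (\<lambda>y\<in>carrier Y. (incl E y, \<zero>\<^bsub>X'\<^esub>))"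
    "proj (pullback_ext Y X' g E) = (\<lambda>p\<in>?P. snd p)"
    by (simp_all add: pullback_ext_def Let_def)
  show ?thesis
    unfolding is_extension_def sel
  proof (intro conjI)
    show "left_module R ?Q" by (rule Q)
    show "(\<lambda>y\<in>carrier Y. (incl E y, \<zero>\<^bsub>X'\<^esub>)) \<in> lmod_hom R Y ?Q"
      by (rule lmod_homI[OF Y Q]) (auto simp: X'.smult_zero_r)
    show "(\<lambda>p\<in>?P. snd p) \<in> lmod_hom R ?Q X'"
      by (rule lmod_homI[OF Q X'.left_module_axioms]) auto
    show "inj_on (\<lambda>y\<in>carrier Y. (incl E y, \<zero>\<^bsub>X'\<^esub>)) (carrier Y)" by (auto simp: inj_on_def)
    show "(\<lambda>y\<in>carrier Y. (incl E y, \<zero>\<^bsub>X'\<^esub>)) ` carrier Y =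
        {m \<in> carrier ?Q. (\<lambda>p\<in>?P. snd p) m = \<zero>\<^bsub>X'\<^esub>}"
      by (auto elim!: ker_proj)
    show "(\<lambda>p\<in>?P. snd p) ` carrier ?Q = carrier X'"
    proof (intro subset_antisym subsetI)
      fix x assume x: "x \<in> carrier X'"
      then obtain m where m: "m \<in> carrier (middle E)" "proj E m = g x"
        using proj_surj[of "g x"] by auto
      with x have "(m, x) \<in> ?P" by simp
      then show "x \<in> (\<lambda>p\<in>?P. snd p) ` carrier ?Q" by (intro image_eqI[of _ _ "(m, x)"]) auto
    qed auto
  qed
qed

lemma is_extension_prod:
  fixes E E' :: "('r, 'y, 'm, 'x) extension"
  assumes "left_module R X" "left_module R Y" "is_extension R X Y E" "is_extension R X Y E'"
  shows "is_extension R (lmod_prod X X) (lmod_prod Y Y) (prod_ext Y E E')"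
proof -
  interpret E: lmod_extension R X Y E by (rule lmod_extension.intro) fact+
  interpret E': lmod_extension R X Y E' by (rule lmod_extension.intro) fact+
  note XX = left_module_prod[OF E.X E.X] and YY = left_module_prod[OF E.Y E.Y]
    and MM = left_module_prod[OF E.M E'.M]
  show ?thesis
    unfolding is_extension_def prod_ext_def extension.simps
  proof (intro conjI)
    show "left_module R (lmod_prod (middle E) (middle E'))" by (rule MM)
    show "(\<lambda>(y, y')\<in>carrier Y \<times> carrier Y. (incl E y, incl E' y'))
        \<in> lmod_hom R (lmod_prod Y Y) (lmod_prod (middle E) (middle E'))"
      by (rule lmod_homI[OF YY MM]) auto
    show "(\<lambda>(m, m')\<in>carrier (middle E) \<times> carrier (middle E'). (proj E m, proj E' m'))
        \<in> lmod_hom R (lmod_prod (middle E) (middle E')) (lmod_prod X X)"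
      by (rule lmod_homI[OF MM XX]) auto
    show "inj_on (\<lambda>(y, y')\<in>carrier Y \<times> carrier Y. (incl E y, incl E' y')) (carrier (lmod_prod Y Y))"
      by (auto simp: inj_on_def)
    show "(\<lambda>(y, y')\<in>carrier Y \<times> carrier Y. (incl E y, incl E' y')) ` carrier (lmod_prod Y Y) =
      {m \<in> carrier (lmod_prod (middle E) (middle E')).
        (\<lambda>(m, m')\<in>carrier (middle E) \<times> carrier (middle E'). (proj E m, proj E' m')) m =
        \<zero>\<^bsub>lmod_prod X X\<^esub>}"
      by (auto elim!: E.ker_proj E'.ker_proj)
    show "(\<lambda>(m, m')\<in>carrier (middle E) \<times> carrier (middle E'). (proj E m, proj E' m')) `
        carrier (lmod_prod (middle E) (middle E')) = carrier (lmod_prod X X)"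
    proof (intro subset_antisym subsetI)
      fix p assume "p \<in> carrier (lmod_prod X X)"
      then obtain x x' where p: "p = (x, x')" "x \<in> carrier X" "x' \<in> carrier X" by auto
      obtain m where "m \<in> carrier (middle E)" "proj E m = x" using p by (auto elim: E.proj_surj)
      moreover obtain m' where "m' \<in> carrier (middle E')" "proj E' m' = x'"
        using p by (auto elim: E'.proj_surj)
      ultimately show "p \<in> (\<lambda>(m, m')\<in>carrier (middle E) \<times> carrier (middle E'). (proj E m, proj E' m')) `
        carrier (lmod_prod (middle E) (middle E'))"
        using p by (intro image_eqI[of _ _ "(m, m')"]) auto
    qed auto
  qed
qed

lemma is_extension_split:
  assumes "left_module R X" "left_module R Y"
  shows "is_extension R X Y (split_ext X Y)"
proof -
  interpret X: left_module R X by fact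
  interpret Y: left_module R Y by fact
  note P = left_module_prod[OF assms(2,1)]
  show ?thesis
    unfolding is_extension_def split_ext_def extension.simps
  proof (intro conjI)
    show "(\<lambda>y\<in>carrier Y. (y, \<zero>\<^bsub>X\<^esub>)) \<in> lmod_hom R Y (lmod_prod Y X)"
      by (rule lmod_homI[OF assms(2) P]) (auto simp: X.smult_zero_r)
    show "(\<lambda>p\<in>carrier Y \<times> carrier X. snd p) \<in> lmod_hom R (lmod_prod Y X) X"
      by (rule lmod_homI[OF P assms(1)]) auto
    show "(\<lambda>p\<in>carrier Y \<times> carrier X. snd p) ` carrier (lmod_prod Y X) = carrier X"
      by (auto simp: image_iff intro!: bexI[of _ "\<zero>\<^bsub>Y\<^esub>"])
  qed (auto simp: P inj_on_def)
qed

section \<open>Factor sets and the group structure of Ext\<close>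

text \<open>
  A factor set in the three variables \<open>r, x, x'\<close> measures the defect of \<open>s\<close> on \<open>r x + x'\<close>, and so
  encodes the additive and the scalar cocycle of the section at once.
\<close>

definition factor_set ::
    "('r, 'k) ring_scheme \<Rightarrow> ('r, 'x) module \<Rightarrow> ('r, 'y) module \<Rightarrow>
     ('r, 'y, 'm, 'x) extension \<Rightarrow> ('r \<Rightarrow> 'x \<Rightarrow> 'x \<Rightarrow> 'y) \<Rightarrow> bool" where
  "factor_set R X Y E a \<longleftrightarrow>
    (\<exists>s. (\<forall>x\<in>carrier X. s x \<in> carrier (middle E) \<and> proj E (s x) = x) \<and>
      (\<forall>r\<in>carrier R. \<forall>x\<in>carrier X. \<forall>x'\<in>carrier X. a r x x' \<in> carrier Y \<and>
        r \<odot>\<^bsub>middle E\<^esub> s x \<oplus>\<^bsub>middle E\<^esub> s x' =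
          s (r \<odot>\<^bsub>X\<^esub> x \<oplus>\<^bsub>X\<^esub> x') \<oplus>\<^bsub>middle E\<^esub> incl E (a r x x')))"

lemma factor_setE:
  assumes "factor_set R X Y E a"
  obtains s where
    "\<And>x. x \<in> carrier X \<Longrightarrow> s x \<in> carrier (middle E)" "\<And>x. x \<in> carrier X \<Longrightarrow> proj E (s x) = x"
    "\<And>r x x'. \<lbrakk>r \<in> carrier R; x \<in> carrier X; x' \<in> carrier X\<rbrakk> \<Longrightarrow> a r x x' \<in> carrier Y"
    "\<And>r x x'. \<lbrakk>r \<in> carrier R; x \<in> carrier X; x' \<in> carrier X\<rbrakk> \<Longrightarrow>
      r \<odot>\<^bsub>middle E\<^esub> s x \<oplus>\<^bsub>middle E\<^esub> s x' =
        s (r \<odot>\<^bsub>X\<^esub> x \<oplus>\<^bsub>X\<^esub> x') \<oplus>\<^bsub>middle E\<^esub> incl E (a r x x')"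
  using assms unfolding factor_set_def by (elim exE conjE) (rule that, auto)

lemma factor_set_cong:
  assumes "factor_set R X Y E a"
    and "\<And>r x x'. \<lbrakk>r \<in> carrier R; x \<in> carrier X; x' \<in> carrier X\<rbrakk> \<Longrightarrow> a r x x' = b r x x'"
  shows "factor_set R X Y E b"
  using assms unfolding factor_set_def by simp

context lmod_extension
begin

lemma section_exists:
  obtains s where
    "\<And>x. x \<in> carrier X \<Longrightarrow> s x \<in> carrier (middle E)" "\<And>x. x \<in> carrier X \<Longrightarrow> proj E (s x) = x"
proof -
  have "\<forall>x\<in>carrier X. \<exists>m. m \<in> carrier (middle E) \<and> proj E m = x"
    using proj_surj by blast
  then obtain s where "\<forall>x\<in>carrier X. s x \<in> carrier (middle E) \<and> proj E (s x) = x"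
    by (rule bchoice[THEN exE]) blast
  then show ?thesis using that by blast
qed

lemma factor_set_exists: "\<exists>a. factor_set R X Y E a"
proof -
  obtain s where s: "\<And>x. x \<in> carrier X \<Longrightarrow> s x \<in> carrier (middle E)"
    "\<And>x. x \<in> carrier X \<Longrightarrow> proj E (s x) = x" by (rule section_exists) blast
  have "\<exists>y. y \<in> carrier Y \<and> r \<odot>\<^bsub>middle E\<^esub> s x \<oplus>\<^bsub>middle E\<^esub> s x' =
          s (r \<odot>\<^bsub>X\<^esub> x \<oplus>\<^bsub>X\<^esub> x') \<oplus>\<^bsub>middle E\<^esub> incl E y"
    if "r \<in> carrier R" "x \<in> carrier X" "x' \<in> carrier X" for r x x'
    using that s fibre_proj[of "r \<odot>\<^bsub>middle E\<^esub> s x \<oplus>\<^bsub>middle E\<^esub> s x'" "s (r \<odot>\<^bsub>X\<^esub> x \<oplus>\<^bsub>X\<^esub> x')"]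
    by (metis M.M.a_closed M.smult_closed X.M.a_closed X.smult_closed proj_simps(3) proj_simps(4))
  then have "\<exists>a. \<forall>r\<in>carrier R. \<forall>x\<in>carrier X. \<forall>x'\<in>carrier X. a r x x' \<in> carrier Y \<and>
      r \<odot>\<^bsub>middle E\<^esub> s x \<oplus>\<^bsub>middle E\<^esub> s x' =
          s (r \<odot>\<^bsub>X\<^esub> x \<oplus>\<^bsub>X\<^esub> x') \<oplus>\<^bsub>middle E\<^esub> incl E (a r x x')"
    by metis
  then obtain a where "\<forall>r\<in>carrier R. \<forall>x\<in>carrier X. \<forall>x'\<in>carrier X. a r x x' \<in> carrier Y \<and>
      r \<odot>\<^bsub>middle E\<^esub> s x \<oplus>\<^bsub>middle E\<^esub> s x' =
          s (r \<odot>\<^bsub>X\<^esub> x \<oplus>\<^bsub>X\<^esub> x') \<oplus>\<^bsub>middle E\<^esub> incl E (a r x x')" ..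
  then have "factor_set R X Y E a" unfolding factor_set_def by (intro exI[of _ s]) (simp add: s)
  then show ?thesis by blast
qed

text \<open>Composing the section with the equivalence gives a section of \<open>E'\<close> with the
  same defect. The middle terms may have different types, which lets the members of a class be
  compared with an extension given elsewhere.\<close>

lemma factor_set_equiv:
  assumes "factor_set R X Y E a" "ext_equiv R Y E E'"
  shows "factor_set R X Y E' a"
proof -
  obtain h where h: "h \<in> lmod_hom R (middle E) (middle E')"
    and hi: "\<And>y. y \<in> carrier Y \<Longrightarrow> h (incl E y) = incl E' y"
    and hp: "\<And>m. m \<in> carrier (middle E) \<Longrightarrow> proj E' (h m) = proj E m"
    using assms(2) by (auto simp: ext_equiv_def lmod_iso_def)
  from assms(1) obtain s where
    s: "\<And>x. x \<in> carrier X \<Longrightarrow> s x \<in> carrier (middle E)" "\<And>x. x \<in> carrier X \<Longrightarrow> proj E (s x) = x"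
    and a: "\<And>r x x'. \<lbrakk>r \<in> carrier R; x \<in> carrier X; x' \<in> carrier X\<rbrakk> \<Longrightarrow> a r x x' \<in> carrier Y"
    and sa: "\<And>r x x'. \<lbrakk>r \<in> carrier R; x \<in> carrier X; x' \<in> carrier X\<rbrakk> \<Longrightarrow>
      r \<odot>\<^bsub>middle E\<^esub> s x \<oplus>\<^bsub>middle E\<^esub> s x' =
        s (r \<odot>\<^bsub>X\<^esub> x \<oplus>\<^bsub>X\<^esub> x') \<oplus>\<^bsub>middle E\<^esub> incl E (a r x x')"
    by (rule factor_setE) blast
  have "r \<odot>\<^bsub>middle E'\<^esub> h (s x) \<oplus>\<^bsub>middle E'\<^esub> h (s x') =
        h (s (r \<odot>\<^bsub>X\<^esub> x \<oplus>\<^bsub>X\<^esub> x')) \<oplus>\<^bsub>middle E'\<^esub> incl E' (a r x x')"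
    if "r \<in> carrier R" "x \<in> carrier X" "x' \<in> carrier X" for r x x'
  proof -
    have "r \<odot>\<^bsub>middle E'\<^esub> h (s x) \<oplus>\<^bsub>middle E'\<^esub> h (s x') = h (r \<odot>\<^bsub>middle E\<^esub> s x \<oplus>\<^bsub>middle E\<^esub> s x')"
      using that by (simp add: lmod_hom_lin[OF M h] s)
    also have "\<dots> = h (s (r \<odot>\<^bsub>X\<^esub> x \<oplus>\<^bsub>X\<^esub> x')) \<oplus>\<^bsub>middle E'\<^esub> h (incl E (a r x x'))"
      using that by (simp add: sa s a lmod_hom_add[OF h])
    finally show ?thesis using that by (simp add: hi a)
  qed
  then show ?thesis unfolding factor_set_def
    by (intro exI[of _ "\<lambda>x. h (s x)"]) (simp add: s a hp lmod_hom_closed[OF h])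
qed

end

text \<open>Every element of the middle term is uniquely of the form \<open>s x + incl y\<close>,
  and in these coordinates the linear structure is determined by \<open>a\<close>. Matching the
  coordinates of the two sections is therefore an equivalence.\<close>

lemma factor_set_unique:
  assumes "left_module R X" "left_module R Y" "is_extension R X Y E" "is_extension R X Y E'"
    "factor_set R X Y E a" "factor_set R X Y E' a"
  shows "ext_equiv R Y E E'"
proof -
  interpret E: lmod_extension R X Y E by (rule lmod_extension.intro) fact+
  interpret E': lmod_extension R X Y E' by (rule lmod_extension.intro) fact+
  let ?M = "middle E" and ?M' = "middle E'"
  from assms(5) obtain s where
    s: "\<And>x. x \<in> carrier X \<Longrightarrow> s x \<in> carrier ?M" "\<And>x. x \<in> carrier X \<Longrightarrow> proj E (s x) = x"
    and a: "\<And>r x x'. \<lbrakk>r \<in> carrier R; x \<in> carrier X; x' \<in> carrier X\<rbrakk> \<Longrightarrow> a r x x' \<in> carrier Y"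
    and sa: "\<And>r x x'. \<lbrakk>r \<in> carrier R; x \<in> carrier X; x' \<in> carrier X\<rbrakk> \<Longrightarrow>
      r \<odot>\<^bsub>?M\<^esub> s x \<oplus>\<^bsub>?M\<^esub> s x' = s (r \<odot>\<^bsub>X\<^esub> x \<oplus>\<^bsub>X\<^esub> x') \<oplus>\<^bsub>?M\<^esub> incl E (a r x x')"
    by (rule factor_setE) blast
  from assms(6) obtain s' where
    s': "\<And>x. x \<in> carrier X \<Longrightarrow> s' x \<in> carrier ?M'" "\<And>x. x \<in> carrier X \<Longrightarrow> proj E' (s' x) = x"
    and sa': "\<And>r x x'. \<lbrakk>r \<in> carrier R; x \<in> carrier X; x' \<in> carrier X\<rbrakk> \<Longrightarrow>
      r \<odot>\<^bsub>?M'\<^esub> s' x \<oplus>\<^bsub>?M'\<^esub> s' x' = s' (r \<odot>\<^bsub>X\<^esub> x \<oplus>\<^bsub>X\<^esub> x') \<oplus>\<^bsub>?M'\<^esub> incl E' (a r x x')"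
    by (rule factor_setE) blast
  have "\<forall>m\<in>carrier ?M. \<exists>y. y \<in> carrier Y \<and> m = s (proj E m) \<oplus>\<^bsub>?M\<^esub> incl E y"
    using E.fibre_proj s by (metis E.proj_simps(1))
  then obtain \<eta> where \<eta>: "\<And>m. m \<in> carrier ?M \<Longrightarrow> \<eta> m \<in> carrier Y"
    "\<And>m. m \<in> carrier ?M \<Longrightarrow> m = s (proj E m) \<oplus>\<^bsub>?M\<^esub> incl E (\<eta> m)" by metis
  define h where "h = (\<lambda>m\<in>carrier ?M. s' (proj E m) \<oplus>\<^bsub>?M'\<^esub> incl E' (\<eta> m))"
  have h: "h (s x \<oplus>\<^bsub>?M\<^esub> incl E y) = s' x \<oplus>\<^bsub>?M'\<^esub> incl E' y"
    if "x \<in> carrier X" "y \<in> carrier Y" for x y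
  proof -
    have m: "s x \<oplus>\<^bsub>?M\<^esub> incl E y \<in> carrier ?M" using that s by simp
    have "s x \<oplus>\<^bsub>?M\<^esub> incl E (\<eta> (s x \<oplus>\<^bsub>?M\<^esub> incl E y)) = s x \<oplus>\<^bsub>?M\<^esub> incl E y"
      using \<eta>(2)[OF m] that s by simp
    then have "\<eta> (s x \<oplus>\<^bsub>?M\<^esub> incl E y) = y" using that s \<eta>(1)[OF m] by simp
    then show ?thesis using m that s by (simp add: h_def)
  qed
  have dec: "\<exists>x\<in>carrier X. \<exists>y\<in>carrier Y. m = s x \<oplus>\<^bsub>?M\<^esub> incl E y" if "m \<in> carrier ?M" for m
    using \<eta>[OF that] that by (meson E.proj_simps(1))
  \<comment> \<open>Separates the section part from the \<open>Y\<close> part, so that the factor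
    set can be applied to the former.\<close>
  have lin: "r \<odot>\<^bsub>M\<^esub> (u \<oplus>\<^bsub>M\<^esub> v) \<oplus>\<^bsub>M\<^esub> (u' \<oplus>\<^bsub>M\<^esub> v') = (r \<odot>\<^bsub>M\<^esub> u \<oplus>\<^bsub>M\<^esub> u') \<oplus>\<^bsub>M\<^esub> (r \<odot>\<^bsub>M\<^esub> v \<oplus>\<^bsub>M\<^esub> v')"
    if "left_module R M" "r \<in> carrier R" "u \<in> carrier M" "v \<in> carrier M" "u' \<in> carrier M" "v' \<in> carrier M"
    for r u v u' v' and M :: "('a, 'z) module"
  proof -
    interpret M: left_module R M by fact
    show ?thesis using that(2-) by (simp add: M.smult_r_distr M.M.a_ac)
  qed
  have "h \<in> lmod_hom R ?M ?M'"
  proof (rule lmod_homI[OF E.M E'.M])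
    show "h \<in> carrier ?M \<rightarrow>\<^sub>E carrier ?M'" by (auto simp: h_def s' \<eta>)
    fix r m n assume r: "r \<in> carrier R" and m: "m \<in> carrier ?M" and n: "n \<in> carrier ?M"
    obtain x y where x: "x \<in> carrier X" "y \<in> carrier Y" "m = s x \<oplus>\<^bsub>?M\<^esub> incl E y" using dec[OF m] by blast
    obtain x' y' where x': "x' \<in> carrier X" "y' \<in> carrier Y" "n = s x' \<oplus>\<^bsub>?M\<^esub> incl E y'" using dec[OF n] by blast
    \<comment> \<open>The coordinates of \<open>r m + n\<close>: the defect of the section joins the
      linear combination of the \<open>Y\<close> parts. They are the same on both sides.\<close>
    let ?y = "a r x x' \<oplus>\<^bsub>Y\<^esub> (r \<odot>\<^bsub>Y\<^esub> y \<oplus>\<^bsub>Y\<^esub> y')" and ?x = "r \<odot>\<^bsub>X\<^esub> x \<oplus>\<^bsub>X\<^esub> x'"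
    have "r \<odot>\<^bsub>?M\<^esub> m \<oplus>\<^bsub>?M\<^esub> n = s ?x \<oplus>\<^bsub>?M\<^esub> incl E ?y"
      using r x x' by (simp add: lin[OF E.M] s sa a E.M.M.a_assoc)
    moreover have "r \<odot>\<^bsub>?M'\<^esub> h m \<oplus>\<^bsub>?M'\<^esub> h n = s' ?x \<oplus>\<^bsub>?M'\<^esub> incl E' ?y"
      using r x x' by (simp add: h lin[OF E'.M] s' sa' a E'.M.M.a_assoc)
    moreover have "?x \<in> carrier X" "?y \<in> carrier Y" using r x x' by (simp_all add: a)
    ultimately show "h (r \<odot>\<^bsub>?M\<^esub> m \<oplus>\<^bsub>?M\<^esub> n) = r \<odot>\<^bsub>?M'\<^esub> h m \<oplus>\<^bsub>?M'\<^esub> h n"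
      by (simp only: h)
  qed
  moreover have "bij_betw h (carrier ?M) (carrier ?M')"
    unfolding bij_betw_def
  proof (intro conjI subset_antisym subsetI inj_onI)
    fix m n assume m: "m \<in> carrier ?M" and n: "n \<in> carrier ?M" and eq: "h m = h n"
    obtain x y where x: "x \<in> carrier X" "y \<in> carrier Y" "m = s x \<oplus>\<^bsub>?M\<^esub> incl E y" using dec[OF m] by blast
    obtain x' y' where x': "x' \<in> carrier X" "y' \<in> carrier Y" "n = s x' \<oplus>\<^bsub>?M\<^esub> incl E y'" using dec[OF n] by blast
    have eq': "s' x \<oplus>\<^bsub>?M'\<^esub> incl E' y = s' x' \<oplus>\<^bsub>?M'\<^esub> incl E' y'" using eq x x' by (simp add: h)
    \<comment> \<open>Projecting recovers \<open>x\<close>; cancelling the section then recovers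
      \<open>y\<close>.\<close>
    then have "proj E' (s' x \<oplus>\<^bsub>?M'\<^esub> incl E' y) = proj E' (s' x' \<oplus>\<^bsub>?M'\<^esub> incl E' y')" by simp
    then have "x = x'" using x x' s' by simp
    then show "m = n" using eq' x x' s' by simp
  next
    fix m assume "m \<in> h ` carrier ?M"
    then show "m \<in> carrier ?M'" by (auto simp: h_def s' \<eta>)
  next
    fix m assume m: "m \<in> carrier ?M'"
    then obtain y where "y \<in> carrier Y" "m = s' (proj E' m) \<oplus>\<^bsub>?M'\<^esub> incl E' y"
      using E'.fibre_proj[of m "s' (proj E' m)"] s' by auto
    then have "m = h (s (proj E' m) \<oplus>\<^bsub>?M\<^esub> incl E y)" "s (proj E' m) \<oplus>\<^bsub>?M\<^esub> incl E y \<in> carrier ?M"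
      using m by (simp_all add: h s)
    then show "m \<in> h ` carrier ?M" by blast
  qed
  moreover have "h (incl E y) = incl E' y" if y: "y \<in> carrier Y" for y
  proof -
    let ?z = "a \<one>\<^bsub>R\<^esub> \<zero>\<^bsub>X\<^esub> \<zero>\<^bsub>X\<^esub>"
    have z: "?z \<in> carrier Y" by (simp add: a)
    \<comment> \<open>Both sections take the same value at zero, which the factor set records.\<close>
    have s0: "s \<zero>\<^bsub>X\<^esub> = incl E ?z"
      using sa[of "\<one>\<^bsub>R\<^esub>" "\<zero>\<^bsub>X\<^esub>" "\<zero>\<^bsub>X\<^esub>"] z s by simp
    have s0': "s' \<zero>\<^bsub>X\<^esub> = incl E' ?z"
      using sa'[of "\<one>\<^bsub>R\<^esub>" "\<zero>\<^bsub>X\<^esub>" "\<zero>\<^bsub>X\<^esub>"] z s' by simp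
    \<comment> \<open>As sections need not vanish at zero, \<open>incl E y\<close> has
      \<open>Y\<close>-coordinate \<open>- a 1 0 0 + y\<close> over \<open>x = 0\<close>; the same
      shift occurs on both sides.\<close>
    have "h (s \<zero>\<^bsub>X\<^esub> \<oplus>\<^bsub>?M\<^esub> incl E (\<ominus>\<^bsub>Y\<^esub> ?z \<oplus>\<^bsub>Y\<^esub> y)) = s' \<zero>\<^bsub>X\<^esub> \<oplus>\<^bsub>?M'\<^esub> incl E' (\<ominus>\<^bsub>Y\<^esub> ?z \<oplus>\<^bsub>Y\<^esub> y)"
      using z y by (intro h) auto
    moreover have "s \<zero>\<^bsub>X\<^esub> \<oplus>\<^bsub>?M\<^esub> incl E (\<ominus>\<^bsub>Y\<^esub> ?z \<oplus>\<^bsub>Y\<^esub> y) = incl E y"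
      using z y by (simp add: s0 E.M.M.r_neg2)
    moreover have "s' \<zero>\<^bsub>X\<^esub> \<oplus>\<^bsub>?M'\<^esub> incl E' (\<ominus>\<^bsub>Y\<^esub> ?z \<oplus>\<^bsub>Y\<^esub> y) = incl E' y"
      using z y by (simp add: s0' E'.M.M.r_neg2)
    ultimately show ?thesis by simp
  qed
  moreover have "proj E' (h m) = proj E m" if "m \<in> carrier ?M" for m
    using that by (simp add: h_def s' \<eta>)
  ultimately show ?thesis unfolding ext_equiv_def lmod_iso_def by blast
qed

section \<open>Factor sets of the derived sequences\<close>

lemma factor_set_pullback:
  fixes E :: "('r, 'y, 'm, 'x) extension"
  assumes "left_module R X" "left_module R Y" "left_module R X'" "is_extension R X Y E"
    and g: "g \<in> lmod_hom R X' X" and fs: "factor_set R X Y E a"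
  shows "factor_set R X' Y (pullback_ext Y X' g E) (\<lambda>r x x'. a r (g x) (g x'))"
proof -
  interpret lmod_extension R X Y E by (rule lmod_extension.intro) fact+
  interpret X': left_module R X' by fact
  from fs obtain s where
    s: "\<And>x. x \<in> carrier X \<Longrightarrow> s x \<in> carrier (middle E)" "\<And>x. x \<in> carrier X \<Longrightarrow> proj E (s x) = x"
    and a: "\<And>r x x'. \<lbrakk>r \<in> carrier R; x \<in> carrier X; x' \<in> carrier X\<rbrakk> \<Longrightarrow> a r x x' \<in> carrier Y"
    and sa: "\<And>r x x'. \<lbrakk>r \<in> carrier R; x \<in> carrier X; x' \<in> carrier X\<rbrakk> \<Longrightarrow>
      r \<odot>\<^bsub>middle E\<^esub> s x \<oplus>\<^bsub>middle E\<^esub> s x' =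
        s (r \<odot>\<^bsub>X\<^esub> x \<oplus>\<^bsub>X\<^esub> x') \<oplus>\<^bsub>middle E\<^esub> incl E (a r x x')"
    by (rule factor_setE) blast
  \<comment> \<open>The section sends \<open>x\<close> to \<open>(s (g x), x)\<close>; its second
    component is linear, so the defect lies in the copy of \<open>Y\<close>.\<close>
  show ?thesis unfolding factor_set_def
    by (intro exI[of _ "\<lambda>x. (s (g x), x)"])
      (simp add: pullback_ext_def Let_def s a sa lmod_hom_closed[OF g]
        lmod_hom_lin[OF X'.left_module_axioms g])
qed

text \<open>The section is followed by the map into the push-out, and its defect
  \<open>incl E (a r x x')\<close> crosses the square to become the image of
  \<open>h (a r x x')\<close>.\<close>

lemma (in pushout_data) factor_set_pushout:
  assumes fs: "factor_set R X Y E a"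
  shows "factor_set R X Y' (pushout_ext Y Y' h E) (\<lambda>r x x'. h (a r x x'))"
proof -
  from fs obtain s where
    s: "\<And>x. x \<in> carrier X \<Longrightarrow> s x \<in> carrier (middle E)" "\<And>x. x \<in> carrier X \<Longrightarrow> proj E (s x) = x"
    and a: "\<And>r x x'. \<lbrakk>r \<in> carrier R; x \<in> carrier X; x' \<in> carrier X\<rbrakk> \<Longrightarrow> a r x x' \<in> carrier Y"
    and sa: "\<And>r x x'. \<lbrakk>r \<in> carrier R; x \<in> carrier X; x' \<in> carrier X\<rbrakk> \<Longrightarrow>
      r \<odot>\<^bsub>middle E\<^esub> s x \<oplus>\<^bsub>middle E\<^esub> s x' =
        s (r \<odot>\<^bsub>X\<^esub> x \<oplus>\<^bsub>X\<^esub> x') \<oplus>\<^bsub>middle E\<^esub> incl E (a r x x')"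
    by (rule factor_setE) blast
  show ?thesis unfolding factor_set_def
  proof (intro exI[of _ "\<lambda>x. \<kappa> \<zero>\<^bsub>Y'\<^esub> (s x)"] conjI ballI)
    fix r x x' assume *: "r \<in> carrier R" "x \<in> carrier X" "x' \<in> carrier X"
    show "h (a r x x') \<in> carrier Y'" using * by (simp add: a lmod_hom_closed[OF h])
    have "r \<odot>\<^bsub>lmod_quot P K\<^esub> \<kappa> \<zero>\<^bsub>Y'\<^esub> (s x) \<oplus>\<^bsub>lmod_quot P K\<^esub> \<kappa> \<zero>\<^bsub>Y'\<^esub> (s x') =
      \<kappa> \<zero>\<^bsub>Y'\<^esub> (s (r \<odot>\<^bsub>X\<^esub> x \<oplus>\<^bsub>X\<^esub> x') \<oplus>\<^bsub>middle E\<^esub> incl E (a r x x'))"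
      using * by (simp add: \<kappa>_smult \<kappa>_add s sa Y'.smult_zero_r)
    also have "\<dots> = \<kappa> \<zero>\<^bsub>Y'\<^esub> (s (r \<odot>\<^bsub>X\<^esub> x \<oplus>\<^bsub>X\<^esub> x')) \<oplus>\<^bsub>lmod_quot P K\<^esub> \<kappa> \<zero>\<^bsub>Y'\<^esub> (incl E (a r x x'))"
      using * by (simp add: \<kappa>_add s a lmod_hom_closed[OF incl_hom])
    finally show "r \<odot>\<^bsub>middle (pushout_ext Y Y' h E)\<^esub> \<kappa> \<zero>\<^bsub>Y'\<^esub> (s x)
        \<oplus>\<^bsub>middle (pushout_ext Y Y' h E)\<^esub> \<kappa> \<zero>\<^bsub>Y'\<^esub> (s x') =
      \<kappa> \<zero>\<^bsub>Y'\<^esub> (s (r \<odot>\<^bsub>X\<^esub> x \<oplus>\<^bsub>X\<^esub> x')) \<oplus>\<^bsub>middle (pushout_ext Y Y' h E)\<^esub>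
        incl (pushout_ext Y Y' h E) (h (a r x x'))"
      using * by (simp add: pushout_sel \<kappa>_incl a lmod_hom_closed[OF h])
  qed (simp_all add: pushout_sel(1) \<kappa>_closed proj_\<kappa> s)
qed

lemma factor_set_prod:
  fixes E E' :: "('r, 'y, 'm, 'x) extension"
  assumes "left_module R X" "left_module R Y" "is_extension R X Y E" "is_extension R X Y E'"
    "factor_set R X Y E a" "factor_set R X Y E' b"
  shows "factor_set R (lmod_prod X X) (lmod_prod Y Y) (prod_ext Y E E')
    (\<lambda>r p q. (a r (fst p) (fst q), b r (snd p) (snd q)))"
proof -
  interpret E: lmod_extension R X Y E by (rule lmod_extension.intro) fact+
  interpret E': lmod_extension R X Y E' by (rule lmod_extension.intro) fact+
  from assms(5) obtain s where
    s: "\<And>x. x \<in> carrier X \<Longrightarrow> s x \<in> carrier (middle E)" "\<And>x. x \<in> carrier X \<Longrightarrow> proj E (s x) = x"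
    and a: "\<And>r x x'. \<lbrakk>r \<in> carrier R; x \<in> carrier X; x' \<in> carrier X\<rbrakk> \<Longrightarrow> a r x x' \<in> carrier Y"
    and sa: "\<And>r x x'. \<lbrakk>r \<in> carrier R; x \<in> carrier X; x' \<in> carrier X\<rbrakk> \<Longrightarrow>
      r \<odot>\<^bsub>middle E\<^esub> s x \<oplus>\<^bsub>middle E\<^esub> s x' =
        s (r \<odot>\<^bsub>X\<^esub> x \<oplus>\<^bsub>X\<^esub> x') \<oplus>\<^bsub>middle E\<^esub> incl E (a r x x')"
    by (rule factor_setE) blast
  from assms(6) obtain s' where
    s': "\<And>x. x \<in> carrier X \<Longrightarrow> s' x \<in> carrier (middle E')" "\<And>x. x \<in> carrier X \<Longrightarrow> proj E' (s' x) = x"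
    and b: "\<And>r x x'. \<lbrakk>r \<in> carrier R; x \<in> carrier X; x' \<in> carrier X\<rbrakk> \<Longrightarrow> b r x x' \<in> carrier Y"
    and sb: "\<And>r x x'. \<lbrakk>r \<in> carrier R; x \<in> carrier X; x' \<in> carrier X\<rbrakk> \<Longrightarrow>
      r \<odot>\<^bsub>middle E'\<^esub> s' x \<oplus>\<^bsub>middle E'\<^esub> s' x' =
        s' (r \<odot>\<^bsub>X\<^esub> x \<oplus>\<^bsub>X\<^esub> x') \<oplus>\<^bsub>middle E'\<^esub> incl E' (b r x x')"
    by (rule factor_setE) blast
  show ?thesis unfolding factor_set_def
    by (intro exI[of _ "\<lambda>(x, x'). (s x, s' x')"])
      (simp add: prod_ext_def s a s' b sa sb split: prod.splits)
qed

text \<open>A coboundary belongs to the split sequence: \<open>x\<close> going to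
  \<open>(t x, x)\<close> is a section, and \<open>ta\<close> says that its defect is
  \<open>a\<close>. This is the criterion by which a class is shown to be zero.\<close>

lemma factor_set_split:
  assumes "left_module R X" "left_module R Y"
    and t: "\<And>x. x \<in> carrier X \<Longrightarrow> t x \<in> carrier Y"
    and a: "\<And>r x x'. \<lbrakk>r \<in> carrier R; x \<in> carrier X; x' \<in> carrier X\<rbrakk> \<Longrightarrow> a r x x' \<in> carrier Y"
    and ta: "\<And>r x x'. \<lbrakk>r \<in> carrier R; x \<in> carrier X; x' \<in> carrier X\<rbrakk> \<Longrightarrow>
      r \<odot>\<^bsub>Y\<^esub> t x \<oplus>\<^bsub>Y\<^esub> t x' = t (r \<odot>\<^bsub>X\<^esub> x \<oplus>\<^bsub>X\<^esub> x') \<oplus>\<^bsub>Y\<^esub> a r x x'"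
  shows "factor_set R X Y (split_ext X Y) a"
proof -
  interpret X: left_module R X by fact
  show ?thesis unfolding factor_set_def
    by (intro exI[of _ "\<lambda>x. (t x, x)"]) (simp add: split_ext_def t a ta)
qed

text \<open>\<open>ext_class\<close> collects only extensions on the type of pairs, so the class of
  an extension on another type could a priori be empty. A section identifies \<open>M\<close> with
  the pairs \<open>(y, x)\<close>, and the module structure is carried over along this
  bijection.\<close>

lemma (in lmod_extension) equiv_extension_exists:
  "\<exists>E' :: ('r, 'y, 'y \<times> 'x, 'x) extension. is_extension R X Y E' \<and> ext_equiv R Y E E'"
proof -
  let ?M = "middle E"
  obtain s where s: "\<And>x. x \<in> carrier X \<Longrightarrow> s x \<in> carrier ?M"
    "\<And>x. x \<in> carrier X \<Longrightarrow> proj E (s x) = x" by (rule section_exists) blast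
  have "\<forall>m\<in>carrier ?M. \<exists>y. y \<in> carrier Y \<and> m = s (proj E m) \<oplus>\<^bsub>?M\<^esub> incl E y"
    using fibre_proj s by (metis proj_simps(1))
  then obtain \<eta> where \<eta>: "\<And>m. m \<in> carrier ?M \<Longrightarrow> \<eta> m \<in> carrier Y"
    "\<And>m. m \<in> carrier ?M \<Longrightarrow> s (proj E m) \<oplus>\<^bsub>?M\<^esub> incl E (\<eta> m) = m" by metis
  define k where "k = (\<lambda>m\<in>carrier ?M. (\<eta> m, proj E m))"
  \<comment> \<open>\<open>b\<close> is the inverse of \<open>k\<close>; the operations of
    \<open>M'\<close> are computed by passing through \<open>M\<close>.\<close>
  define b where "b = (\<lambda>(y, x). s x \<oplus>\<^bsub>?M\<^esub> incl E y)"
  have b: "b p \<in> carrier ?M" if "p \<in> carrier Y \<times> carrier X" for p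
    using that s by (auto simp: b_def)
  have bk: "b (k m) = m" if "m \<in> carrier ?M" for m
    using that \<eta> by (simp add: b_def k_def)
  have kb: "k (b p) = p" if p_mem: "p \<in> carrier Y \<times> carrier X" for p
  proof -
    obtain y x where p: "p = (y, x)" "y \<in> carrier Y" "x \<in> carrier X" using p_mem by auto
    have m: "s x \<oplus>\<^bsub>?M\<^esub> incl E y \<in> carrier ?M" using p s by simp
    have "s x \<oplus>\<^bsub>?M\<^esub> incl E (\<eta> (s x \<oplus>\<^bsub>?M\<^esub> incl E y)) = s x \<oplus>\<^bsub>?M\<^esub> incl E y"
      using \<eta>(2)[OF m] p s by simp
    then have "\<eta> (s x \<oplus>\<^bsub>?M\<^esub> incl E y) = y" using p s \<eta>(1)[OF m] by simp
    then show ?thesis using m p s by (simp add: k_def b_def)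
  qed
  have k: "k m \<in> carrier Y \<times> carrier X" "snd (k m) = proj E m" if "m \<in> carrier ?M" for m
    using that \<eta> by (simp_all add: k_def)
  \<comment> \<open>The zero of \<open>M'\<close> is \<open>k 0\<close>, in general not
    \<open>(0, 0)\<close>, since the section need not vanish at zero.\<close>
  define M' :: "('r, 'y \<times> 'x) module" where
    "M' = \<lparr>carrier = carrier Y \<times> carrier X, mult = undefined, one = undefined, zero = k \<zero>\<^bsub>?M\<^esub>,
      add = (\<lambda>p q. k (b p \<oplus>\<^bsub>?M\<^esub> b q)), smult = (\<lambda>r p. k (r \<odot>\<^bsub>?M\<^esub> b p))\<rparr>"
  have im: "k ` carrier ?M = carrier Y \<times> carrier X"
  proof (intro subset_antisym subsetI)
    fix p assume "p \<in> carrier Y \<times> carrier X"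
    then show "p \<in> k ` carrier ?M" using kb b by (metis image_eqI)
  qed (use k(1) in blast)
  have M': "left_module R M'"
    by (rule left_module_image[OF M, where k = k]) (simp_all add: M'_def im bk)
  have khom: "k \<in> lmod_hom R ?M M'"
  proof (rule lmod_homI[OF M M'])
    show "k \<in> carrier ?M \<rightarrow>\<^sub>E carrier M'" using \<eta>(1) by (auto simp: k_def M'_def)
  qed (simp add: M'_def bk)
  have kinj: "inj_on k (carrier ?M)" by (metis bk inj_onI)
  have kiso: "k \<in> lmod_iso R ?M M'"
    using khom kinj im by (simp add: lmod_iso_def bij_betw_def M'_def)
  define E' where "E' = \<lparr>middle = M', incl = (\<lambda>y\<in>carrier Y. k (incl E y)),
    proj = (\<lambda>p\<in>carrier Y \<times> carrier X. snd p)\<rparr>"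
  have car: "carrier M' = k ` carrier ?M" using im by (simp add: M'_def)
  have pk: "proj E' (k m) = proj E m" if "m \<in> carrier ?M" for m
    using k[OF that] by (simp add: E'_def)
  have "is_extension R X Y E'"
    unfolding is_extension_def
  proof (intro conjI)
    show "left_module R (middle E')" using M' by (simp add: E'_def)
    show "incl E' \<in> lmod_hom R Y (middle E')"
      using lmod_hom_compose[OF Y M M' incl_hom khom] by (simp add: E'_def)
    have "proj E' \<in> lmod_hom R M' X"
    proof (rule lmod_homI[OF M' X])
      show "proj E' \<in> carrier M' \<rightarrow>\<^sub>E carrier X" by (auto simp: E'_def M'_def)
      fix r p q assume r: "r \<in> carrier R" and "p \<in> carrier M'" "q \<in> carrier M'"
      then obtain m n where m: "m \<in> carrier ?M" "p = k m" and n: "n \<in> carrier ?M" "q = k n"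
        by (auto simp: car)
      have "r \<odot>\<^bsub>M'\<^esub> p \<oplus>\<^bsub>M'\<^esub> q = k (r \<odot>\<^bsub>?M\<^esub> m \<oplus>\<^bsub>?M\<^esub> n)"
        using lmod_hom_lin[OF M khom r m(1) n(1)] m n by simp
      then show "proj E' (r \<odot>\<^bsub>M'\<^esub> p \<oplus>\<^bsub>M'\<^esub> q) = r \<odot>\<^bsub>X\<^esub> proj E' p \<oplus>\<^bsub>X\<^esub> proj E' q"
        using r m n by (simp add: pk)
    qed
    then show "proj E' \<in> lmod_hom R (middle E') X" by (simp add: E'_def)
    show "inj_on (incl E') (carrier Y)"
      by (simp add: E'_def inj_on_def inj_on_eq_iff[OF kinj])
    have "incl E' ` carrier Y = k ` (incl E ` carrier Y)"
      by (auto simp: E'_def image_image)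
    also have "\<dots> = k ` {m \<in> carrier ?M. proj E m = \<zero>\<^bsub>X\<^esub>}"
      using ext by (simp add: is_extension_def)
    also have "\<dots> = {p \<in> carrier M'. proj E' p = \<zero>\<^bsub>X\<^esub>}" by (auto simp: car pk)
    finally show "incl E' ` carrier Y = {p \<in> carrier (middle E'). proj E' p = \<zero>\<^bsub>X\<^esub>}"
      by (simp add: E'_def)
    have "proj E' ` carrier M' = proj E ` carrier ?M"
      by (simp add: car image_image pk)
    then show "proj E' ` carrier (middle E') = carrier X"
      using ext by (simp add: E'_def is_extension_def)
  qed
  moreover have "ext_equiv R Y E E'"
    unfolding ext_equiv_def by (rule bexI[of _ k]) (use kiso pk in \<open>auto simp: E'_def\<close>)
  ultimately show ?thesis by blast
qed

text \<open>The class is empty unless \<open>a\<close> is a factor set of some extension, so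
  non-emptiness takes the place of the cocycle identities. Factor sets that differ by a coboundary
  yield the same class.\<close>

definition fs_class ::
    "('r, 'k) ring_scheme \<Rightarrow> ('r, 'x) module \<Rightarrow> ('r, 'y) module \<Rightarrow>
     ('r \<Rightarrow> 'x \<Rightarrow> 'x \<Rightarrow> 'y) \<Rightarrow> ('r, 'y, 'y \<times> 'x, 'x) extension set" where
  "fs_class R X Y a = {E. is_extension R X Y E \<and> factor_set R X Y E a}"

section \<open>Addition and scalars of \<open>Ext1\<close>, computed on factor sets\<close>

locale ext_group =
  fixes R :: "('r, 'k) ring_scheme" and X :: "('r, 'x) module" and Y :: "('r, 'y) module"
  assumes X: "left_module R X" and Y: "left_module R Y"
begin

sublocale X: left_module R X by (rule X)
sublocale Y: left_module R Y by (rule Y)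

lemma fs_class_cong:
  assumes "\<And>r x x'. \<lbrakk>r \<in> carrier R; x \<in> carrier X; x' \<in> carrier X\<rbrakk> \<Longrightarrow> a r x x' = b r x x'"
  shows "fs_class R X Y a = fs_class R X Y b"
  using factor_set_cong[of R X Y _ a b] factor_set_cong[of R X Y _ b a] assms
  unfolding fs_class_def by fastforce

lemma fs_class_mem:
  assumes "fs_class R X Y a \<noteq> {}" "r \<in> carrier R" "x \<in> carrier X" "x' \<in> carrier X"
  shows "a r x x' \<in> carrier Y"
  using assms by (auto simp: fs_class_def factor_set_def)

text \<open>Equivalences preserve factor sets, and sharing one forces an equivalence, so both sides
  collect the same extensions; \<open>equiv_extension_exists\<close> supplies a member. From here on
  \<open>Ext1\<close> is computed with functions into \<open>Y\<close>.\<close>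

lemma ext_class_eq_fs_class:
  assumes "is_extension R X Y E" "factor_set R X Y E a"
  shows "ext_class R X Y E = fs_class R X Y a" "fs_class R X Y a \<noteq> {}"
proof -
  interpret lmod_extension R X Y E by (rule lmod_extension.intro) (fact X Y assms)+
  show "ext_class R X Y E = fs_class R X Y a"
    using factor_set_equiv[OF assms(2)] factor_set_unique[OF X Y assms(1) _ assms(2)]
    by (auto simp: ext_class_def fs_class_def)
  then show "fs_class R X Y a \<noteq> {}" using equiv_extension_exists by (auto simp: ext_class_def)
qed

lemma carrier_Ext1: "carrier (Ext1 R X Y) = {fs_class R X Y a | a. fs_class R X Y a \<noteq> {}}"
proof (intro subset_antisym subsetI)
  fix C assume "C \<in> carrier (Ext1 R X Y)"
  then obtain E :: "('r, 'y, 'y \<times> 'x, 'x) extension"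
    where E: "is_extension R X Y E" "C = ext_class R X Y E" by (auto simp: Ext1_def)
  then obtain a where "factor_set R X Y E a"
    using lmod_extension.factor_set_exists lmod_extension.intro[OF X Y] by blast
  then show "C \<in> {fs_class R X Y a | a. fs_class R X Y a \<noteq> {}}"
    using ext_class_eq_fs_class E by blast
next
  fix C assume "C \<in> {fs_class R X Y a | a. fs_class R X Y a \<noteq> {}}"
  then obtain a E where "C = fs_class R X Y a" "E \<in> fs_class R X Y a" by auto
  then show "C \<in> carrier (Ext1 R X Y)"
    using ext_class_eq_fs_class[of E a] by (auto simp: Ext1_def fs_class_def)
qed

lemma zero_Ext1:
  "\<zero>\<^bsub>Ext1 R X Y\<^esub> = fs_class R X Y (\<lambda>_ _ _. \<zero>\<^bsub>Y\<^esub>)" "fs_class R X Y (\<lambda>_ _ _. \<zero>\<^bsub>Y\<^esub>) \<noteq> {}"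
proof -
  have "factor_set R X Y (split_ext X Y) (\<lambda>_ _ _. \<zero>\<^bsub>Y\<^esub>)"
    by (rule factor_set_split[OF X Y, where t = "\<lambda>_. \<zero>\<^bsub>Y\<^esub>"]) (simp_all add: Y.smult_zero_r)
  from ext_class_eq_fs_class[OF is_extension_split[OF X Y] this]
  show "\<zero>\<^bsub>Ext1 R X Y\<^esub> = fs_class R X Y (\<lambda>_ _ _. \<zero>\<^bsub>Y\<^esub>)" "fs_class R X Y (\<lambda>_ _ _. \<zero>\<^bsub>Y\<^esub>) \<noteq> {}"
    by (simp_all add: Ext1_def)
qed

text \<open>The product has the pair of factor sets, the diagonal pull-back evaluates both at the
  same arguments in \<open>X\<close>, and the push-out along addition adds the two values.\<close>

lemma baer_sum_factor_set:
  fixes E E' :: "('r, 'y, 'm, 'x) extension"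
  assumes "is_extension R X Y E" "is_extension R X Y E'" "factor_set R X Y E a" "factor_set R X Y E' b"
  shows "is_extension R X Y (baer_sum X Y E E')"
    "factor_set R X Y (baer_sum X Y E E') (\<lambda>r x x'. a r x x' \<oplus>\<^bsub>Y\<^esub> b r x x')"
proof -
  let ?E = "pullback_ext (lmod_prod Y Y) X (\<lambda>x\<in>carrier X. (x, x)) (prod_ext Y E E')"
  note XX = left_module_prod[OF X X] and YY = left_module_prod[OF Y Y]
  have diag: "(\<lambda>x\<in>carrier X. (x, x)) \<in> lmod_hom R X (lmod_prod X X)"
    by (rule lmod_homI[OF X XX]) auto
  have sum: "(\<lambda>(y, y')\<in>carrier Y \<times> carrier Y. y \<oplus>\<^bsub>Y\<^esub> y') \<in> lmod_hom R (lmod_prod Y Y) Y"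
    by (rule lmod_homI[OF YY Y]) (auto simp: Y.smult_r_distr Y.M.a_ac)
  have ext: "is_extension R X (lmod_prod Y Y) ?E"
    by (rule is_extension_pullback[OF XX YY X is_extension_prod[OF X Y assms(1,2)] diag])
  have "factor_set R X (lmod_prod Y Y) ?E
    (\<lambda>r x x'. (a r (fst ((\<lambda>x\<in>carrier X. (x, x)) x)) (fst ((\<lambda>x\<in>carrier X. (x, x)) x')),
      b r (snd ((\<lambda>x\<in>carrier X. (x, x)) x)) (snd ((\<lambda>x\<in>carrier X. (x, x)) x'))))"
    by (rule factor_set_pullback[OF XX YY X is_extension_prod[OF X Y assms(1,2)] diag
          factor_set_prod[OF X Y assms]])
  then have fs: "factor_set R X (lmod_prod Y Y) ?E (\<lambda>r x x'. (a r x x', b r x x'))"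
    by (rule factor_set_cong) simp
  interpret E: lmod_extension R X "lmod_prod Y Y" ?E by (rule lmod_extension.intro[OF X YY ext])
  interpret pushout_data R X "lmod_prod Y Y" Y "\<lambda>(y, y')\<in>carrier Y \<times> carrier Y. y \<oplus>\<^bsub>Y\<^esub> y'" ?E
    by (rule pushout_data.intro[OF X YY Y E.M sum E.incl_hom E.proj_hom E.proj_incl])
  show "is_extension R X Y (baer_sum X Y E E')"
    unfolding baer_sum_def by (rule is_extension_pushout[OF ext])
  show "factor_set R X Y (baer_sum X Y E E') (\<lambda>r x x'. a r x x' \<oplus>\<^bsub>Y\<^esub> b r x x')"
    unfolding baer_sum_def
    by (rule factor_set_cong[OF factor_set_pushout[OF fs]])
      (use assms(3,4) in \<open>auto simp: factor_set_def\<close>)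
qed

text \<open>Any choice of representatives has a Baer sum with the pointwise sum as factor set, so
  the union that defines addition runs over a constant family. Non-emptiness of both classes keeps
  that family non-empty.\<close>

lemma add_Ext1:
  assumes "fs_class R X Y a \<noteq> {}" "fs_class R X Y b \<noteq> {}"
  shows "fs_class R X Y a \<oplus>\<^bsub>Ext1 R X Y\<^esub> fs_class R X Y b = fs_class R X Y (\<lambda>r x x'. a r x x' \<oplus>\<^bsub>Y\<^esub> b r x x')"
    and "fs_class R X Y (\<lambda>r x x'. a r x x' \<oplus>\<^bsub>Y\<^esub> b r x x') \<noteq> {}"
proof -
  have eq: "ext_class R X Y (baer_sum X Y E E') = fs_class R X Y (\<lambda>r x x'. a r x x' \<oplus>\<^bsub>Y\<^esub> b r x x')"
    and ne: "fs_class R X Y (\<lambda>r x x'. a r x x' \<oplus>\<^bsub>Y\<^esub> b r x x') \<noteq> {}"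
    if "E \<in> fs_class R X Y a" "E' \<in> fs_class R X Y b" for E E'
    using ext_class_eq_fs_class[OF baer_sum_factor_set[of E E' a b]] that
    unfolding fs_class_def[of R X Y a] fs_class_def[of R X Y b] by simp_all
  have "(\<Union>E\<in>fs_class R X Y a. \<Union>E'\<in>fs_class R X Y b. ext_class R X Y (baer_sum X Y E E')) =
    fs_class R X Y (\<lambda>r x x'. a r x x' \<oplus>\<^bsub>Y\<^esub> b r x x')"
    using eq assms by (simp cong: SUP_cong)
  then show "fs_class R X Y a \<oplus>\<^bsub>Ext1 R X Y\<^esub> fs_class R X Y b =
      fs_class R X Y (\<lambda>r x x'. a r x x' \<oplus>\<^bsub>Y\<^esub> b r x x')"
    by (simp add: Ext1_def)
  show "fs_class R X Y (\<lambda>r x x'. a r x x' \<oplus>\<^bsub>Y\<^esub> b r x x') \<noteq> {}" using ne assms by blast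
qed

lemma smult_Ext1:
  assumes "fs_class R X Y a \<noteq> {}" and d: "d \<in> lmod_hom R X X"
  shows "d \<odot>\<^bsub>Ext1 R X Y\<^esub> fs_class R X Y a = fs_class R X Y (\<lambda>r x x'. a r (d x) (d x'))"
    and "fs_class R X Y (\<lambda>r x x'. a r (d x) (d x')) \<noteq> {}"
proof -
  have eq: "ext_class R X Y (pullback_ext Y X d E) = fs_class R X Y (\<lambda>r x x'. a r (d x) (d x'))"
    and ne: "fs_class R X Y (\<lambda>r x x'. a r (d x) (d x')) \<noteq> {}" if "E \<in> fs_class R X Y a" for E
    using ext_class_eq_fs_class[OF is_extension_pullback[OF X Y X _ d] factor_set_pullback[OF X Y X _ d, of E a]]
      that unfolding fs_class_def[of R X Y a] by simp_all
  have "(\<Union>E\<in>fs_class R X Y a. ext_class R X Y (pullback_ext Y X d E)) =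
    fs_class R X Y (\<lambda>r x x'. a r (d x) (d x'))"
    using eq assms(1) by (simp cong: SUP_cong)
  then show "d \<odot>\<^bsub>Ext1 R X Y\<^esub> fs_class R X Y a = fs_class R X Y (\<lambda>r x x'. a r (d x) (d x'))"
    by (simp add: Ext1_def)
  show "fs_class R X Y (\<lambda>r x x'. a r (d x) (d x')) \<noteq> {}" using ne assms(1) by blast
qed

text \<open>The laws hold pointwise in \<open>Y\<close>. They are what the finite sums in
  \<open>lmod_basis\<close> rely on.\<close>

lemma Ext1_abelian_monoid: "abelian_monoid (Ext1 R X Y)"
proof (rule abelian_monoidI)
  show "\<zero>\<^bsub>Ext1 R X Y\<^esub> \<in> carrier (Ext1 R X Y)" using zero_Ext1 by (auto simp: carrier_Ext1)
  fix C assume "C \<in> carrier (Ext1 R X Y)"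
  then obtain a where a: "C = fs_class R X Y a" "fs_class R X Y a \<noteq> {}" by (auto simp: carrier_Ext1)
  show "\<zero>\<^bsub>Ext1 R X Y\<^esub> \<oplus>\<^bsub>Ext1 R X Y\<^esub> C = C"
    using a zero_Ext1 by (simp add: add_Ext1, intro fs_class_cong) (simp add: fs_class_mem)
  fix D assume "D \<in> carrier (Ext1 R X Y)"
  then obtain b where b: "D = fs_class R X Y b" "fs_class R X Y b \<noteq> {}" by (auto simp: carrier_Ext1)
  show "C \<oplus>\<^bsub>Ext1 R X Y\<^esub> D \<in> carrier (Ext1 R X Y)"
    unfolding carrier_Ext1 using a b add_Ext1[OF a(2) b(2)] by blast
  show "C \<oplus>\<^bsub>Ext1 R X Y\<^esub> D = D \<oplus>\<^bsub>Ext1 R X Y\<^esub> C"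
    using a b by (simp add: add_Ext1, intro fs_class_cong) (simp add: fs_class_mem Y.M.a_comm)
  fix F assume "F \<in> carrier (Ext1 R X Y)"
  then obtain c where c: "F = fs_class R X Y c" "fs_class R X Y c \<noteq> {}" by (auto simp: carrier_Ext1)
  show "C \<oplus>\<^bsub>Ext1 R X Y\<^esub> D \<oplus>\<^bsub>Ext1 R X Y\<^esub> F = C \<oplus>\<^bsub>Ext1 R X Y\<^esub> (D \<oplus>\<^bsub>Ext1 R X Y\<^esub> F)"
    using a b c by (simp add: add_Ext1, intro fs_class_cong) (simp add: fs_class_mem Y.M.a_assoc)
qed

text \<open>Non-emptiness is proved together with the equation, because \<open>add_Ext1\<close>
  needs it for the partial sum in the induction step.\<close>

lemma finsum_Ext1:
  assumes "finite A" "\<And>i. i \<in> A \<Longrightarrow> fs_class R X Y (a i) \<noteq> {}"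
  shows "(\<Oplus>\<^bsub>Ext1 R X Y\<^esub>i\<in>A. fs_class R X Y (a i)) = fs_class R X Y (\<lambda>r x x'. \<Oplus>\<^bsub>Y\<^esub>i\<in>A. a i r x x') \<and>
    fs_class R X Y (\<lambda>r x x'. \<Oplus>\<^bsub>Y\<^esub>i\<in>A. a i r x x') \<noteq> {}"
  using assms
proof (induction A rule: finite_induct)
  case empty
  interpret V: abelian_monoid "Ext1 R X Y" by (rule Ext1_abelian_monoid)
  show ?case by (simp add: zero_Ext1)
next
  case (insert j A)
  interpret V: abelian_monoid "Ext1 R X Y" by (rule Ext1_abelian_monoid)
  have IH: "(\<Oplus>\<^bsub>Ext1 R X Y\<^esub>i\<in>A. fs_class R X Y (a i)) = fs_class R X Y (\<lambda>r x x'. \<Oplus>\<^bsub>Y\<^esub>i\<in>A. a i r x x')"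
    "fs_class R X Y (\<lambda>r x x'. \<Oplus>\<^bsub>Y\<^esub>i\<in>A. a i r x x') \<noteq> {}" using insert by auto
  have j: "fs_class R X Y (a j) \<noteq> {}" using insert by auto
  have "(\<Oplus>\<^bsub>Ext1 R X Y\<^esub>i\<in>insert j A. fs_class R X Y (a i)) =
    fs_class R X Y (\<lambda>r x x'. a j r x x' \<oplus>\<^bsub>Y\<^esub> (\<Oplus>\<^bsub>Y\<^esub>i\<in>A. a i r x x'))"
    using insert.hyps insert.prems IH j
    by (subst V.finsum_insert) (auto simp: carrier_Ext1 add_Ext1)
  moreover have "fs_class R X Y (\<lambda>r x x'. a j r x x' \<oplus>\<^bsub>Y\<^esub> (\<Oplus>\<^bsub>Y\<^esub>i\<in>A. a i r x x')) =
      fs_class R X Y (\<lambda>r x x'. \<Oplus>\<^bsub>Y\<^esub>i\<in>insert j A. a i r x x')"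
    using insert.hyps insert.prems
    by (intro fs_class_cong) (subst Y.M.finsum_insert, auto simp: fs_class_mem)
  ultimately show ?case using add_Ext1(2)[OF j IH(2)] by simp
qed

end

section \<open>Homomorphisms into a universal sequence\<close>

lemma left_module_regular:
  assumes "ring R"
  shows "left_module R (regular_module R)"
proof -
  interpret R: ring R by fact
  have "abelian_group (regular_module R)"
  proof (rule abelian_groupI)
    fix x assume "x \<in> carrier (regular_module R)"
    then show "\<exists>y\<in>carrier (regular_module R).
        y \<oplus>\<^bsub>regular_module R\<^esub> x = \<zero>\<^bsub>regular_module R\<^esub>"
      by (intro bexI[of _ "\<ominus>\<^bsub>R\<^esub> x"]) (auto simp: regular_module_def R.l_neg)
  qed (auto simp: regular_module_def R.a_ac)
  then show ?thesis
    unfolding left_module_def left_module_axioms_def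
    using R.ring_axioms
    by (auto simp: regular_module_def R.l_distr R.r_distr R.m_assoc)
qed

text \<open>The generators are the images of the standard basis vectors. They are phrased through
  submodules so that a property defining a submodule of \<open>X\<close> need only be checked on
  \<open>S\<close>; both finiteness arguments have this form.\<close>

lemma finitely_presented_generators:
  assumes "ring R" "left_module R X" "finitely_presented R X"
  obtains S where "finite S" "S \<subseteq> carrier X"
    "\<And>H. \<lbrakk>lmod_submodule R X H; S \<subseteq> H\<rbrakk> \<Longrightarrow> carrier X \<subseteq> H"
proof -
  interpret R: ring R by fact
  interpret X: left_module R X by fact
  obtain n :: nat and p where p: "p \<in> lmod_hom R (lmod_sum {..<n} (\<lambda>_. regular_module R)) X"
    "p ` carrier (lmod_sum {..<n} (\<lambda>_. regular_module R)) = carrier X"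
    using assms(3) by (auto simp: finitely_presented_def Let_def)
  let ?F = "lmod_sum {..<n} (\<lambda>_. regular_module R)"
  have F: "left_module R ?F" by (intro left_module_sum assms(1) left_module_regular)
  define e where "e k = (\<lambda>i\<in>{..<n}. if i = k then \<one>\<^bsub>R\<^esub> else \<zero>\<^bsub>R\<^esub>)" for k
  have e: "e k \<in> carrier ?F" for k
    by (rule lmod_sum_carrierI[of _ _ _ "{..<n}"]) (auto simp: e_def regular_module_def)
  show ?thesis
  proof (rule that[of "(\<lambda>k. p (e k)) ` {..<n}"])
    show "(\<lambda>k. p (e k)) ` {..<n} \<subseteq> carrier X" using e lmod_hom_closed[OF p(1)] by auto
    fix H assume "lmod_submodule R X H" and S: "(\<lambda>k. p (e k)) ` {..<n} \<subseteq> H"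
    then interpret H: lmod_submodule R X H by simp
    show "carrier X \<subseteq> H"
    proof
      fix x assume "x \<in> carrier X"
      then obtain v where v: "v \<in> carrier ?F" "x = p v" using p(2) by auto
      \<comment> \<open>\<open>w m\<close> keeps the first \<open>m\<close> coordinates of
        \<open>v\<close>. It interpolates between zero and \<open>v\<close>, and each step adds one
        multiple of a basis vector, a combination under which submodules are closed.\<close>
      define w where "w m = (\<lambda>i\<in>{..<n}. if i < m then v i else \<zero>\<^bsub>R\<^esub>)" for m
      have vi: "v i \<in> carrier R" if "i < n" for i
        using lmod_sum_nth[OF v(1), of i] that by (simp add: regular_module_def)
      have w: "w m \<in> carrier ?F" for m
        by (rule lmod_sum_carrierI[of _ _ _ "{..<n}"]) (auto simp: w_def regular_module_def vi)
      have "p (w m) \<in> H" if "m \<le> n" for m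
        using that
      proof (induction m)
        case 0
        have "w 0 = \<zero>\<^bsub>?F\<^esub>" by (simp add: w_def lmod_sum_simps regular_module_def)
        then show ?case using H.zero_mem by (simp add: lmod_hom_zero[OF F X.left_module_axioms p(1)])
      next
        case (Suc m)
        have "w (Suc m) = v m \<odot>\<^bsub>?F\<^esub> e m \<oplus>\<^bsub>?F\<^esub> w m"
          using Suc.prems vi
          by (auto simp: w_def e_def lmod_sum_simps regular_module_def fun_eq_iff less_Suc_eq)
        then have "p (w (Suc m)) = v m \<odot>\<^bsub>X\<^esub> p (e m) \<oplus>\<^bsub>X\<^esub> p (w m)"
          using Suc.prems vi e w by (simp add: lmod_hom_lin[OF F p(1)])
        then show ?case using Suc S vi by (auto intro!: H.lin_mem)
      qed
      moreover have "w n = v"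
        using v(1) by (auto simp: w_def lmod_sum_simps fun_eq_iff PiE_def extensional_def)
      ultimately show "x \<in> H" using v by auto
    qed
  qed simp
qed

section \<open>The summation map and direct sums of homomorphisms\<close>

lemma (in left_module) finsum_smult:
  assumes "finite A" "r \<in> carrier R" "v \<in> A \<rightarrow> carrier M"
  shows "r \<odot>\<^bsub>M\<^esub> (\<Oplus>\<^bsub>M\<^esub>j\<in>A. v j) = (\<Oplus>\<^bsub>M\<^esub>j\<in>A. r \<odot>\<^bsub>M\<^esub> v j)"
  using assms(1,3)
proof (induction A rule: finite_induct)
  case empty
  then show ?case using assms(2) by (simp add: smult_zero_r)
next
  case (insert j A)
  have v: "v \<in> A \<rightarrow> carrier M" "v j \<in> carrier M" using insert.prems by auto
  then have "(\<lambda>j. r \<odot>\<^bsub>M\<^esub> v j) \<in> A \<rightarrow> carrier M" using assms(2) by auto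
  with insert v assms(2) show ?case
    by (simp add: M.finsum_insert smult_r_distr M.finsum_closed)
qed

text \<open>\<open>summation_map\<close> sums over the support, which varies with the element. A
  common finite index set \<open>B\<close> lets the sums of several elements be combined; the extra
  terms are zero.\<close>

lemma summation_map_eq_finsum:
  assumes "left_module R Y" "v \<in> carrier (lmod_sum J (\<lambda>_. Y))" "finite B" "B \<subseteq> J"
    "\<And>j. j \<in> J - B \<Longrightarrow> v j = \<zero>\<^bsub>Y\<^esub>"
  shows "summation_map J Y v = (\<Oplus>\<^bsub>Y\<^esub>j\<in>B. v j)"
proof -
  interpret Y: left_module R Y by fact
  have "(\<Oplus>\<^bsub>Y\<^esub>j\<in>{j \<in> J. v j \<noteq> \<zero>\<^bsub>Y\<^esub>}. v j) = (\<Oplus>\<^bsub>Y\<^esub>j\<in>B. v j)"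
    by (rule Y.M.add.finprod_mono_neutral_cong_left)
      (use assms lmod_sum_nth[OF assms(2)] in auto)
  then show ?thesis using assms(2) by (simp add: summation_map_def)
qed

lemma summation_map_hom:
  assumes "left_module R Y"
  shows "summation_map J Y \<in> lmod_hom R (lmod_sum J (\<lambda>_. Y)) Y"
proof -
  interpret Y: left_module R Y by fact
  let ?S = "lmod_sum J (\<lambda>_. Y)"
  have S: "left_module R ?S" by (intro left_module_sum assms Y.R.ring_axioms)
  interpret S: left_module R ?S by (rule S)
  have fin: "finite {j \<in> J. v j \<noteq> \<zero>\<^bsub>Y\<^esub>}" if "v \<in> carrier ?S" for v
    using that by (simp add: lmod_sum_simps)
  show ?thesis
  proof (rule lmod_homI[OF S assms])
    have "summation_map J Y v \<in> carrier Y" if "v \<in> carrier ?S" for v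
      using that lmod_sum_nth[OF that] by (auto simp: summation_map_def intro!: Y.M.finsum_closed)
    then show "summation_map J Y \<in> carrier ?S \<rightarrow>\<^sub>E carrier Y"
      by (auto simp: summation_map_def)
    fix r v w assume r: "r \<in> carrier R" and v: "v \<in> carrier ?S" and w: "w \<in> carrier ?S"
    \<comment> \<open>Contains the supports of \<open>v\<close>, of \<open>w\<close> and of
      \<open>r v + w\<close>.\<close>
    let ?B = "{j \<in> J. v j \<noteq> \<zero>\<^bsub>Y\<^esub>} \<union> {j \<in> J. w j \<noteq> \<zero>\<^bsub>Y\<^esub>}"
    note [simp] = lmod_sum_nth[OF v] lmod_sum_nth[OF w]
    have B: "finite ?B" "?B \<subseteq> J" using fin v w by auto
    have eq: "(r \<odot>\<^bsub>?S\<^esub> v \<oplus>\<^bsub>?S\<^esub> w) j = r \<odot>\<^bsub>Y\<^esub> v j \<oplus>\<^bsub>Y\<^esub> w j" if "j \<in> J" for j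
      using that by (simp add: lmod_sum_simps)
    have "summation_map J Y (r \<odot>\<^bsub>?S\<^esub> v \<oplus>\<^bsub>?S\<^esub> w) = (\<Oplus>\<^bsub>Y\<^esub>j\<in>?B. (r \<odot>\<^bsub>?S\<^esub> v \<oplus>\<^bsub>?S\<^esub> w) j)"
      by (rule summation_map_eq_finsum[OF assms _ B]) (use r v w in \<open>auto simp: eq Y.smult_zero_r\<close>)
    also have "\<dots> = (\<Oplus>\<^bsub>Y\<^esub>j\<in>?B. r \<odot>\<^bsub>Y\<^esub> v j \<oplus>\<^bsub>Y\<^esub> w j)"
      by (rule Y.M.finsum_cong') (use r in \<open>auto simp: eq\<close>)
    also have "\<dots> = (\<Oplus>\<^bsub>Y\<^esub>j\<in>?B. r \<odot>\<^bsub>Y\<^esub> v j) \<oplus>\<^bsub>Y\<^esub> (\<Oplus>\<^bsub>Y\<^esub>j\<in>?B. w j)"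
      by (rule Y.M.finsum_addf) (use r in auto)
    also have "(\<Oplus>\<^bsub>Y\<^esub>j\<in>?B. r \<odot>\<^bsub>Y\<^esub> v j) = r \<odot>\<^bsub>Y\<^esub> (\<Oplus>\<^bsub>Y\<^esub>j\<in>?B. v j)"
      by (rule Y.finsum_smult[symmetric]) (use r B in auto)
    also have "(\<Oplus>\<^bsub>Y\<^esub>j\<in>?B. v j) = summation_map J Y v"
      by (rule summation_map_eq_finsum[OF assms v B, symmetric]) auto
    also have "(\<Oplus>\<^bsub>Y\<^esub>j\<in>?B. w j) = summation_map J Y w"
      by (rule summation_map_eq_finsum[OF assms w B, symmetric]) auto
    finally show "summation_map J Y (r \<odot>\<^bsub>?S\<^esub> v \<oplus>\<^bsub>?S\<^esub> w) =
      r \<odot>\<^bsub>Y\<^esub> summation_map J Y v \<oplus>\<^bsub>Y\<^esub> summation_map J Y w" .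
  qed
qed

text \<open>Each \<open>f j\<close> sends zero to zero, so the support of the image lies in that of
  the argument.\<close>

lemma sum_map_hom:
  assumes "ring R" "\<And>j. j \<in> J \<Longrightarrow> left_module R (M j)" "\<And>j. j \<in> J \<Longrightarrow> left_module R (N j)"
    and f: "\<And>j. j \<in> J \<Longrightarrow> f j \<in> lmod_hom R (M j) (N j)"
  shows "(\<lambda>v\<in>carrier (lmod_sum J M). \<lambda>j\<in>J. f j (v j)) \<in> lmod_hom R (lmod_sum J M) (lmod_sum J N)"
proof -
  have M: "left_module R (lmod_sum J M)" and N: "left_module R (lmod_sum J N)"
    using assms by (auto intro!: left_module_sum)
  interpret M: left_module R "lmod_sum J M" by (rule M)
  show ?thesis
  proof (rule lmod_homI[OF M N])
    have "(\<lambda>j\<in>J. f j (v j)) \<in> carrier (lmod_sum J N)" if v: "v \<in> carrier (lmod_sum J M)" for v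
      by (rule lmod_sum_carrierI[of _ _ _ "{j \<in> J. v j \<noteq> \<zero>\<^bsub>M j\<^esub>}"])
        (use v in \<open>auto simp: lmod_sum_simps lmod_hom_closed[OF f] lmod_sum_nth[OF v]
          lmod_hom_zero[OF assms(2,3) f]\<close>)
    then show "(\<lambda>v\<in>carrier (lmod_sum J M). \<lambda>j\<in>J. f j (v j))
        \<in> carrier (lmod_sum J M) \<rightarrow>\<^sub>E carrier (lmod_sum J N)" by auto
    fix r v w assume r: "r \<in> carrier R" and v: "v \<in> carrier (lmod_sum J M)"
      and w: "w \<in> carrier (lmod_sum J M)"
    have "(\<lambda>j\<in>J. f j ((r \<odot>\<^bsub>lmod_sum J M\<^esub> v \<oplus>\<^bsub>lmod_sum J M\<^esub> w) j)) =
      r \<odot>\<^bsub>lmod_sum J N\<^esub> (\<lambda>j\<in>J. f j (v j)) \<oplus>\<^bsub>lmod_sum J N\<^esub> (\<lambda>j\<in>J. f j (w j))"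
      using r by (auto simp: lmod_sum_simps(3,4) lmod_hom_lin[OF assms(2) f] lmod_sum_nth[OF v]
          lmod_sum_nth[OF w] intro!: restrict_ext)
    then show "(\<lambda>v\<in>carrier (lmod_sum J M). \<lambda>j\<in>J. f j (v j))
        (r \<odot>\<^bsub>lmod_sum J M\<^esub> v \<oplus>\<^bsub>lmod_sum J M\<^esub> w) =
      r \<odot>\<^bsub>lmod_sum J N\<^esub> (\<lambda>v\<in>carrier (lmod_sum J M). \<lambda>j\<in>J. f j (v j)) v \<oplus>\<^bsub>lmod_sum J N\<^esub>
        (\<lambda>v\<in>carrier (lmod_sum J M). \<lambda>j\<in>J. f j (v j)) w"
      using r v w by simp
  qed
qed

text \<open>With \<open>summation_map\<close> as the map out of the copies of \<open>Y\<close>, this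
  is the instance of the push-out from which the universal sequence arises.\<close>

lemma pushout_data_sum:
  fixes E :: "'j \<Rightarrow> ('r, 'y, 'm, 'x) extension"
  assumes "ring R" "left_module R Y" "\<And>j. j \<in> J \<Longrightarrow> left_module R (X j)"
    and ext: "\<And>j. j \<in> J \<Longrightarrow> is_extension R (X j) Y (E j)"
  shows "pushout_data R (lmod_sum J X) (lmod_sum J (\<lambda>_. Y)) Y (summation_map J Y) (sum_ext J Y E)"
proof -
  have E: "lmod_extension R (X j) Y (E j)" if "j \<in> J" for j
    using assms that by (intro lmod_extension.intro)
  note M = lmod_extension.M[OF E] and incl = lmod_extension.incl_hom[OF E]
    and proj = lmod_extension.proj_hom[OF E] and proj_incl = lmod_extension.proj_incl[OF E]
  have ihom: "incl (sum_ext J Y E) \<in> lmod_hom R (lmod_sum J (\<lambda>_. Y)) (lmod_sum J (\<lambda>j. middle (E j)))"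
    using sum_map_hom[OF assms(1,2) M incl] by (simp add: sum_ext_def)
  show ?thesis
  proof (rule pushout_data.intro)
    show "left_module R (lmod_sum J X)" "left_module R (lmod_sum J (\<lambda>_. Y))"
      using assms by (auto intro!: left_module_sum)
    show "left_module R (middle (sum_ext J Y E))"
      using assms(1) M by (auto simp: sum_ext_def intro!: left_module_sum)
    show "summation_map J Y \<in> lmod_hom R (lmod_sum J (\<lambda>_. Y)) Y" by (rule summation_map_hom) fact
    show "incl (sum_ext J Y E) \<in> lmod_hom R (lmod_sum J (\<lambda>_. Y)) (middle (sum_ext J Y E))"
      using ihom by (simp add: sum_ext_def)
    show "proj (sum_ext J Y E) \<in> lmod_hom R (middle (sum_ext J Y E)) (lmod_sum J X)"
      using sum_map_hom[OF assms(1) M assms(3) proj] by (simp add: sum_ext_def)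
    fix v assume v: "v \<in> carrier (lmod_sum J (\<lambda>_. Y))"
    have "incl (sum_ext J Y E) v \<in> carrier (lmod_sum J (\<lambda>j. middle (E j)))"
      using lmod_hom_closed[OF ihom v] .
    then show "proj (sum_ext J Y E) (incl (sum_ext J Y E) v) = \<zero>\<^bsub>lmod_sum J X\<^esub>"
      using v lmod_sum_nth[OF v]
      by (auto simp: sum_ext_def lmod_sum_simps(2) proj_incl intro!: restrict_ext)
  qed (rule assms(2))
qed

text \<open>Packages the push-out into one map \<open>q\<close> from the direct sum of the basis
  extensions to \<open>M\<close>, compatible with \<open>incl\<close> and \<open>proj\<close>. The
  push-out is tied to \<open>U\<close> by an equivalence, so \<open>q\<close> is the map into the
  push-out followed by that equivalence; afterwards cosets no longer occur.\<close>

lemma universal_ses_cover: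
  fixes E :: "('r, 'x) module \<Rightarrow> 'i \<Rightarrow> ('r, 'y, 'e, 'x) extension"
    and U :: "('r, 'y, 'm, ('r, 'x) module \<times> 'i \<Rightarrow> 'x) extension"
  assumes R: "ring R" and X: "\<And>X. X \<in> \<X> \<Longrightarrow> left_module R X" and Y: "left_module R Y"
    and U: "universal_ses R \<X> Y I E U"
  defines "E' \<equiv> \<lambda>j. E (fst j) (snd j)"
  obtains q where "q \<in> lmod_hom R (lmod_sum (Sigma \<X> I) (\<lambda>j. middle (E' j))) (middle U)"
    "\<And>v. v \<in> carrier (lmod_sum (Sigma \<X> I) (\<lambda>_. Y)) \<Longrightarrow>
      q (\<lambda>j\<in>Sigma \<X> I. incl (E' j) (v j)) = incl U (summation_map (Sigma \<X> I) Y v)"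
    "\<And>m. m \<in> carrier (lmod_sum (Sigma \<X> I) (\<lambda>j. middle (E' j))) \<Longrightarrow>
      proj U (q m) = (\<lambda>j\<in>Sigma \<X> I. proj (E' j) (m j))"
proof -
  define J where "J = Sigma \<X> I"
  have fst: "(\<lambda>(X, i). X) = fst" and E': "(\<lambda>(X, i). E X i) = E'" by (auto simp: E'_def)
  have ext: "is_extension R (fst j) Y (E' j)" if "j \<in> J" for j
    using U that by (auto simp: universal_ses_def J_def E'_def)
  interpret pushout_data R "lmod_sum J fst" "lmod_sum J (\<lambda>_. Y)" Y "summation_map J Y" "sum_ext J Y E'"
    by (rule pushout_data_sum) (use R X Y ext in \<open>auto simp: J_def\<close>)
  have "left_module R (middle U)"
    "ext_equiv R Y (pushout_ext (lmod_sum J (\<lambda>_. Y)) Y (summation_map J Y) (sum_ext J Y E')) U"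
    using U by (auto simp: universal_ses_def Let_def fst E' is_extension_def simp flip: J_def)
  then obtain h where MU: "left_module R (middle U)"
    and hhom: "h \<in> lmod_hom R (lmod_quot P K) (middle U)"
    and hi: "\<And>y. y \<in> carrier Y \<Longrightarrow> h (\<kappa> y \<zero>\<^bsub>middle (sum_ext J Y E')\<^esub>) = incl U y"
    and hp: "\<And>C. C \<in> carrier (lmod_quot P K) \<Longrightarrow> proj U (h C) =
      proj (pushout_ext (lmod_sum J (\<lambda>_. Y)) Y (summation_map J Y) (sum_ext J Y E')) C"
    by (auto simp: ext_equiv_def lmod_iso_def pushout_sel)
  have mid: "middle (sum_ext J Y E') = lmod_sum J (\<lambda>j. middle (E' j))" by (simp add: sum_ext_def)
  define q where "q = (\<lambda>m\<in>carrier (middle (sum_ext J Y E')). h (\<kappa> \<zero>\<^bsub>Y\<^esub> m))"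
  have qhom: "q \<in> lmod_hom R (middle (sum_ext J Y E')) (middle U)"
  proof (rule lmod_homI[OF M MU])
    show "q \<in> carrier (middle (sum_ext J Y E')) \<rightarrow>\<^sub>E carrier (middle U)"
      by (auto simp: q_def intro!: lmod_hom_closed[OF hhom] \<kappa>_closed)
    fix r m n assume *: "r \<in> carrier R" "m \<in> carrier (middle (sum_ext J Y E'))"
      "n \<in> carrier (middle (sum_ext J Y E'))"
    then have "\<kappa> \<zero>\<^bsub>Y\<^esub> (r \<odot>\<^bsub>middle (sum_ext J Y E')\<^esub> m \<oplus>\<^bsub>middle (sum_ext J Y E')\<^esub> n) =
      r \<odot>\<^bsub>lmod_quot P K\<^esub> \<kappa> \<zero>\<^bsub>Y\<^esub> m \<oplus>\<^bsub>lmod_quot P K\<^esub> \<kappa> \<zero>\<^bsub>Y\<^esub> n"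
      using M.smult_closed[of r m] by (simp add: \<kappa>_smult \<kappa>_add Y'.smult_zero_r)
    then show "q (r \<odot>\<^bsub>middle (sum_ext J Y E')\<^esub> m \<oplus>\<^bsub>middle (sum_ext J Y E')\<^esub> n) =
        r \<odot>\<^bsub>middle U\<^esub> q m \<oplus>\<^bsub>middle U\<^esub> q n"
      using * M.smult_closed[of r m] M.M.a_closed[of "r \<odot>\<^bsub>middle (sum_ext J Y E')\<^esub> m" n]
      by (simp add: q_def lmod_hom_lin[OF K.left_module_quot hhom] \<kappa>_closed)
  qed
  show ?thesis
  proof (rule that[of q])
    show "q \<in> lmod_hom R (lmod_sum (Sigma \<X> I) (\<lambda>j. middle (E' j))) (middle U)"
      using qhom unfolding mid by (simp add: J_def)
    fix v assume "v \<in> carrier (lmod_sum (Sigma \<X> I) (\<lambda>_. Y))"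
    then have v: "v \<in> carrier (lmod_sum J (\<lambda>_. Y))" by (simp add: J_def)
    \<comment> \<open>Commutativity of the push-out square, carried along the equivalence with
      \<open>U\<close>.\<close>
    have "q (incl (sum_ext J Y E') v) = incl U (summation_map J Y v)"
      using lmod_hom_closed[OF incl_hom v] lmod_hom_closed[OF h v] v
      by (simp add: q_def \<kappa>_incl hi)
    then show "q (\<lambda>j\<in>Sigma \<X> I. incl (E' j) (v j)) = incl U (summation_map (Sigma \<X> I) Y v)"
      using v by (simp add: sum_ext_def J_def)
  next
    fix m assume "m \<in> carrier (lmod_sum (Sigma \<X> I) (\<lambda>j. middle (E' j)))"
    then have m: "m \<in> carrier (middle (sum_ext J Y E'))" unfolding mid by (simp add: J_def)
    then have "proj U (q m) = proj (sum_ext J Y E') m"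
      by (simp add: q_def hp \<kappa>_closed proj_\<kappa>)
    then show "proj U (q m) = (\<lambda>j\<in>Sigma \<X> I. proj (E' j) (m j))"
      using m by (simp add: sum_ext_def J_def)
  qed
qed

text \<open>Each generator has an image of finite support, and vanishing outside a fixed index set
  is preserved by linear combinations. The union of the supports over the generators thus serves for
  all of \<open>X\<close>.\<close>

lemma hom_to_sum_finite_support:
  assumes "ring R" "left_module R X" "finitely_presented R X"
    and M: "\<And>j. j \<in> J \<Longrightarrow> left_module R (M j)" and f: "f \<in> lmod_hom R X (lmod_sum J M)"
  obtains B where "finite B" "B \<subseteq> J" "\<And>x j. \<lbrakk>x \<in> carrier X; j \<in> J - B\<rbrakk> \<Longrightarrow> f x j = \<zero>\<^bsub>M j\<^esub>"
proof -
  interpret X: left_module R X by fact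
  obtain S where S: "finite S" "S \<subseteq> carrier X"
    "\<And>H. \<lbrakk>lmod_submodule R X H; S \<subseteq> H\<rbrakk> \<Longrightarrow> carrier X \<subseteq> H"
    using finitely_presented_generators[OF assms(1-3)] by blast
  let ?B = "\<Union>s\<in>S. {j \<in> J. f s j \<noteq> \<zero>\<^bsub>M j\<^esub>}"
  let ?H = "{x \<in> carrier X. \<forall>j\<in>J - ?B. f x j = \<zero>\<^bsub>M j\<^esub>}"
  have "lmod_submodule R X ?H"
  proof
    show "?H \<subseteq> carrier X" by auto
    show "\<zero>\<^bsub>X\<^esub> \<in> ?H"
      using lmod_hom_zero[OF assms(2) left_module_sum[OF assms(1) M] f] by (simp add: lmod_sum_simps)
    fix r x y assume *: "r \<in> carrier R" "x \<in> ?H" "y \<in> ?H"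
    have "f (r \<odot>\<^bsub>X\<^esub> x \<oplus>\<^bsub>X\<^esub> y) j = \<zero>\<^bsub>M j\<^esub>" if j: "j \<in> J - ?B" for j
    proof -
      interpret Mj: left_module R "M j" using M j by auto
      have "f x j = \<zero>\<^bsub>M j\<^esub>" "f y j = \<zero>\<^bsub>M j\<^esub>" using * j by blast+
      then show ?thesis
        using * j by (simp add: lmod_hom_lin[OF assms(2) f] lmod_sum_simps(3,4) Mj.smult_zero_r)
    qed
    then show "r \<odot>\<^bsub>X\<^esub> x \<oplus>\<^bsub>X\<^esub> y \<in> ?H" using * by auto
  qed
  moreover have "S \<subseteq> ?H" using S(2) by auto
  ultimately have "carrier X \<subseteq> ?H" by (rule S(3))
  moreover have "finite ?B"
  proof (rule finite_UN_I[OF S(1)])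
    fix s assume "s \<in> S"
    then show "finite {j \<in> J. f s j \<noteq> \<zero>\<^bsub>M j\<^esub>}"
      using lmod_hom_closed[OF f, of s] S(2) by (auto simp: lmod_sum_simps)
  qed
  ultimately show ?thesis by (intro that[of ?B]) blast+
qed

lemma lmod_sum_component_hom:
  assumes "left_module R X" "f \<in> lmod_hom R X (lmod_sum J M)" "j \<in> J" "left_module R (M j)"
  shows "(\<lambda>x\<in>carrier X. f x j) \<in> lmod_hom R X (M j)"
proof -
  interpret X: left_module R X by fact
  show ?thesis
    by (rule lmod_homI[OF assms(1,4)])
      (use assms(3) lmod_sum_nth[OF lmod_hom_closed[OF assms(2)]] in
        \<open>auto simp: lmod_hom_add[OF assms(2)] lmod_hom_smult[OF assms(2)] lmod_sum_simps(3,4)\<close>)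
qed

text \<open>The given \<open>g\<close> and the set-theoretic lift \<open>q (\<sigma> x)\<close> of
  the same map \<open>f\<close> differ by some \<open>t x\<close> in \<open>Y\<close>. As
  \<open>g\<close> is linear and the defect of the lift is \<open>b\<close>, the function
  \<open>t\<close> exhibits \<open>b\<close>, a factor set of the combination of the basis classes
  with coefficients \<open>d i\<close>, as a coboundary. Linear independence then kills each
  \<open>d i\<close>, and with them \<open>f\<close>.\<close>

lemma universal_ses_proj_hom_zero:
  fixes E :: "('r, 'x) module \<Rightarrow> 'i \<Rightarrow> ('r, 'y, 'e, 'x) extension"
    and U :: "('r, 'y, 'm, ('r, 'x) module \<times> 'i \<Rightarrow> 'x) extension"
  assumes R: "ring R" and semi: "semibrick R \<X>" and Y: "left_module R Y"
    and univ: "universal_ses R \<X> Y I E U" and X\<X>: "X \<in> \<X>"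
    and g: "g \<in> lmod_hom R X (middle U)" and x: "x \<in> carrier X"
  shows "proj U (g x) = \<zero>\<^bsub>lmod_sum (Sigma \<X> I) (\<lambda>(X, i). X)\<^esub>"
proof -
  define J where "J = Sigma \<X> I"
  define E' where "E' = (\<lambda>j. E (fst j) (snd j))"
  have fst: "(\<lambda>(X, i). X) = fst" by auto
  let ?S = "lmod_sum J fst" and ?L = "lmod_sum J (\<lambda>j. middle (E' j))"
  have mod: "left_module R Z" if "Z \<in> \<X>" for Z
    using semi that by (auto simp: semibrick_def brick_def)
  have modJ: "left_module R (fst j)" if "j \<in> J" for j using mod that by (auto simp: J_def)
  have X: "left_module R X" and Xfp: "finitely_presented R X"
    using semi X\<X> by (auto simp: semibrick_def brick_def)
  have extJ: "is_extension R (fst j) Y (E' j)" if "j \<in> J" for j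
    using univ that by (auto simp: universal_ses_def J_def E'_def)
  have basis: "lmod_basis (End_ring R X) (Ext1 R X Y) (I X) (\<lambda>i. ext_class R X Y (E X i))"
    using univ X\<X> by (auto simp: universal_ses_def)
  have extU: "is_extension R ?S Y U" using univ by (auto simp: universal_ses_def Let_def J_def fst)
  have S: "left_module R ?S" using R modJ by (intro left_module_sum)
  have extI: "is_extension R X Y (E X i)" if "i \<in> I X" for i
    using univ that X\<X> by (auto simp: universal_ses_def)
  have EJ: "lmod_extension R (fst j) Y (E' j)" if "j \<in> J" for j
    using that by (intro lmod_extension.intro modJ Y extJ)
  have L: "left_module R ?L" using R lmod_extension.M[OF EJ] by (intro left_module_sum)
  interpret U: lmod_extension R ?S Y U by (rule lmod_extension.intro[OF S Y extU])
  interpret V: ext_group R X Y by (rule ext_group.intro[OF X Y])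
  interpret L: left_module R ?L by (rule L)
  obtain q where q: "q \<in> lmod_hom R ?L (middle U)"
    and q_incl: "\<And>v. v \<in> carrier (lmod_sum J (\<lambda>_. Y)) \<Longrightarrow>
      q (\<lambda>j\<in>J. incl (E' j) (v j)) = incl U (summation_map J Y v)"
    and q_proj: "\<And>m. m \<in> carrier ?L \<Longrightarrow> proj U (q m) = (\<lambda>j\<in>J. proj (E' j) (m j))"
    using universal_ses_cover[OF R mod Y univ] unfolding J_def E'_def by blast
  define f where "f = (\<lambda>x\<in>carrier X. proj U (g x))"
  have f: "f \<in> lmod_hom R X ?S"
    unfolding f_def by (rule lmod_hom_compose[OF X U.M S g U.proj_hom])
  obtain B where B: "finite B" "B \<subseteq> J"
    "\<And>x j. \<lbrakk>x \<in> carrier X; j \<in> J - B\<rbrakk> \<Longrightarrow> f x j = \<zero>\<^bsub>fst j\<^esub>"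
    using hom_to_sum_finite_support[OF R X Xfp modJ f] by blast
  define A where "A = {i. (X, i) \<in> B}"
  have "A = snd ` (B \<inter> {X} \<times> UNIV)" by (force simp: A_def)
  then have finA: "finite A" using B(1) by simp
  have AI: "A \<subseteq> I X" using B(2) by (auto simp: A_def J_def)
  define d where "d i = (\<lambda>x\<in>carrier X. f x (X, i))" for i
  have comp: "(\<lambda>x\<in>carrier X. f x j) \<in> lmod_hom R X (fst j)" if "j \<in> J" for j
    by (rule lmod_sum_component_hom[OF X f that modJ[OF that]])
  have d: "d i \<in> lmod_hom R X X" if "i \<in> I X" for i
    using comp[of "(X, i)"] that X\<X> by (simp add: d_def J_def)
  note dcl = lmod_hom_closed[OF d]
  \<comment> \<open>Two reasons for vanishing: a copy of \<open>X\<close> with index off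
    \<open>A\<close> lies outside the support bound \<open>B\<close>, and a different brick receives
    only the zero map from \<open>X\<close>.\<close>
  have fzero: "f x j = \<zero>\<^bsub>fst j\<^esub>" if j: "j \<in> J" "\<not> (fst j = X \<and> snd j \<in> A)" and x: "x \<in> carrier X" for x j
  proof (cases "fst j = X")
    case True
    then have "j \<notin> B" using j by (cases j) (auto simp: A_def)
    then show ?thesis using B(3) j x by auto
  next
    case False
    then have "lmod_hom R X (fst j) = {zero_hom X (fst j)}"
      using semi X\<X> j by (auto simp: semibrick_def J_def)
    then have "(\<lambda>x\<in>carrier X. f x j) = zero_hom X (fst j)" using comp[OF j(1)] by simp
    then show ?thesis using x by (auto simp: zero_hom_def dest: fun_cong[of _ _ x])
  qed
  have "\<forall>i\<in>I X. \<exists>a. factor_set R X Y (E X i) a"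
    using lmod_extension.factor_set_exists lmod_extension.intro[OF X Y extI] by blast
  then obtain a where fs: "\<And>i. i \<in> I X \<Longrightarrow> factor_set R X Y (E X i) (a i)"
    using bchoice[of "I X"] by metis
  \<comment> \<open>The factor sets \<open>a i\<close> are fixed beforehand, and the sections are
    now chosen to realise exactly these.\<close>
  then have "\<forall>i\<in>I X. \<exists>s. (\<forall>x\<in>carrier X. s x \<in> carrier (middle (E X i)) \<and> proj (E X i) (s x) = x) \<and>
      (\<forall>r\<in>carrier R. \<forall>x\<in>carrier X. \<forall>x'\<in>carrier X. a i r x x' \<in> carrier Y \<and>
        r \<odot>\<^bsub>middle (E X i)\<^esub> s x \<oplus>\<^bsub>middle (E X i)\<^esub> s x' =
          s (r \<odot>\<^bsub>X\<^esub> x \<oplus>\<^bsub>X\<^esub> x') \<oplus>\<^bsub>middle (E X i)\<^esub> incl (E X i) (a i r x x'))"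
    unfolding factor_set_def by blast
  from bchoice[OF this] obtain s where
    s: "\<And>i x. \<lbrakk>i \<in> I X; x \<in> carrier X\<rbrakk> \<Longrightarrow> s i x \<in> carrier (middle (E X i))"
      "\<And>i x. \<lbrakk>i \<in> I X; x \<in> carrier X\<rbrakk> \<Longrightarrow> proj (E X i) (s i x) = x"
    and a: "\<And>i r x x'. \<lbrakk>i \<in> I X; r \<in> carrier R; x \<in> carrier X; x' \<in> carrier X\<rbrakk> \<Longrightarrow>
      a i r x x' \<in> carrier Y"
    and sa: "\<And>i r x x'. \<lbrakk>i \<in> I X; r \<in> carrier R; x \<in> carrier X; x' \<in> carrier X\<rbrakk> \<Longrightarrow>
      r \<odot>\<^bsub>middle (E X i)\<^esub> s i x \<oplus>\<^bsub>middle (E X i)\<^esub> s i x' =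
          s i (r \<odot>\<^bsub>X\<^esub> x \<oplus>\<^bsub>X\<^esub> x') \<oplus>\<^bsub>middle (E X i)\<^esub> incl (E X i) (a i r x x')"
    by blast
  \<comment> \<open>The factor set of the sum over \<open>A\<close> of \<open>d i\<close> times the
    class of \<open>E X i\<close>: pull-backs substitute \<open>d i\<close>, Baer sums add.\<close>
  define b where "b r x x' = (\<Oplus>\<^bsub>Y\<^esub>i\<in>A. a i r (d i x) (d i x'))" for r x x'
  \<comment> \<open>A set-theoretic lift of \<open>f\<close>. Off \<open>A\<close> the value is zero
    itself and not the section at zero, because sections need not vanish there and the support must
    stay finite.\<close>
  define \<sigma> where "\<sigma> x = (\<lambda>j\<in>J. if fst j = X \<and> snd j \<in> A then s (snd j) (d (snd j) x)
    else \<zero>\<^bsub>middle (E' j)\<^esub>)" for x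
  \<comment> \<open>The defect of \<open>\<sigma>\<close>, component by component;
    \<open>summation_map\<close> collapses it to \<open>b\<close>.\<close>
  define v where "v r x x' = (\<lambda>j\<in>J. if fst j = X \<and> snd j \<in> A
    then a (snd j) r (d (snd j) x) (d (snd j) x') else \<zero>\<^bsub>Y\<^esub>)" for r x x'
  have fin: "finite (Pair X ` A)" and sub: "Pair X ` A \<subseteq> J"
    using finA B(2) by (auto simp: A_def)
  have notin: "\<not> (fst j = X \<and> snd j \<in> A)" if "j \<notin> Pair X ` A" for j
    using that by (cases j) auto
  have \<sigma>: "\<sigma> x \<in> carrier ?L" if x: "x \<in> carrier X" for x
  proof (rule lmod_sum_carrierI[OF _ fin])
    have "\<sigma> x j \<in> carrier (middle (E' j))" if j: "j \<in> J" for j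
    proof -
      interpret Ej: lmod_extension R "fst j" Y "E' j" by (rule EJ[OF j])
      show ?thesis
        using j x AI Ej.M.M.zero_closed by (auto simp: \<sigma>_def E'_def s dcl subsetD)
    qed
    then show "\<sigma> x \<in> (\<Pi>\<^sub>E j\<in>J. carrier (middle (E' j)))" by (auto simp: \<sigma>_def PiE_iff)
    show "\<And>j. j \<in> J \<Longrightarrow> j \<notin> Pair X ` A \<Longrightarrow> \<sigma> x j = \<zero>\<^bsub>middle (E' j)\<^esub>"
      by (frule notin) (auto simp: \<sigma>_def)
  qed
  have v: "v r x x' \<in> carrier (lmod_sum J (\<lambda>_. Y))"
    if "r \<in> carrier R" "x \<in> carrier X" "x' \<in> carrier X" for r x x'
    by (rule lmod_sum_carrierI[OF _ fin])
      (use that AI notin in \<open>auto simp: v_def a dcl subsetD\<close>)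
  have sum_v: "summation_map J Y (v r x x') = b r x x'"
    if "r \<in> carrier R" "x \<in> carrier X" "x' \<in> carrier X" for r x x'
  proof -
    have "summation_map J Y (v r x x') = (\<Oplus>\<^bsub>Y\<^esub>j\<in>Pair X ` A. v r x x' j)"
      by (rule summation_map_eq_finsum[OF Y v[OF that] fin sub]) (auto simp: v_def dest: notin)
    also have "\<dots> = (\<Oplus>\<^bsub>Y\<^esub>i\<in>A. v r x x' (X, i))"
      by (rule U.Y.M.finsum_reindex)
        (use lmod_sum_nth[OF v[OF that]] sub in \<open>auto simp: inj_on_def\<close>)
    also have "\<dots> = b r x x'"
      unfolding b_def
      by (rule U.Y.M.finsum_cong') (use that AI sub in \<open>auto simp: v_def a dcl subsetD\<close>)
    finally show ?thesis .
  qed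
  have bcl: "b r x x' \<in> carrier Y" if "r \<in> carrier R" "x \<in> carrier X" "x' \<in> carrier X" for r x x'
    unfolding b_def by (rule U.Y.M.finsum_closed) (use that AI in \<open>auto simp: a dcl subsetD\<close>)
  have \<sigma>v: "r \<odot>\<^bsub>?L\<^esub> \<sigma> x \<oplus>\<^bsub>?L\<^esub> \<sigma> x' =
      \<sigma> (r \<odot>\<^bsub>X\<^esub> x \<oplus>\<^bsub>X\<^esub> x') \<oplus>\<^bsub>?L\<^esub> (\<lambda>j\<in>J. incl (E' j) (v r x x' j))"
    if *: "r \<in> carrier R" "x \<in> carrier X" "x' \<in> carrier X" for r x x'
    unfolding lmod_sum_simps(3,4)
  proof (rule restrict_ext)
    fix j assume j: "j \<in> J"
    interpret Ej: lmod_extension R "fst j" Y "E' j" by (rule EJ[OF j])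
    show "(\<lambda>j\<in>J. r \<odot>\<^bsub>middle (E' j)\<^esub> \<sigma> x j) j \<oplus>\<^bsub>middle (E' j)\<^esub> \<sigma> x' j =
      \<sigma> (r \<odot>\<^bsub>X\<^esub> x \<oplus>\<^bsub>X\<^esub> x') j \<oplus>\<^bsub>middle (E' j)\<^esub> (\<lambda>j\<in>J. incl (E' j) (v r x x' j)) j"
    proof (cases "fst j = X \<and> snd j \<in> A")
      case True
      then have i: "snd j \<in> I X" using AI by auto
      have "d (snd j) (r \<odot>\<^bsub>X\<^esub> x \<oplus>\<^bsub>X\<^esub> x') = r \<odot>\<^bsub>X\<^esub> d (snd j) x \<oplus>\<^bsub>X\<^esub> d (snd j) x'"
        using lmod_hom_lin[OF X d[OF i]] * by simp
      then show ?thesis using True j i * by (simp add: \<sigma>_def v_def E'_def sa dcl)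
    next
      case False
      then have "\<And>z. \<sigma> z j = \<zero>\<^bsub>middle (E' j)\<^esub>" "v r x x' j = \<zero>\<^bsub>Y\<^esub>"
        using j by (auto simp: \<sigma>_def v_def)
      then show ?thesis using j * by (simp add: Ej.M.smult_zero_r)
    qed
  qed
  \<comment> \<open>\<open>q\<close> composed with \<open>\<sigma>\<close> covers the same map
    \<open>f\<close> as \<open>g\<close> does, so the two differ by elements of
    \<open>Y\<close>.\<close>
  have proj_\<sigma>: "proj U (q (\<sigma> x)) = proj U (g x)" if x: "x \<in> carrier X" for x
  proof -
    have "(\<lambda>j\<in>J. proj (E' j) (\<sigma> x j)) = f x"
    proof (rule extensionalityI[of _ J])
      show "f x \<in> extensional J" using lmod_hom_closed[OF f x] by (simp add: lmod_sum_simps PiE_iff)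
      fix j assume j: "j \<in> J"
      interpret Ej: lmod_extension R "fst j" Y "E' j" by (rule EJ[OF j])
      show "(\<lambda>j\<in>J. proj (E' j) (\<sigma> x j)) j = f x j"
      proof (cases "fst j = X \<and> snd j \<in> A")
        case True
        then have i: "snd j \<in> I X" using AI by auto
        have "j = (X, snd j)" using True by (cases j) auto
        then have "f x j = d (snd j) x" using x by (simp add: d_def)
        then show ?thesis using True j i x by (simp add: \<sigma>_def E'_def s dcl)
      next
        case False
        then show ?thesis using fzero[OF j False x] j by (auto simp: \<sigma>_def)
      qed
    qed simp
    then show ?thesis using q_proj[OF \<sigma>[OF x]] x by (simp add: f_def)
  qed
  have "\<forall>x\<in>carrier X. \<exists>y. y \<in> carrier Y \<and> g x = q (\<sigma> x) \<oplus>\<^bsub>middle U\<^esub> incl U y"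
  proof
    fix x assume x: "x \<in> carrier X"
    obtain y where "y \<in> carrier Y" "g x = q (\<sigma> x) \<oplus>\<^bsub>middle U\<^esub> incl U y"
      by (rule U.fibre_proj[OF lmod_hom_closed[OF g x] lmod_hom_closed[OF q \<sigma>[OF x]]
            proj_\<sigma>[OF x, symmetric]])
    then show "\<exists>y. y \<in> carrier Y \<and> g x = q (\<sigma> x) \<oplus>\<^bsub>middle U\<^esub> incl U y" by blast
  qed
  from bchoice[OF this] obtain t where t: "\<And>x. x \<in> carrier X \<Longrightarrow> t x \<in> carrier Y"
    and gt: "\<And>x. x \<in> carrier X \<Longrightarrow> g x = q (\<sigma> x) \<oplus>\<^bsub>middle U\<^esub> incl U (t x)" by blast
  \<comment> \<open>Expands \<open>g (r x + x')\<close> in two ways, by linearity of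
    \<open>g\<close> and through \<open>\<sigma>\<close>, and cancels the common value of
    \<open>q\<close>.\<close>
  have tb: "t (r \<odot>\<^bsub>X\<^esub> x \<oplus>\<^bsub>X\<^esub> x') = b r x x' \<oplus>\<^bsub>Y\<^esub> (r \<odot>\<^bsub>Y\<^esub> t x \<oplus>\<^bsub>Y\<^esub> t x')"
    if *: "r \<in> carrier R" "x \<in> carrier X" "x' \<in> carrier X" for r x x'
  proof -
    let ?x = "r \<odot>\<^bsub>X\<^esub> x \<oplus>\<^bsub>X\<^esub> x'" and ?M = "middle U"
    have x: "?x \<in> carrier X" using * by simp
    note qcl = lmod_hom_closed[OF q \<sigma>]
    have iv: "(\<lambda>j\<in>J. incl (E' j) (v r x x' j)) \<in> carrier ?L"
    proof (rule lmod_sum_carrierI[OF _ fin])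
      have "incl (E' j) (v r x x' j) \<in> carrier (middle (E' j))" if j: "j \<in> J" for j
        using lmod_hom_closed[OF lmod_extension.incl_hom[OF EJ[OF j]] lmod_sum_nth[OF v[OF *] j]] .
      then show "(\<lambda>j\<in>J. incl (E' j) (v r x x' j)) \<in> (\<Pi>\<^sub>E j\<in>J. carrier (middle (E' j)))" by simp
      fix j assume j: "j \<in> J" "j \<notin> Pair X ` A"
      interpret Ej: lmod_extension R "fst j" Y "E' j" by (rule EJ[OF j(1)])
      show "(\<lambda>j\<in>J. incl (E' j) (v r x x' j)) j = \<zero>\<^bsub>middle (E' j)\<^esub>"
        using j notin[OF j(2)] by (auto simp: v_def)
    qed
    have "q (\<sigma> ?x) \<oplus>\<^bsub>?M\<^esub> incl U (t ?x) = r \<odot>\<^bsub>?M\<^esub> g x \<oplus>\<^bsub>?M\<^esub> g x'"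
      using gt[OF x] lmod_hom_lin[OF X g *] by simp
    also have "\<dots> = (r \<odot>\<^bsub>?M\<^esub> q (\<sigma> x) \<oplus>\<^bsub>?M\<^esub> q (\<sigma> x')) \<oplus>\<^bsub>?M\<^esub> incl U (r \<odot>\<^bsub>Y\<^esub> t x \<oplus>\<^bsub>Y\<^esub> t x')"
      using * by (simp add: gt t qcl U.M.smult_r_distr U.M.M.a_ac)
    also have "r \<odot>\<^bsub>?M\<^esub> q (\<sigma> x) \<oplus>\<^bsub>?M\<^esub> q (\<sigma> x') = q (\<sigma> ?x \<oplus>\<^bsub>?L\<^esub> (\<lambda>j\<in>J. incl (E' j) (v r x x' j)))"
      using * lmod_hom_lin[OF L q, of r "\<sigma> x" "\<sigma> x'"] by (simp add: \<sigma> \<sigma>v)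
    also have "\<dots> = q (\<sigma> ?x) \<oplus>\<^bsub>?M\<^esub> incl U (b r x x')"
      using lmod_hom_add[OF q \<sigma>[OF x] iv] by (simp add: q_incl[OF v[OF *]] sum_v[OF *])
    finally have "q (\<sigma> ?x) \<oplus>\<^bsub>?M\<^esub> incl U (t ?x) =
        q (\<sigma> ?x) \<oplus>\<^bsub>?M\<^esub> incl U (b r x x' \<oplus>\<^bsub>Y\<^esub> (r \<odot>\<^bsub>Y\<^esub> t x \<oplus>\<^bsub>Y\<^esub> t x'))"
      using * by (simp add: qcl[OF x] bcl t U.M.M.a_assoc)
    moreover have "b r x x' \<oplus>\<^bsub>Y\<^esub> (r \<odot>\<^bsub>Y\<^esub> t x \<oplus>\<^bsub>Y\<^esub> t x') \<in> carrier Y" using * by (simp add: bcl t)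
    \<comment> \<open>\<open>incl U\<close> is kept applied to the whole sum, so that cancellation
      leaves an equation between two of its values and injectivity finishes.\<close>
    ultimately show ?thesis
      using qcl[OF x] t[OF x] by (simp del: U.incl_simps(3,4) add: U.incl_simps(1))
  qed
  \<comment> \<open>In \<open>tb\<close> the term \<open>b\<close> stands on the opposite side from
    where \<open>factor_set_split\<close> expects it, hence the witness is
    \<open>- t\<close>.\<close>
  have "factor_set R X Y (split_ext X Y) b"
  proof (rule factor_set_split[OF X Y, where t = "\<lambda>x. \<ominus>\<^bsub>Y\<^esub> t x"])
    fix r x x' assume *: "r \<in> carrier R" "x \<in> carrier X" "x' \<in> carrier X"
    let ?c = "r \<odot>\<^bsub>Y\<^esub> t x \<oplus>\<^bsub>Y\<^esub> t x'"
    have c: "?c \<in> carrier Y" using * t by simp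
    have "\<ominus>\<^bsub>Y\<^esub> t (r \<odot>\<^bsub>X\<^esub> x \<oplus>\<^bsub>X\<^esub> x') \<oplus>\<^bsub>Y\<^esub> b r x x' = \<ominus>\<^bsub>Y\<^esub> ?c"
      using c bcl[OF *] by (simp add: tb[OF *] U.Y.M.minus_add U.Y.M.a_ac U.Y.M.r_neg2)
    also have "\<dots> = r \<odot>\<^bsub>Y\<^esub> (\<ominus>\<^bsub>Y\<^esub> t x) \<oplus>\<^bsub>Y\<^esub> \<ominus>\<^bsub>Y\<^esub> t x'"
      using * t by (simp add: U.Y.M.minus_add U.Y.smult_minus)
    finally show "r \<odot>\<^bsub>Y\<^esub> (\<ominus>\<^bsub>Y\<^esub> t x) \<oplus>\<^bsub>Y\<^esub> \<ominus>\<^bsub>Y\<^esub> t x' =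
      \<ominus>\<^bsub>Y\<^esub> t (r \<odot>\<^bsub>X\<^esub> x \<oplus>\<^bsub>X\<^esub> x') \<oplus>\<^bsub>Y\<^esub> b r x x'" by simp
  qed (use t bcl in auto)
  then have zero: "\<zero>\<^bsub>Ext1 R X Y\<^esub> = fs_class R X Y b"
    using V.ext_class_eq_fs_class[OF is_extension_split[OF X Y]] by (simp add: Ext1_def)
  have cls: "ext_class R X Y (E X i) = fs_class R X Y (a i)" "fs_class R X Y (a i) \<noteq> {}"
    if "i \<in> I X" for i
    using V.ext_class_eq_fs_class[OF extI[OF that] fs[OF that]] by auto
  have dcls: "d i \<odot>\<^bsub>Ext1 R X Y\<^esub> ext_class R X Y (E X i) =
      fs_class R X Y (\<lambda>r x x'. a i r (d i x) (d i x'))"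
    "fs_class R X Y (\<lambda>r x x'. a i r (d i x) (d i x')) \<noteq> {}" if "i \<in> A" for i
    using V.smult_Ext1[OF cls(2) d] cls(1) that AI by (simp_all add: subsetD)
  \<comment> \<open>The combination of the basis classes has factor set \<open>b\<close>, and so has
    the split sequence; hence it is zero.\<close>
  have "(\<Oplus>\<^bsub>Ext1 R X Y\<^esub>i\<in>A. d i \<odot>\<^bsub>Ext1 R X Y\<^esub> ext_class R X Y (E X i)) =
      (\<Oplus>\<^bsub>Ext1 R X Y\<^esub>i\<in>A. fs_class R X Y (\<lambda>r x x'. a i r (d i x) (d i x')))"
    by (rule abelian_monoid.finsum_cong'[OF V.Ext1_abelian_monoid])
      (use dcls in \<open>auto simp: V.carrier_Ext1\<close>)
  also have "\<dots> = fs_class R X Y b"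
    using V.finsum_Ext1[OF finA, of "\<lambda>i r x x'. a i r (d i x) (d i x')"] dcls(2) by (simp add: b_def[abs_def])
  finally have "(\<Oplus>\<^bsub>Ext1 R X Y\<^esub>i\<in>A. d i \<odot>\<^bsub>Ext1 R X Y\<^esub> ext_class R X Y (E X i)) = \<zero>\<^bsub>Ext1 R X Y\<^esub>"
    using zero by simp
  moreover have "d \<in> A \<rightarrow> carrier (End_ring R X)" using d AI by (auto simp: End_ring_def)
  ultimately have d0: "\<forall>i\<in>A. d i = \<zero>\<^bsub>End_ring R X\<^esub>"
    using basis finA AI unfolding lmod_basis_def by blast
  \<comment> \<open>Components indexed by \<open>A\<close> vanish with \<open>d\<close>, all others
    by \<open>fzero\<close>.\<close>
  have "f x = (\<lambda>j\<in>J. \<zero>\<^bsub>fst j\<^esub>)"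
  proof (rule extensionalityI[of _ J])
    show "f x \<in> extensional J" using lmod_hom_closed[OF f x] by (simp add: lmod_sum_simps PiE_iff)
    fix j assume j: "j \<in> J"
    show "f x j = (\<lambda>j\<in>J. \<zero>\<^bsub>fst j\<^esub>) j"
    proof (cases "fst j = X \<and> snd j \<in> A")
      case True
      have "j = (X, snd j)" using True by (cases j) auto
      then have "f x j = d (snd j) x" using x by (simp add: d_def)
      also have "\<dots> = \<zero>\<^bsub>X\<^esub>" using d0 True x by (simp add: End_ring_def zero_hom_def)
      finally show ?thesis using True j by simp
    qed (use fzero[OF j _ x] j in simp)
  qed simp
  then show ?thesis using x by (simp add: f_def fst lmod_sum_simps flip: J_def)
qed

section \<open>Homomorphisms into the direct limit\<close>

lemma transition_add:
  "transition \<phi> i (k + l) y = transition \<phi> (i + k) l (transition \<phi> i k y)"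
  by (induction l) (simp_all add: add.assoc)

lemma transition_extend:
  assumes "i + k = j + l" "transition \<phi> i k y = transition \<phi> j l z"
  shows "transition \<phi> i (k + m) y = transition \<phi> j (l + m) z"
  using assms by (simp add: transition_add)

text \<open>Eventual equality is transitive: advancing each of the two coincidences by the number of
  steps that the other one takes from \<open>y\<close> brings them to a common stage.\<close>

lemma dirlim_class_mono:
  assumes eq: "i + k = j + l" "transition \<phi> i k y = transition \<phi> j l z"
  shows "dirlim_class N \<phi> i y \<subseteq> dirlim_class N \<phi> j z"
proof
  fix p assume "p \<in> dirlim_class N \<phi> i y"
  then obtain m w k' l' where p: "p = (m, w)" "1 \<le> m" "w \<in> carrier (N m)" "i + k' = m + l'"
    "transition \<phi> i k' y = transition \<phi> m l' w" by (auto simp: dirlim_class_def)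
  have "transition \<phi> j (l + k') z = transition \<phi> i (k' + k) y"
    using transition_extend[OF eq, of k'] by (simp add: add.commute)
  also have "\<dots> = transition \<phi> m (l' + k) w"
    using transition_extend[OF p(4,5), of k] .
  finally have "transition \<phi> j (l + k') z = transition \<phi> m (l' + k) w" .
  moreover have "j + (l + k') = m + (l' + k)" using eq(1) p(4) by simp
  ultimately show "p \<in> dirlim_class N \<phi> j z" using p by (auto simp: dirlim_class_def)
qed

lemma dirlim_class_eqI:
  assumes "i + k = j + l" "transition \<phi> i k y = transition \<phi> j l z"
  shows "dirlim_class N \<phi> i y = dirlim_class N \<phi> j z"
  using dirlim_class_mono[OF assms] dirlim_class_mono[OF assms[symmetric]] by blast

lemma dirlim_class_transition:
  "dirlim_class N \<phi> (i + k) (transition \<phi> i k y) = dirlim_class N \<phi> i y"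
  by (rule dirlim_class_eqI[of _ 0 _ k]) simp_all

lemma dirlim_class_self:
  "\<lbrakk>1 \<le> i; y \<in> carrier (N i)\<rbrakk> \<Longrightarrow> (i, y) \<in> dirlim_class N \<phi> i y"
  by (auto simp: dirlim_class_def)

section \<open>Direct systems with injective transition maps\<close>

locale mono_direct_system =
  fixes R :: "('r, 'k) ring_scheme" and N :: "nat \<Rightarrow> ('r, 'y) module" and \<phi> :: "nat \<Rightarrow> 'y \<Rightarrow> 'y"
  assumes N: "1 \<le> i \<Longrightarrow> left_module R (N i)"
    and \<phi>: "1 \<le> i \<Longrightarrow> \<phi> i \<in> lmod_hom R (N i) (N (i + 1))"
    and \<phi>_inj: "1 \<le> i \<Longrightarrow> inj_on (\<phi> i) (carrier (N i))"
begin

abbreviation \<iota> where "\<iota> \<equiv> dirlim_class N \<phi>"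

lemma transition_closed:
  "\<lbrakk>1 \<le> i; y \<in> carrier (N i)\<rbrakk> \<Longrightarrow> transition \<phi> i k y \<in> carrier (N (i + k))"
  by (induction k) (use lmod_hom_closed[OF \<phi>] in \<open>auto\<close>)

lemma transition_add_hom:
  "\<lbrakk>1 \<le> i; y \<in> carrier (N i); z \<in> carrier (N i)\<rbrakk> \<Longrightarrow>
    transition \<phi> i k (y \<oplus>\<^bsub>N i\<^esub> z) = transition \<phi> i k y \<oplus>\<^bsub>N (i + k)\<^esub> transition \<phi> i k z"
  by (induction k) (use lmod_hom_add[OF \<phi>] transition_closed in auto)

lemma transition_smult:
  "\<lbrakk>1 \<le> i; r \<in> carrier R; y \<in> carrier (N i)\<rbrakk> \<Longrightarrow>
    transition \<phi> i k (r \<odot>\<^bsub>N i\<^esub> y) = r \<odot>\<^bsub>N (i + k)\<^esub> transition \<phi> i k y"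
  by (induction k) (use lmod_hom_smult[OF \<phi>] transition_closed in auto)

lemma transition_inj:
  "\<lbrakk>1 \<le> i; y \<in> carrier (N i); z \<in> carrier (N i); transition \<phi> i k y = transition \<phi> i k z\<rbrakk> \<Longrightarrow> y = z"
proof (induction k)
  case (Suc k)
  then show ?case
    using inj_onD[OF \<phi>_inj, of "i + k" "transition \<phi> i k y" "transition \<phi> i k z"] transition_closed
    by auto
qed simp

text \<open>Equality in the limit is equality after finitely many transitions, which are
  injective.\<close>

lemma \<iota>_inj:
  assumes "1 \<le> i" "y \<in> carrier (N i)" "z \<in> carrier (N i)" "\<iota> i y = \<iota> i z"
  shows "y = z"
proof -
  have "(i, z) \<in> \<iota> i y" using assms dirlim_class_self by simp
  then obtain k where "transition \<phi> i k y = transition \<phi> i k z" by (auto simp: dirlim_class_def)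
  then show ?thesis by (rule transition_inj[OF assms(1-3)])
qed

lemma dirlim_carrierE:
  assumes "C \<in> carrier (dirlim N \<phi>)"
  obtains i y where "1 \<le> i" "y \<in> carrier (N i)" "C = \<iota> i y"
  using assms by (auto simp: dirlim_def)

text \<open>The union over representatives is constant, since transitions commute with
  scalars.\<close>

lemma \<iota>_smult:
  assumes n: "1 \<le> n" "a \<in> carrier (N n)" and r: "r \<in> carrier R"
  shows "r \<odot>\<^bsub>dirlim N \<phi>\<^esub> \<iota> n a = \<iota> n (r \<odot>\<^bsub>N n\<^esub> a)"
proof -
  have eq: "\<iota> i (r \<odot>\<^bsub>N i\<^esub> y) = \<iota> n (r \<odot>\<^bsub>N n\<^esub> a)" if "(i, y) \<in> \<iota> n a" for i y
  proof -
    from that obtain k l where *: "1 \<le> i" "y \<in> carrier (N i)" "n + k = i + l"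
      "transition \<phi> n k a = transition \<phi> i l y" by (auto simp: dirlim_class_def)
    then show ?thesis using n r
      by (intro dirlim_class_eqI[of _ l _ k]) (simp_all add: transition_smult)
  qed
  have "(\<Union>(i, y)\<in>\<iota> n a. \<iota> i (r \<odot>\<^bsub>N i\<^esub> y)) = \<iota> n (r \<odot>\<^bsub>N n\<^esub> a)"
  proof (rule SUP_eq_const)
    show "\<iota> n a \<noteq> {}" using dirlim_class_self[of n a N, OF n] by blast
    fix p assume "p \<in> \<iota> n a"
    then show "(case p of (i, y) \<Rightarrow> \<iota> i (r \<odot>\<^bsub>N i\<^esub> y)) = \<iota> n (r \<odot>\<^bsub>N n\<^esub> a)"
      using eq[of "fst p" "snd p"] by (simp only: prod.collapse split_def)
  qed
  then show ?thesis by (simp add: dirlim_def)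
qed

lemma \<iota>_add:
  assumes n: "1 \<le> n" and a: "a \<in> carrier (N n)" and b: "b \<in> carrier (N n)"
  shows "\<iota> n a \<oplus>\<^bsub>dirlim N \<phi>\<^esub> \<iota> n b = \<iota> n (a \<oplus>\<^bsub>N n\<^esub> b)"
proof -
  have eq: "\<iota> (i + j) (transition \<phi> i j y \<oplus>\<^bsub>N (i + j)\<^esub> transition \<phi> j i z) = \<iota> n (a \<oplus>\<^bsub>N n\<^esub> b)"
    if iy: "(i, y) \<in> \<iota> n a" and jz: "(j, z) \<in> \<iota> n b" for i y j z
  proof -
    from iy obtain k l where y: "1 \<le> i" "y \<in> carrier (N i)" "n + k = i + l"
      "transition \<phi> n k a = transition \<phi> i l y" by (auto simp: dirlim_class_def)
    from jz obtain k' l' where z: "1 \<le> j" "z \<in> carrier (N j)" "n + k' = j + l'"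
      "transition \<phi> n k' b = transition \<phi> j l' z" by (auto simp: dirlim_class_def)
    \<comment> \<open>The stage \<open>?L\<close> steps after \<open>i + j\<close> is the stage
      \<open>?K\<close> steps after \<open>n\<close>, far enough for both coincidences to hold.
      \<open>K\<close> rewrites \<open>?K\<close> into the form that suits the second
      summand.\<close>
    let ?K = "k + (j + l')" and ?L = "l + l'"
    have K: "?K = k' + (i + l)" and nK: "(i + j) + ?L = n + ?K" using y(3) z(3) by simp_all
    have ty: "transition \<phi> (i + j) ?L (transition \<phi> i j y) = transition \<phi> n ?K a"
      using transition_extend[OF y(3,4), of "j + l'"] transition_add[of \<phi> i j ?L y]
      by (simp add: ac_simps)
    have tz: "transition \<phi> (i + j) ?L (transition \<phi> j i z) = transition \<phi> n ?K b"
      using transition_extend[OF z(3,4), of "i + l"] transition_add[of \<phi> j i ?L z] K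
      by (simp add: ac_simps)
    have yz: "transition \<phi> i j y \<in> carrier (N (i + j))" "transition \<phi> j i z \<in> carrier (N (i + j))"
      using transition_closed[OF y(1,2), of j] transition_closed[OF z(1,2), of i]
      by (simp_all add: add.commute)
    show ?thesis
      by (rule dirlim_class_eqI[OF nK])
        (use yz y n a b in \<open>simp only: transition_add_hom ty tz nK trans_le_add1\<close>)
  qed
  have "(\<Union>(i, y)\<in>\<iota> n a. \<Union>(j, z)\<in>\<iota> n b. \<iota> (i + j) (transition \<phi> i j y \<oplus>\<^bsub>N (i + j)\<^esub> transition \<phi> j i z)) = \<iota> n (a \<oplus>\<^bsub>N n\<^esub> b)"
  proof (rule SUP_eq_const)
    show "\<iota> n a \<noteq> {}" using dirlim_class_self[of n a N, OF n a] by blast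
    fix p assume p: "p \<in> \<iota> n a"
    have "(\<Union>(j, z)\<in>\<iota> n b. \<iota> (fst p + j) (transition \<phi> (fst p) j (snd p) \<oplus>\<^bsub>N (fst p + j)\<^esub>
        transition \<phi> j (fst p) z)) = \<iota> n (a \<oplus>\<^bsub>N n\<^esub> b)"
    proof (rule SUP_eq_const)
      show "\<iota> n b \<noteq> {}" using dirlim_class_self[of n b N, OF n b] by blast
      fix t assume "t \<in> \<iota> n b"
      then show "(case t of (j, z) \<Rightarrow> \<iota> (fst p + j) (transition \<phi> (fst p) j (snd p) \<oplus>\<^bsub>N (fst p + j)\<^esub>
          transition \<phi> j (fst p) z)) = \<iota> n (a \<oplus>\<^bsub>N n\<^esub> b)"
        using eq[of "fst p" "snd p" "fst t" "snd t"] p by (simp only: prod.collapse split_def)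
    qed
    then show "(case p of (i, y) \<Rightarrow> \<Union>(j, z)\<in>\<iota> n b. \<iota> (i + j) (transition \<phi> i j y \<oplus>\<^bsub>N (i + j)\<^esub> transition \<phi> j i z)) = \<iota> n (a \<oplus>\<^bsub>N n\<^esub> b)"
      by (simp only: split_def)
  qed
  then show ?thesis by (simp add: dirlim_def)
qed

lemma \<iota>_image_mono:
  assumes "1 \<le> i" "i \<le> j"
  shows "\<iota> i ` carrier (N i) \<subseteq> \<iota> j ` carrier (N j)"
proof
  fix C assume "C \<in> \<iota> i ` carrier (N i)"
  then obtain y where y: "y \<in> carrier (N i)" "C = \<iota> i y" by auto
  have "C = \<iota> j (transition \<phi> i (j - i) y)" "transition \<phi> i (j - i) y \<in> carrier (N j)"
    using assms y dirlim_class_transition[of N \<phi> i "j - i" y] transition_closed[OF assms(1) y(1), of "j - i"]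
    by simp_all
  then show "C \<in> \<iota> j ` carrier (N j)" by blast
qed

text \<open>Every generator is sent into some stage, the images of the stages increase, and the
  elements sent into a fixed stage form a submodule; the largest of finitely many stages therefore
  serves.\<close>

lemma hom_factors_through_stage:
  assumes R: "ring R" and X: "left_module R X" "finitely_presented R X"
    and f: "f \<in> lmod_hom R X (dirlim N \<phi>)"
  obtains n where "1 \<le> n" "f ` carrier X \<subseteq> \<iota> n ` carrier (N n)"
proof -
  interpret X: left_module R X by (rule X)
  obtain S where S: "finite S" "S \<subseteq> carrier X"
    "\<And>H. \<lbrakk>lmod_submodule R X H; S \<subseteq> H\<rbrakk> \<Longrightarrow> carrier X \<subseteq> H"
    using finitely_presented_generators[OF R X] by blast
  have "\<forall>s\<in>carrier X. \<exists>i. 1 \<le> i \<and> f s \<in> \<iota> i ` carrier (N i)"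
  proof
    fix s assume "s \<in> carrier X"
    then show "\<exists>i. 1 \<le> i \<and> f s \<in> \<iota> i ` carrier (N i)"
      by (rule dirlim_carrierE[OF lmod_hom_closed[OF f]]) auto
  qed
  then obtain k where k: "\<And>s. s \<in> carrier X \<Longrightarrow> 1 \<le> k s"
    "\<And>s. s \<in> carrier X \<Longrightarrow> f s \<in> \<iota> (k s) ` carrier (N (k s))" by metis
  \<comment> \<open>Inserting the stage of zero keeps the set non-empty when \<open>S\<close> is
    empty, and it also gives \<open>1 \<le> n\<close>.\<close>
  define n where "n = Max (insert (k \<zero>\<^bsub>X\<^esub>) (k ` S))"
  have le: "k s \<le> n" if "s \<in> insert \<zero>\<^bsub>X\<^esub> S" for s
    unfolding n_def using S(1) that by (auto intro!: Max_ge)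
  have n: "1 \<le> n" using le[of "\<zero>\<^bsub>X\<^esub>"] k(1)[of "\<zero>\<^bsub>X\<^esub>"] by simp
  have gen: "f s \<in> \<iota> n ` carrier (N n)" if "s \<in> insert \<zero>\<^bsub>X\<^esub> S" for s
    using \<iota>_image_mono[OF k(1) le, of s] k(2)[of s] that S(2) by auto
  interpret Nn: left_module R "N n" by (rule N[OF n])
  let ?H = "{x \<in> carrier X. f x \<in> \<iota> n ` carrier (N n)}"
  have "lmod_submodule R X ?H"
  proof
    show "\<zero>\<^bsub>X\<^esub> \<in> ?H" using gen by simp
    fix r x y assume r: "r \<in> carrier R" and "x \<in> ?H" "y \<in> ?H"
    then obtain a b where *: "x \<in> carrier X" "y \<in> carrier X" "a \<in> carrier (N n)" "b \<in> carrier (N n)"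
      "f x = \<iota> n a" "f y = \<iota> n b" by auto
    then have "f (r \<odot>\<^bsub>X\<^esub> x \<oplus>\<^bsub>X\<^esub> y) = \<iota> n (r \<odot>\<^bsub>N n\<^esub> a \<oplus>\<^bsub>N n\<^esub> b)"
      using r n by (simp add: lmod_hom_lin[OF X(1) f] \<iota>_smult \<iota>_add)
    then show "r \<odot>\<^bsub>X\<^esub> x \<oplus>\<^bsub>X\<^esub> y \<in> ?H" using r * by auto
  qed auto
  then have "carrier X \<subseteq> ?H" by (rule S(3)) (use gen S(2) in auto)
  then show ?thesis using that n by blast
qed

text \<open>Injectivity of \<open>\<iota> n\<close> makes preimages unique, so the values chosen
  pointwise inherit linearity from \<open>f\<close>.\<close>

lemma hom_to_stage:
  assumes X: "left_module R X" and f: "f \<in> lmod_hom R X (dirlim N \<phi>)"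
    and n: "1 \<le> n" and im: "f ` carrier X \<subseteq> \<iota> n ` carrier (N n)"
  obtains g where "g \<in> lmod_hom R X (N n)" "\<And>x. x \<in> carrier X \<Longrightarrow> \<iota> n (g x) = f x"
proof -
  interpret X: left_module R X by (rule X)
  interpret Nn: left_module R "N n" by (rule N[OF n])
  have "\<forall>x\<in>carrier X. \<exists>a. a \<in> carrier (N n) \<and> \<iota> n a = f x" 
    using im by (fastforce simp: image_subset_iff image_iff)
  from bchoice[OF this] obtain g where g: "\<And>x. x \<in> carrier X \<Longrightarrow> g x \<in> carrier (N n)"
    "\<And>x. x \<in> carrier X \<Longrightarrow> \<iota> n (g x) = f x" by blast
  have "(\<lambda>x\<in>carrier X. g x) \<in> lmod_hom R X (N n)"
  proof (rule lmod_homI[OF X N[OF n]])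
    fix r x y assume *: "r \<in> carrier R" "x \<in> carrier X" "y \<in> carrier X"
    have "\<iota> n (g (r \<odot>\<^bsub>X\<^esub> x \<oplus>\<^bsub>X\<^esub> y)) = r \<odot>\<^bsub>dirlim N \<phi>\<^esub> f x \<oplus>\<^bsub>dirlim N \<phi>\<^esub> f y"
      using * by (simp add: g lmod_hom_lin[OF X f])
    also have "\<dots> = r \<odot>\<^bsub>dirlim N \<phi>\<^esub> \<iota> n (g x) \<oplus>\<^bsub>dirlim N \<phi>\<^esub> \<iota> n (g y)" using * by (simp add: g)
    also have "\<dots> = \<iota> n (r \<odot>\<^bsub>N n\<^esub> g x \<oplus>\<^bsub>N n\<^esub> g y)"
      using * n g(1) by (simp add: \<iota>_smult \<iota>_add)
    finally have "g (r \<odot>\<^bsub>X\<^esub> x \<oplus>\<^bsub>X\<^esub> y) = r \<odot>\<^bsub>N n\<^esub> g x \<oplus>\<^bsub>N n\<^esub> g y"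
      by (rule \<iota>_inj[OF n, rotated 2]) (use * g(1) in auto)
    then show "(\<lambda>x\<in>carrier X. g x) (r \<odot>\<^bsub>X\<^esub> x \<oplus>\<^bsub>X\<^esub> y) =
      r \<odot>\<^bsub>N n\<^esub> (\<lambda>x\<in>carrier X. g x) x \<oplus>\<^bsub>N n\<^esub> (\<lambda>x\<in>carrier X. g x) y" using * by simp
  qed (use g in auto)
  then show ?thesis by (rule that) (simp add: g)
qed

end

section \<open>Descent from a finite stage to \<open>Y\<close>\<close>

theorem proposition4p5:
  fixes R :: "('r, 'k) ring_scheme"
    and \<X> :: "('r, 'x) module set"
    and Y :: "('r, 'y) module"
    and I :: "nat \<Rightarrow> ('r, 'x) module \<Rightarrow> 'i set"
    and E :: "nat \<Rightarrow> ('r, 'x) module \<Rightarrow> 'i \<Rightarrow> ('r, 'y, 'e, 'x) extension"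
    and N :: "nat \<Rightarrow> ('r, 'y) module"
    and \<phi> :: "nat \<Rightarrow> 'y \<Rightarrow> 'y"
    and X :: "('r, 'x) module"
    and f :: "'x \<Rightarrow> (nat \<times> 'y) set"
  assumes "ring R"
    and "semibrick R \<X>"
    and "left_module R Y"
    and "universal_system R \<X> Y I E N \<phi>"
    and "X \<in> \<X>"
    and "f \<in> lmod_hom R X (dirlim N \<phi>)"
  shows "f ` carrier X \<subseteq> dirlim_embedding N \<phi> ` carrier Y"
proof -
  have N1: "N 1 = Y" using assms(4) by (simp add: universal_system_def)
  have X: "left_module R X" "finitely_presented R X"
    using assms(2,5) by (auto simp: semibrick_def brick_def)
  have ses: "\<exists>p. universal_ses R \<X> (N i) (I i) (E i) \<lparr>middle = N (i + 1), incl = \<phi> i, proj = p\<rparr>"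
    if "1 \<le> i" for i
    using assms(4) that by (simp add: universal_system_def)
  have ext: "left_module R (N (i + 1))" "\<phi> i \<in> lmod_hom R (N i) (N (i + 1))"
    "inj_on (\<phi> i) (carrier (N i))" if "1 \<le> i" for i
    using ses[OF that] by (auto simp: universal_ses_def is_extension_def Let_def)
  \<comment> \<open>Stage \<open>1\<close> is \<open>Y\<close> itself; every later stage is the
    middle term of the sequence one index before, hence a module.\<close>
  have N: "left_module R (N i)" if i: "1 \<le> i" for i
  proof (cases "i = 1")
    case True
    then show ?thesis using assms(3) N1 by simp
  next
    case False
    then show ?thesis using ext(1)[of "i - 1"] i by simp
  qed
  interpret mono_direct_system R N \<phi> by (rule mono_direct_system.intro) (fact N ext)+
  \<comment> \<open>The induction lowers the stage by one. With the stage written as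
    \<open>Suc n\<close>, the irrelevant index \<open>0\<close> of the system is never touched and
    the base case is stage \<open>1\<close>.\<close>
  have "f ` carrier X \<subseteq> \<iota> 1 ` carrier (N 1)"
    if "f ` carrier X \<subseteq> \<iota> (Suc n) ` carrier (N (Suc n))" for n
    using that
  proof (induction n)
    case (Suc n)
    let ?n = "Suc n"
    obtain p where U: "universal_ses R \<X> (N ?n) (I ?n) (E ?n)
        \<lparr>middle = N (?n + 1), incl = \<phi> ?n, proj = p\<rparr>" using ses[of ?n] by auto
    obtain g where g: "g \<in> lmod_hom R X (N (?n + 1))" "\<And>x. x \<in> carrier X \<Longrightarrow> \<iota> (?n + 1) (g x) = f x"
      using hom_to_stage[OF X(1) assms(6), of "?n + 1"] Suc.prems by auto
    have ker: "\<phi> ?n ` carrier (N ?n) = {m \<in> carrier (N (?n + 1)).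
        p m = \<zero>\<^bsub>lmod_sum (Sigma \<X> (I ?n)) (\<lambda>(X, i). X)\<^esub>}"
      using U by (simp add: universal_ses_def Let_def is_extension_def)
    have "f ` carrier X \<subseteq> \<iota> ?n ` carrier (N ?n)"
    proof
      fix C assume "C \<in> f ` carrier X"
      then obtain x where x: "x \<in> carrier X" "C = f x" by auto
      \<comment> \<open>The sequence in question starts from \<open>N ?n\<close>, so the argument
        for one universal sequence applies with \<open>N ?n\<close> in the role of
        \<open>Y\<close>.\<close>
      have "p (g x) = \<zero>\<^bsub>lmod_sum (Sigma \<X> (I ?n)) (\<lambda>(X, i). X)\<^esub>"
        using universal_ses_proj_hom_zero[OF assms(1,2) N U assms(5) _ x(1)] g(1) by simp
      then have "g x \<in> \<phi> ?n ` carrier (N ?n)" using ker lmod_hom_closed[OF g(1) x(1)] by simp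
      then obtain y where y: "y \<in> carrier (N ?n)" "g x = \<phi> ?n y" by auto
      \<comment> \<open>One transition does not change the class in the limit, so \<open>f x\<close>
        already comes from stage \<open>?n\<close>.\<close>
      have "C = \<iota> ?n y"
        using g(2)[OF x(1)] x(2) y(2) dirlim_class_transition[of N \<phi> ?n 1 y] by simp
      then show "C \<in> \<iota> ?n ` carrier (N ?n)" using y(1) by blast
    qed
    then show ?case by (rule Suc.IH)
  qed simp
  moreover obtain n where "f ` carrier X \<subseteq> \<iota> (Suc n) ` carrier (N (Suc n))"
    using hom_factors_through_stage[OF assms(1) X assms(6)] by (metis Suc_le_D One_nat_def)
  ultimately have "f ` carrier X \<subseteq> \<iota> 1 ` carrier (N 1)" by blast
  then show ?thesis unfolding dirlim_embedding_def N1 by simp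
qed

end
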